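(* Let $K\subseteq[-1,1]$ be a set having $0$ as a limit point. If $$0\longrightarrow\mathcal{A}\overset{f}{\longrightarrow}\mathcal{B}\overset{g}{\longrightarrow}\mathcal{C}\longrightarrow 0$$ is a short exact sequence of C$^\ast$-algebras, then $$0\longrightarrow\hat{\mathcal{A}}_1\overset{\hat f|_{\hat{\mathcal{A}}_1}}{\longrightarrow}\hat{\mathcal{B}}_1\overset{\hat g|_{\hat{\mathcal{B}}_1}}{\longrightarrow}\hat{\mathcal{C}}_1\longrightarrow 0$$ is also a short exact sequence of C$^\ast$-algebras; i.e., the functor $\mathfrak{F}$ given by $\mathfrak{F}(\mathcal{A})=\hat{\mathcal{A}}_1$ and $\mathfrak{F}(f)=\hat f|_{\hat{\mathcal{A}}_1}$ is exact. Furthermore, if $\mathcal{I}$ is a closed ideal of a C$^\ast$-algebra $\mathcal{A}$, then $\widehat{(\mathcal{A}/\mathcal{I})}_1$ is $\ast$-isomorphic to $\hat{\mathcal{A}}_1/\hat{\mathcal{I}}_1$.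
   Context: All C$^\ast$-algebras are complex. For a C$^\ast$-algebra $\mathcal{A}$, $\mathcal{A}[Z]$ is the $\ast$-algebra of all formal power series $F(Z)=\sum_{n=0}^\infty a_nZ^n$ with $a_n\in\mathcal{A}$ and $\sum_{n=0}^\infty\|a_n\|<\infty$, with coefficientwise linear operations, Cauchy product, and involution $(\sum a_nZ^n)^\ast=\sum a_n^\ast Z^n$. For $t\in[-1,1]$, $F(t)=\sum_{n=0}^\infty a_nt^n\in\mathcal{A}$. The norm $\|F\|_K=\sup_{t\in K}\|F(t)\|$ makes $\mathcal{A}[Z]$ a pre-C$^\ast$-algebra, and its completion is the C$^\ast$-algebra $[\mathcal{A}]_K$. The ideal $\mathcal{A}_1=\{\sum a_nZ^n\in\mathcal{A}[Z]:a_0=0\}$ has completion (closure in $[\mathcal{A}]_K$) denoted $\hat{\mathcal{A}}_1$. A $\ast$-homomorphism $f:\mathcal{A}\to\mathcal{B}$ induces $\tilde f:\mathcal{A}[Z]\to\mathcal{B}[Z]$, $\tilde f(\sum a_nZ^n)=\sum f(a_n)Z^n$, and $\hat f:[\mathcal{A}]_K\to[\mathcal{B}]_K$ is its continuous extension; it maps $\hat{\mathcal{A}}_1$ into $\hat{\mathcal{B}}_1$. For a closed ideal $\mathcal{I}$ of $\mathcal{A}$, $\hat{\mathcal{I}}_1$ is regarded as a closed ideal of $\hat{\mathcal{A}}_1$ via the inclusion $\mathcal{I}[Z]\subseteq\mathcal{A}[Z]$. *)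

theory Defs
  imports
    "HOL-Analysis.Analysis"
    "HOL-Algebra.Module"
    "HOL-Algebra.QuotRing"
begin

section \<open>C*-algebras with explicit carriers\<close>

definition complex_ring :: "complex ring"
  where "complex_ring = \<lparr>carrier = UNIV, mult = (*), one = 1, zero = 0, add = (+)\<rparr>"

text \<open>
  Algebras need not be unital. The field \<^const>\<open>one\<close>, inherited from the library's ring
  records, is unconstrained and irrelevant everywhere below; so is the value of any operation
  outside the carrier.
\<close>

record 'a star_algebra = "(complex, 'a) module" +
  adj :: "'a \<Rightarrow> 'a"
  nrm :: "'a \<Rightarrow> real"

text \<open>
  The distance is truncated outside the carrier because the locale \<^locale>\<open>Metric_space\<close> requires
  non-negativity and symmetry on the whole type.
\<close>

definition ndist :: "('a, 'm) star_algebra_scheme \<Rightarrow> 'a \<Rightarrow> 'a \<Rightarrow> real"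
  where "ndist A x y =
    (if x \<in> carrier A \<and> y \<in> carrier A then nrm A (x \<ominus>\<^bsub>A\<^esub> y) else 0)"

abbreviation ntopology :: "('a, 'm) star_algebra_scheme \<Rightarrow> 'a topology"
  where "ntopology A \<equiv> Metric_space.mtopology (carrier A) (ndist A)"

locale pre_cstar_algebra = Module.module complex_ring A for A (structure) +
  assumes mult_closed: "\<lbrakk>x \<in> carrier A; y \<in> carrier A\<rbrakk> \<Longrightarrow> x \<otimes> y \<in> carrier A"
    and mult_assoc: "\<lbrakk>x \<in> carrier A; y \<in> carrier A; z \<in> carrier A\<rbrakk>
      \<Longrightarrow> (x \<otimes> y) \<otimes> z = x \<otimes> (y \<otimes> z)"
    and mult_add_left: "\<lbrakk>x \<in> carrier A; y \<in> carrier A; z \<in> carrier A\<rbrakk>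
      \<Longrightarrow> (x \<oplus> y) \<otimes> z = x \<otimes> z \<oplus> y \<otimes> z"
    and mult_add_right: "\<lbrakk>x \<in> carrier A; y \<in> carrier A; z \<in> carrier A\<rbrakk>
      \<Longrightarrow> z \<otimes> (x \<oplus> y) = z \<otimes> x \<oplus> z \<otimes> y"
    and smult_mult_left: "\<lbrakk>x \<in> carrier A; y \<in> carrier A\<rbrakk>
      \<Longrightarrow> (c \<odot> x) \<otimes> y = c \<odot> (x \<otimes> y)"
    and smult_mult_right: "\<lbrakk>x \<in> carrier A; y \<in> carrier A\<rbrakk>
      \<Longrightarrow> x \<otimes> (c \<odot> y) = c \<odot> (x \<otimes> y)"
    and adj_closed: "x \<in> carrier A \<Longrightarrow> adj A x \<in> carrier A"
    and adj_adj: "x \<in> carrier A \<Longrightarrow> adj A (adj A x) = x"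
    and adj_add: "\<lbrakk>x \<in> carrier A; y \<in> carrier A\<rbrakk> \<Longrightarrow> adj A (x \<oplus> y) = adj A x \<oplus> adj A y"
    and adj_smult: "x \<in> carrier A \<Longrightarrow> adj A (c \<odot> x) = cnj c \<odot> adj A x"
    and adj_mult: "\<lbrakk>x \<in> carrier A; y \<in> carrier A\<rbrakk> \<Longrightarrow> adj A (x \<otimes> y) = adj A y \<otimes> adj A x"
    and nrm_nonneg: "x \<in> carrier A \<Longrightarrow> 0 \<le> nrm A x"
    and nrm_eq_0_iff: "x \<in> carrier A \<Longrightarrow> nrm A x = 0 \<longleftrightarrow> x = \<zero>"
    and nrm_triangle: "\<lbrakk>x \<in> carrier A; y \<in> carrier A\<rbrakk> \<Longrightarrow> nrm A (x \<oplus> y) \<le> nrm A x + nrm A y"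
    and nrm_smult: "x \<in> carrier A \<Longrightarrow> nrm A (c \<odot> x) = cmod c * nrm A x"
    and nrm_mult: "\<lbrakk>x \<in> carrier A; y \<in> carrier A\<rbrakk> \<Longrightarrow> nrm A (x \<otimes> y) \<le> nrm A x * nrm A y"
    and cstar_identity: "x \<in> carrier A \<Longrightarrow> nrm A (adj A x \<otimes> x) = (nrm A x)\<^sup>2"

locale cstar_algebra = pre_cstar_algebra +
  assumes complete: "Metric_space.mcomplete (carrier A) (ndist A)"

definition star_hom ::
  "('a, 'm) star_algebra_scheme \<Rightarrow> ('b, 'n) star_algebra_scheme \<Rightarrow> ('a \<Rightarrow> 'b) set"
  where "star_hom A B = {f. f \<in> hom A B \<and> f \<in> hom (add_monoid A) (add_monoid B) \<and>
    (\<forall>x \<in> carrier A. (\<forall>c. f (c \<odot>\<^bsub>A\<^esub> x) = c \<odot>\<^bsub>B\<^esub> f x) \<and> f (adj A x) = adj B (f x))}"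

definition star_isomorphic ::
  "('a, 'm) star_algebra_scheme \<Rightarrow> ('b, 'n) star_algebra_scheme \<Rightarrow> bool"
  where "star_isomorphic A B \<longleftrightarrow> (\<exists>f \<in> star_hom A B. bij_betw f (carrier A) (carrier B))"

definition short_exact ::
  "('a, 'm) star_algebra_scheme \<Rightarrow> ('a \<Rightarrow> 'b) \<Rightarrow> ('b, 'n) star_algebra_scheme \<Rightarrow> ('b \<Rightarrow> 'c)
    \<Rightarrow> ('c, 'p) star_algebra_scheme \<Rightarrow> bool"
  where "short_exact A f B g C \<longleftrightarrow>
    cstar_algebra A \<and> cstar_algebra B \<and> cstar_algebra C \<and>
    f \<in> star_hom A B \<and> g \<in> star_hom B C \<and>
    inj_on f (carrier A) \<and> f ` carrier A = a_kernel B C g \<and> g ` carrier B = carrier C"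

definition closed_ideal :: "'a set \<Rightarrow> ('a, 'm) star_algebra_scheme \<Rightarrow> bool"
  where "closed_ideal I A \<longleftrightarrow> submodule I complex_ring A \<and>
    (\<forall>x \<in> I. \<forall>a \<in> carrier A. a \<otimes>\<^bsub>A\<^esub> x \<in> I \<and> x \<otimes>\<^bsub>A\<^esub> a \<in> I) \<and>
    closedin (ntopology A) I"

definition quotient_algebra :: "('a, 'm) star_algebra_scheme \<Rightarrow> 'a set \<Rightarrow> 'a set star_algebra"
  where "quotient_algebra A I =
    \<lparr>carrier = a_rcosets\<^bsub>A\<^esub> I, mult = rcoset_mult A I, one = undefined, zero = I, add = set_add A,
     smult = (\<lambda>c X. \<Union>x\<in>X. I +>\<^bsub>A\<^esub> (c \<odot>\<^bsub>A\<^esub> x)),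
     adj = (\<lambda>X. \<Union>x\<in>X. I +>\<^bsub>A\<^esub> adj A x),
     nrm = (\<lambda>X. INF x\<in>X. nrm A x)\<rparr>"


section \<open>Completion of a normed *-algebra\<close>

text \<open>
  The completion consists of the Cauchy sequences modulo null sequences. Operations on classes
  are unions over all representatives, following \<^theory>\<open>HOL.Equiv_Relations\<close>.
\<close>

abbreviation cauchy_seqs :: "('a, 'm) star_algebra_scheme \<Rightarrow> (nat \<Rightarrow> 'a) set"
  where "cauchy_seqs N \<equiv> Collect (Metric_space.MCauchy (carrier N) (ndist N))"

definition cauchy_rel :: "('a, 'm) star_algebra_scheme \<Rightarrow> ((nat \<Rightarrow> 'a) \<times> (nat \<Rightarrow> 'a)) set"
  where "cauchy_rel N = {(s, t). s \<in> cauchy_seqs N \<and> t \<in> cauchy_seqs N \<and>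
    (\<lambda>n. ndist N (s n) (t n)) \<longlonglongrightarrow> 0}"

definition completion :: "('a, 'm) star_algebra_scheme \<Rightarrow> (nat \<Rightarrow> 'a) set star_algebra"
  where "completion N =
    \<lparr>carrier = cauchy_seqs N // cauchy_rel N,
     mult = (\<lambda>X Y. \<Union>s\<in>X. \<Union>t\<in>Y. cauchy_rel N `` {\<lambda>n. s n \<otimes>\<^bsub>N\<^esub> t n}),
     one = undefined,
     zero = cauchy_rel N `` {\<lambda>n. \<zero>\<^bsub>N\<^esub>},
     add = (\<lambda>X Y. \<Union>s\<in>X. \<Union>t\<in>Y. cauchy_rel N `` {\<lambda>n. s n \<oplus>\<^bsub>N\<^esub> t n}),
     smult = (\<lambda>c X. \<Union>s\<in>X. cauchy_rel N `` {\<lambda>n. c \<odot>\<^bsub>N\<^esub> s n}),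
     adj = (\<lambda>X. \<Union>s\<in>X. cauchy_rel N `` {\<lambda>n. adj N (s n)}),
     nrm = (\<lambda>X. the_elem ((\<lambda>s. lim (\<lambda>n. nrm N (s n))) ` X))\<rparr>"

definition completion_embed :: "('a, 'm) star_algebra_scheme \<Rightarrow> 'a \<Rightarrow> (nat \<Rightarrow> 'a) set"
  where "completion_embed N x = cauchy_rel N `` {\<lambda>n. x}"

text \<open>
  The continuous extension of \<open>h\<close> to completions: the limit of \<open>s\<^sub>n\<close> is sent to the
  limit of \<open>h s\<^sub>n\<close>.
\<close>

definition completion_map ::
  "('a, 'm) star_algebra_scheme \<Rightarrow> ('b, 'n) star_algebra_scheme \<Rightarrow> ('a \<Rightarrow> 'b)
    \<Rightarrow> (nat \<Rightarrow> 'a) set \<Rightarrow> (nat \<Rightarrow> 'b) set"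
  where "completion_map M N h =
    (\<lambda>X \<in> carrier (completion M). \<Union>s\<in>X. cauchy_rel N `` {\<lambda>n. h (s n)})"


section \<open>Absolutely summable power series\<close>

definition ps_eval :: "('a, 'm) star_algebra_scheme \<Rightarrow> (nat \<Rightarrow> 'a) \<Rightarrow> real \<Rightarrow> 'a"
  where "ps_eval A F t = (THE x. limitin (ntopology A)
    (\<lambda>n. \<Oplus>\<^bsub>A\<^esub>k\<in>{..<n}. complex_of_real (t ^ k) \<odot>\<^bsub>A\<^esub> F k) x sequentially)"

text \<open>The pre-C*-algebra \<open>\<A>[Z]\<close> with the norm \<open>\<parallel>\<cdot>\<parallel>\<^sub>K\<close>.\<close>

definition power_series :: "real set \<Rightarrow> ('a, 'm) star_algebra_scheme \<Rightarrow> (nat \<Rightarrow> 'a) star_algebra"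
  where "power_series K A =
    \<lparr>carrier = {F. (\<forall>n. F n \<in> carrier A) \<and> summable (\<lambda>n. nrm A (F n))},
     mult = (\<lambda>F G n. \<Oplus>\<^bsub>A\<^esub>k\<in>{..n}. F k \<otimes>\<^bsub>A\<^esub> G (n - k)),
     one = undefined,
     zero = (\<lambda>n. \<zero>\<^bsub>A\<^esub>),
     add = (\<lambda>F G n. F n \<oplus>\<^bsub>A\<^esub> G n),
     smult = (\<lambda>c F n. c \<odot>\<^bsub>A\<^esub> F n),
     adj = (\<lambda>F n. adj A (F n)),
     nrm = (\<lambda>F. SUP t\<in>K. nrm A (ps_eval A F t))\<rparr>"

text \<open>The C*-algebra \<open>[\<A>]\<^sub>K\<close>.\<close>

definition ps_completion ::
  "real set \<Rightarrow> ('a, 'm) star_algebra_scheme \<Rightarrow> (nat \<Rightarrow> nat \<Rightarrow> 'a) set star_algebra"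
  where "ps_completion K A = completion (power_series K A)"

text \<open>The closure in \<open>[\<A>]\<^sub>K\<close> of the power series with zero constant term, that is,
  the algebra written \<open>\<A>\<close> with a hat and subscript 1.\<close>

definition hat1 ::
  "real set \<Rightarrow> ('a, 'm) star_algebra_scheme \<Rightarrow> (nat \<Rightarrow> nat \<Rightarrow> 'a) set star_algebra"
  where "hat1 K A = (ps_completion K A)\<lparr>carrier :=
    ntopology (ps_completion K A) closure_of
      (completion_embed (power_series K A) ` {F \<in> carrier (power_series K A). F 0 = \<zero>\<^bsub>A\<^esub>})\<rparr>"

definition hat_map ::
  "real set \<Rightarrow> ('a, 'm) star_algebra_scheme \<Rightarrow> ('b, 'n) star_algebra_scheme \<Rightarrow> ('a \<Rightarrow> 'b)
    \<Rightarrow> (nat \<Rightarrow> nat \<Rightarrow> 'a) set \<Rightarrow> (nat \<Rightarrow> nat \<Rightarrow> 'b) set"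
  where "hat_map K A B f =
    completion_map (power_series K A) (power_series K B) (\<lambda>F n. f (F n))"

definition hat1_map ::
  "real set \<Rightarrow> ('a, 'm) star_algebra_scheme \<Rightarrow> ('b, 'n) star_algebra_scheme \<Rightarrow> ('a \<Rightarrow> 'b)
    \<Rightarrow> (nat \<Rightarrow> nat \<Rightarrow> 'a) set \<Rightarrow> (nat \<Rightarrow> nat \<Rightarrow> 'b) set"
  where "hat1_map K A B f = restrict (hat_map K A B f) (carrier (hat1 K A))"

text \<open>
  For a closed ideal \<open>I\<close>, itself a C*-algebra \<open>A\<lparr>carrier := I\<rparr>\<close>, the algebra
  \<open>hat1 K (A\<lparr>carrier := I\<rparr>)\<close> consists of classes of sequences in \<open>I[Z]\<close> only. It
  becomes a subset of \<open>hat1 K A\<close> through the map induced by the inclusion of \<open>I\<close> in \<open>A\<close>.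
\<close>

definition hat1_ideal ::
  "real set \<Rightarrow> ('a, 'm) star_algebra_scheme \<Rightarrow> 'a set \<Rightarrow> (nat \<Rightarrow> nat \<Rightarrow> 'a) set set"
  where "hat1_ideal K A I =
    hat1_map K (A\<lparr>carrier := I\<rparr>) A (\<lambda>x. x) ` carrier (hat1 K (A\<lparr>carrier := I\<rparr>))"

end

theory Submission
  imports Defs
begin

text \<open>
  No spectral theory is needed. A self-adjoint \<open>x\<close> of norm less than \<open>1\<close> has a self-adjoint
  \<open>s\<close> in the double commutant with \<open>(1 - s)\<^sup>2 = 1 - x\<^sup>2\<close>, found as a fixed point; thus
  \<open>x \<plusminus> i (1 - s)\<close> are unitary multipliers with mean \<open>x\<close>. Homomorphisms preserve this relation,
  so they are contractive and bijective ones are isometric. The same trick shows that closed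
  ideals have approximate units acting by contractions \<open>1 - u\<close>, whence quotients are
  C*-algebras and \<open>\<parallel>g b\<parallel>\<close> is the quotient norm for every surjection \<open>g\<close>.

  For the exactness of the functor, a power series \<open>F\<close> over the quotient is lifted
  coefficientwise to \<open>G\<close> and then corrected to \<open>G (1 - u)\<close> with \<open>u\<close> in the kernel of \<open>g\<close>. As \<open>G\<close>
  is uniformly continuous on \<open>[-1, 1]\<close>, it suffices to choose \<open>u\<close> for finitely many values of
  \<open>G\<close>, which bounds the norm of the lift by that of \<open>F\<close>. Cauchy sequences can then be lifted to
  Cauchy sequences and moved into the kernel by small corrections.
\<close>

section \<open>Star-algebras\<close>

text \<open>Exactness is delicate because the norm of \<open>power_series K\<close> sees only the
  values on \<open>K\<close>. Lifting coefficients with a norm bound controls the sum of the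
  coefficient norms, and in general that sum is not bounded by a multiple of the sup norm.
  Multiplying all coefficients on the right by one \<open>1 - u\<close> repairs this: the result
  stays absolutely summable, keeps a zero constant term, is still a lift because \<open>u\<close>
  lies in the kernel, and its values are the old values times \<open>1 - u\<close>. Some fixed
  constant in the final bound is enough, since Cauchy sequences are lifted along geometrically
  convergent subsequences; the constant is 2 throughout.

  In the absence of a unit, \<open>1 - u\<close> and \<open>r - a\<close> occur only as the right
  multiplications \<open>z - z u\<close> and \<open>r z - z a\<close>, and the norm of an element is
  read off from its action on the whole algebra. The square roots are taken in the double commutant
  so that several of them commute: only then is a product of roots again self-adjoint and usable as
  the imaginary part of a multiple of a unitary.\<close>

lemma complex_ring_simps [simp]:
  "carrier complex_ring = UNIV" "mult complex_ring = (*)" "one complex_ring = 1"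
  "zero complex_ring = 0" "add complex_ring = (+)"
  by (simp_all add: complex_ring_def)

lemma cring_complex_ring: "cring complex_ring"
proof (rule cringI)
  show "abelian_group complex_ring"
    by (rule abelian_groupI) (auto simp: algebra_simps intro: exI[of _ "- x" for x])
  show "comm_monoid complex_ring"
    by (rule comm_monoidI) (auto simp: algebra_simps)
qed (auto simp: algebra_simps)

lemma complex_ring_a_inv [simp]: "\<ominus>\<^bsub>complex_ring\<^esub> c = - c"
proof -
  interpret cring complex_ring by (rule cring_complex_ring)
  have "- c \<oplus>\<^bsub>complex_ring\<^esub> c = \<zero>\<^bsub>complex_ring\<^esub>" by simp
  then show ?thesis using minus_equality[of "- c" c] by simp
qed

locale star_algebra_laws = Module.module complex_ring A for A (structure) +
  assumes mult_closed [simp]: "\<lbrakk>x \<in> carrier A; y \<in> carrier A\<rbrakk> \<Longrightarrow> x \<otimes> y \<in> carrier A"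
    and mult_assoc: "\<lbrakk>x \<in> carrier A; y \<in> carrier A; z \<in> carrier A\<rbrakk>
      \<Longrightarrow> (x \<otimes> y) \<otimes> z = x \<otimes> (y \<otimes> z)"
    and mult_add_left: "\<lbrakk>x \<in> carrier A; y \<in> carrier A; z \<in> carrier A\<rbrakk>
      \<Longrightarrow> (x \<oplus> y) \<otimes> z = x \<otimes> z \<oplus> y \<otimes> z"
    and mult_add_right: "\<lbrakk>x \<in> carrier A; y \<in> carrier A; z \<in> carrier A\<rbrakk>
      \<Longrightarrow> z \<otimes> (x \<oplus> y) = z \<otimes> x \<oplus> z \<otimes> y"
    and smult_mult_left: "\<lbrakk>x \<in> carrier A; y \<in> carrier A\<rbrakk>
      \<Longrightarrow> (c \<odot> x) \<otimes> y = c \<odot> (x \<otimes> y)"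
    and smult_mult_right: "\<lbrakk>x \<in> carrier A; y \<in> carrier A\<rbrakk>
      \<Longrightarrow> x \<otimes> (c \<odot> y) = c \<odot> (x \<otimes> y)"
    and adj_closed [simp]: "x \<in> carrier A \<Longrightarrow> adj A x \<in> carrier A"
    and adj_adj [simp]: "x \<in> carrier A \<Longrightarrow> adj A (adj A x) = x"
    and adj_add: "\<lbrakk>x \<in> carrier A; y \<in> carrier A\<rbrakk> \<Longrightarrow> adj A (x \<oplus> y) = adj A x \<oplus> adj A y"
    and adj_smult: "x \<in> carrier A \<Longrightarrow> adj A (c \<odot> x) = cnj c \<odot> adj A x"
    and adj_mult: "\<lbrakk>x \<in> carrier A; y \<in> carrier A\<rbrakk> \<Longrightarrow> adj A (x \<otimes> y) = adj A y \<otimes> adj A x"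
begin

lemma smult_in [simp]: "x \<in> carrier A \<Longrightarrow> c \<odot> x \<in> carrier A"
  by (rule smult_closed) auto

lemma smult_add_left: "x \<in> carrier A \<Longrightarrow> (a + b) \<odot> x = a \<odot> x \<oplus> b \<odot> x"
  using smult_l_distr[of a b x] by simp

lemma smult_add_right: "x \<in> carrier A \<Longrightarrow> y \<in> carrier A \<Longrightarrow> a \<odot> (x \<oplus> y) = a \<odot> x \<oplus> a \<odot> y"
  using smult_r_distr[of a x y] by simp

lemma smult_smult: "x \<in> carrier A \<Longrightarrow> a \<odot> (b \<odot> x) = (a * b) \<odot> x"
  using smult_assoc1[of a b x] by simp

lemma smult_1 [simp]: "x \<in> carrier A \<Longrightarrow> 1 \<odot> x = x"
  using smult_one[of x] by simp

lemma smult_0 [simp]: "x \<in> carrier A \<Longrightarrow> 0 \<odot> x = \<zero>"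
  using smult_l_null[of x] by simp

lemma smult_zero [simp]: "c \<odot> \<zero> = \<zero>"
  using smult_r_null[of c] by simp

lemma a_inv_smult: "x \<in> carrier A \<Longrightarrow> \<ominus> x = (- 1) \<odot> x"
  using smult_l_minus[of 1 x] by simp

lemma minus_smult: "x \<in> carrier A \<Longrightarrow> y \<in> carrier A \<Longrightarrow> x \<ominus> y = x \<oplus> (- 1) \<odot> y"
  by (simp add: minus_eq a_inv_smult)

text \<open>
  Linear identities in at most four vectors are proved by rewriting every vector as a value of
  one opaque function of its coordinates.
\<close>

definition coords :: "(complex \<Rightarrow> complex \<Rightarrow> complex \<Rightarrow> complex \<Rightarrow> 'a) \<Rightarrow> 'a \<Rightarrow> 'a \<Rightarrow> 'a \<Rightarrow> 'a \<Rightarrow> bool"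
  where "coords L x y z w \<longleftrightarrow> x = L 1 0 0 0 \<and> y = L 0 1 0 0 \<and> z = L 0 0 1 0 \<and> w = L 0 0 0 1 \<and>
    \<zero> = L 0 0 0 0 \<and>
    (\<forall>a b c d a' b' c' d'. L a b c d \<oplus> L a' b' c' d' = L (a + a') (b + b') (c + c') (d + d')) \<and>
    (\<forall>a b c d a' b' c' d'. L a b c d \<ominus> L a' b' c' d' = L (a - a') (b - b') (c - c') (d - d')) \<and>
    (\<forall>a b c d. \<ominus> L a b c d = L (- a) (- b) (- c) (- d)) \<and>
    (\<forall>r a b c d. r \<odot> L a b c d = L (r * a) (r * b) (r * c) (r * d)) \<and>
    (\<forall>a b c d. L a b c d \<in> carrier A)"

lemma coordsD:
  assumes "coords L x y z w"
  shows "x = L 1 0 0 0" "y = L 0 1 0 0" "z = L 0 0 1 0" "w = L 0 0 0 1" "\<zero> = L 0 0 0 0"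
    "\<And>a b c d a' b' c' d'. L a b c d \<oplus> L a' b' c' d' = L (a + a') (b + b') (c + c') (d + d')"
    "\<And>a b c d a' b' c' d'. L a b c d \<ominus> L a' b' c' d' = L (a - a') (b - b') (c - c') (d - d')"
    "\<And>a b c d. \<ominus> L a b c d = L (- a) (- b) (- c) (- d)"
    "\<And>r a b c d. r \<odot> L a b c d = L (r * a) (r * b) (r * c) (r * d)"
    "\<And>a b c d. L a b c d \<in> carrier A"
  using assms by (simp_all add: coords_def)

lemma linear4:
  assumes "x \<in> carrier A" "y \<in> carrier A" "z \<in> carrier A" "w \<in> carrier A"
  obtains L where "coords L x y z w"
proof
  define L where "L a b c d = a \<odot> x \<oplus> (b \<odot> y \<oplus> (c \<odot> z \<oplus> d \<odot> w))" for a b c d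
  have cl: "L a b c d \<in> carrier A" for a b c d
    by (simp add: L_def assms)
  have add: "L a b c d \<oplus> L a' b' c' d' = L (a + a') (b + b') (c + c') (d + d')"
    for a b c d a' b' c' d'
    by (simp add: L_def smult_add_left assms a_ac)
  have sm: "r \<odot> L a b c d = L (r * a) (r * b) (r * c) (r * d)" for r a b c d
    by (simp add: L_def smult_add_right smult_smult assms)
  have inv: "\<ominus> L a b c d = L (- a) (- b) (- c) (- d)" for a b c d
    by (simp add: a_inv_smult cl sm)
  have minus: "L a b c d \<ominus> L a' b' c' d' = L (a - a') (b - b') (c - c') (d - d')"
    for a b c d a' b' c' d'
    by (simp add: minus_smult cl sm add)
  have "x = L 1 0 0 0" "y = L 0 1 0 0" "z = L 0 0 1 0" "w = L 0 0 0 1" "\<zero> = L 0 0 0 0"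
    by (simp_all add: L_def assms)
  then show "coords L x y z w"
    unfolding coords_def using cl add sm inv minus by blast
qed

lemma minus_in [simp]: "x \<in> carrier A \<Longrightarrow> y \<in> carrier A \<Longrightarrow> x \<ominus> y \<in> carrier A"
  by (simp add: minus_smult)

lemma minus_zero_right [simp]: "x \<in> carrier A \<Longrightarrow> x \<ominus> \<zero> = x"
  by (simp add: minus_smult)

lemma zero_mult [simp]: "x \<in> carrier A \<Longrightarrow> \<zero> \<otimes> x = \<zero>"
  using smult_mult_left[of \<zero> x 0] by simp

lemma mult_zero [simp]: "x \<in> carrier A \<Longrightarrow> x \<otimes> \<zero> = \<zero>"
  using smult_mult_right[of x \<zero> 0] by simp

lemma adj_zero [simp]: "adj A \<zero> = \<zero>"
  using adj_smult[of \<zero> 0] by simp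

lemma mult_minus_left: "x \<in> carrier A \<Longrightarrow> y \<in> carrier A \<Longrightarrow> z \<in> carrier A
    \<Longrightarrow> (x \<ominus> y) \<otimes> z = x \<otimes> z \<ominus> y \<otimes> z"
  by (simp add: minus_smult mult_add_left smult_mult_left)

lemma mult_minus_right: "x \<in> carrier A \<Longrightarrow> y \<in> carrier A \<Longrightarrow> z \<in> carrier A
    \<Longrightarrow> z \<otimes> (x \<ominus> y) = z \<otimes> x \<ominus> z \<otimes> y"
  by (simp add: minus_smult mult_add_right smult_mult_right)

lemma adj_minus: "x \<in> carrier A \<Longrightarrow> y \<in> carrier A \<Longrightarrow> adj A (x \<ominus> y) = adj A x \<ominus> adj A y"
  by (simp add: minus_smult adj_add adj_smult)

lemma smult_minus: "x \<in> carrier A \<Longrightarrow> y \<in> carrier A \<Longrightarrow> c \<odot> (x \<ominus> y) = c \<odot> x \<ominus> c \<odot> y"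
  by (simp add: minus_smult smult_add_right smult_smult)

lemma minus_eq_zero_iff: "x \<in> carrier A \<Longrightarrow> y \<in> carrier A \<Longrightarrow> x \<ominus> y = \<zero> \<longleftrightarrow> x = y"
  using add.inv_solve_right[of \<zero> x y] by (auto simp: minus_eq)

end

section \<open>Transfer of the algebraic laws\<close>

lemma star_algebra_lawsI:
  fixes A (structure)
  assumes "\<And>x y. x \<in> carrier A \<Longrightarrow> y \<in> carrier A \<Longrightarrow> x \<oplus> y \<in> carrier A"
    and "\<zero> \<in> carrier A"
    and "\<And>x y z. x \<in> carrier A \<Longrightarrow> y \<in> carrier A \<Longrightarrow> z \<in> carrier A \<Longrightarrow> (x \<oplus> y) \<oplus> z = x \<oplus> (y \<oplus> z)"
    and "\<And>x y. x \<in> carrier A \<Longrightarrow> y \<in> carrier A \<Longrightarrow> x \<oplus> y = y \<oplus> x"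
    and "\<And>x. x \<in> carrier A \<Longrightarrow> \<zero> \<oplus> x = x"
    and "\<And>x. x \<in> carrier A \<Longrightarrow> (- 1) \<odot> x \<oplus> x = \<zero>"
    and "\<And>c x. x \<in> carrier A \<Longrightarrow> c \<odot> x \<in> carrier A"
    and "\<And>a b x. x \<in> carrier A \<Longrightarrow> (a + b) \<odot> x = a \<odot> x \<oplus> b \<odot> x"
    and "\<And>a x y. x \<in> carrier A \<Longrightarrow> y \<in> carrier A \<Longrightarrow> a \<odot> (x \<oplus> y) = a \<odot> x \<oplus> a \<odot> y"
    and "\<And>a b x. x \<in> carrier A \<Longrightarrow> (a * b) \<odot> x = a \<odot> (b \<odot> x)"
    and "\<And>x. x \<in> carrier A \<Longrightarrow> 1 \<odot> x = x"
    and "star_algebra_laws_axioms A"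
  shows "star_algebra_laws A"
proof -
  have "abelian_group A"
    by (rule abelian_groupI[OF assms(1-5)]) (use assms(6,7) in blast)+
  then have "Module.module complex_ring A"
    by (rule moduleI[OF cring_complex_ring]) (use assms(7-11) in auto)
  then show ?thesis using assms(12) by (rule star_algebra_laws.intro)
qed

text \<open>
  The locale \<^locale>\<open>pre_cstar_algebra\<close>, regrouped so that the algebraic laws can be
  transferred on their own.
\<close>

locale pre_cstar = star_algebra_laws +
  assumes nrm_nonneg [simp]: "x \<in> carrier A \<Longrightarrow> 0 \<le> nrm A x"
    and nrm_eq_0_iff [simp]: "x \<in> carrier A \<Longrightarrow> nrm A x = 0 \<longleftrightarrow> x = \<zero>"
    and nrm_triangle: "\<lbrakk>x \<in> carrier A; y \<in> carrier A\<rbrakk> \<Longrightarrow> nrm A (x \<oplus> y) \<le> nrm A x + nrm A y"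
    and nrm_smult [simp]: "x \<in> carrier A \<Longrightarrow> nrm A (c \<odot> x) = cmod c * nrm A x"
    and nrm_mult: "\<lbrakk>x \<in> carrier A; y \<in> carrier A\<rbrakk> \<Longrightarrow> nrm A (x \<otimes> y) \<le> nrm A x * nrm A y"
    and cstar_identity: "x \<in> carrier A \<Longrightarrow> nrm A (adj A x \<otimes> x) = (nrm A x)\<^sup>2"

lemma pre_cstar_iff: "pre_cstar A \<longleftrightarrow> pre_cstar_algebra A"
  by (auto simp: pre_cstar_def pre_cstar_axioms_def star_algebra_laws_def
      star_algebra_laws_axioms_def pre_cstar_algebra_def pre_cstar_algebra_axioms_def)

text \<open>The laws are equations, so they may be checked after applying a family of homomorphisms
  \<open>e t\<close> that separates points. The family consists of evaluations for power series, of
  entries for sequences, and of the inclusion for subalgebras.\<close>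

lemma star_algebra_laws_inherit_inj:
  fixes A :: "('a, 'm) star_algebra_scheme" and Q :: "('q, 'n) star_algebra_scheme"
  assumes "star_algebra_laws A"
    and e: "\<And>t x. t \<in> T \<Longrightarrow> x \<in> carrier Q \<Longrightarrow> e t x \<in> carrier A"
    and inj: "\<And>x y. x \<in> carrier Q \<Longrightarrow> y \<in> carrier Q \<Longrightarrow> (\<And>t. t \<in> T \<Longrightarrow> e t x = e t y) \<Longrightarrow> x = y"
    and zero: "\<zero>\<^bsub>Q\<^esub> \<in> carrier Q" "\<And>t. t \<in> T \<Longrightarrow> e t \<zero>\<^bsub>Q\<^esub> = \<zero>\<^bsub>A\<^esub>"
    and add: "\<And>x y. x \<in> carrier Q \<Longrightarrow> y \<in> carrier Q \<Longrightarrow> x \<oplus>\<^bsub>Q\<^esub> y \<in> carrier Q"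
      "\<And>t x y. t \<in> T \<Longrightarrow> x \<in> carrier Q \<Longrightarrow> y \<in> carrier Q \<Longrightarrow> e t (x \<oplus>\<^bsub>Q\<^esub> y) = e t x \<oplus>\<^bsub>A\<^esub> e t y"
    and mult: "\<And>x y. x \<in> carrier Q \<Longrightarrow> y \<in> carrier Q \<Longrightarrow> x \<otimes>\<^bsub>Q\<^esub> y \<in> carrier Q"
      "\<And>t x y. t \<in> T \<Longrightarrow> x \<in> carrier Q \<Longrightarrow> y \<in> carrier Q \<Longrightarrow> e t (x \<otimes>\<^bsub>Q\<^esub> y) = e t x \<otimes>\<^bsub>A\<^esub> e t y"
    and smult: "\<And>c x. x \<in> carrier Q \<Longrightarrow> c \<odot>\<^bsub>Q\<^esub> x \<in> carrier Q"
      "\<And>t c x. t \<in> T \<Longrightarrow> x \<in> carrier Q \<Longrightarrow> e t (c \<odot>\<^bsub>Q\<^esub> x) = c \<odot>\<^bsub>A\<^esub> e t x"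
    and adj: "\<And>x. x \<in> carrier Q \<Longrightarrow> adj Q x \<in> carrier Q"
      "\<And>t x. t \<in> T \<Longrightarrow> x \<in> carrier Q \<Longrightarrow> e t (adj Q x) = adj A (e t x)"
  shows "star_algebra_laws Q"
proof -
  interpret A: star_algebra_laws A by fact
  note simps = e zero add mult smult adj A.mult_assoc A.mult_add_left A.mult_add_right
    A.smult_mult_left A.smult_mult_right A.adj_add A.adj_smult A.adj_mult A.smult_add_left
    A.smult_add_right A.smult_smult
  show ?thesis
  proof (rule star_algebra_lawsI)
    show "star_algebra_laws_axioms Q"
      by (rule star_algebra_laws_axioms.intro; (simp add: simps)?; rule inj; simp add: simps)
    show "(- 1) \<odot>\<^bsub>Q\<^esub> x \<oplus>\<^bsub>Q\<^esub> x = \<zero>\<^bsub>Q\<^esub>" if "x \<in> carrier Q" for x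
      by (rule inj) (use that in \<open>simp_all add: simps A.l_neg flip: A.a_inv_smult\<close>)
  qed ((simp add: simps)?; rule inj; simp add: simps A.a_ac)+
qed

text \<open>Equations also pass to images under maps that respect the operations. This serves the
  quotient by an ideal and the classes of Cauchy sequences.\<close>

lemma star_algebra_laws_inherit_surj:
  fixes A :: "('a, 'm) star_algebra_scheme" and Q :: "('q, 'n) star_algebra_scheme"
  assumes "star_algebra_laws A"
    and surj: "p ` carrier A = carrier Q"
    and zero: "\<zero>\<^bsub>Q\<^esub> = p \<zero>\<^bsub>A\<^esub>"
    and add: "\<And>x y. x \<in> carrier A \<Longrightarrow> y \<in> carrier A \<Longrightarrow> p x \<oplus>\<^bsub>Q\<^esub> p y = p (x \<oplus>\<^bsub>A\<^esub> y)"
    and mult: "\<And>x y. x \<in> carrier A \<Longrightarrow> y \<in> carrier A \<Longrightarrow> p x \<otimes>\<^bsub>Q\<^esub> p y = p (x \<otimes>\<^bsub>A\<^esub> y)"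
    and smult: "\<And>c x. x \<in> carrier A \<Longrightarrow> c \<odot>\<^bsub>Q\<^esub> p x = p (c \<odot>\<^bsub>A\<^esub> x)"
    and adj: "\<And>x. x \<in> carrier A \<Longrightarrow> adj Q (p x) = p (adj A x)"
  shows "star_algebra_laws Q"
proof -
  interpret A: star_algebra_laws A by fact
  note simps = zero add mult smult adj A.mult_assoc A.mult_add_left A.mult_add_right
    A.smult_mult_left A.smult_mult_right A.adj_add A.adj_smult A.adj_mult A.smult_add_left
    A.smult_add_right A.smult_smult
  show ?thesis
  proof (rule star_algebra_lawsI)
    show "star_algebra_laws_axioms Q"
      by (rule star_algebra_laws_axioms.intro) (auto simp: simps simp flip: surj)
    show "(- 1) \<odot>\<^bsub>Q\<^esub> x \<oplus>\<^bsub>Q\<^esub> x = \<zero>\<^bsub>Q\<^esub>" if "x \<in> carrier Q" for x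
      using that by (auto simp: simps A.l_neg simp flip: surj A.a_inv_smult)
  qed (auto simp: simps A.a_ac simp flip: surj)
qed

section \<open>Convergence\<close>

text \<open>These versions of the metric notions avoid the truncated distance \<open>ndist\<close>
  and have membership of all terms built in; \<open>MCauchy_iff\<close> and
  \<open>limitin_iff_conv\<close> connect the two views.\<close>

definition cauchy :: "('a, 'm) star_algebra_scheme \<Rightarrow> (nat \<Rightarrow> 'a) \<Rightarrow> bool"
  where "cauchy A s \<longleftrightarrow> (\<forall>n. s n \<in> carrier A) \<and>
    (\<forall>e>0. \<exists>N. \<forall>m\<ge>N. \<forall>n\<ge>N. nrm A (s m \<ominus>\<^bsub>A\<^esub> s n) < e)"

definition conv :: "('a, 'm) star_algebra_scheme \<Rightarrow> (nat \<Rightarrow> 'a) \<Rightarrow> 'a \<Rightarrow> bool"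
  where "conv A s x \<longleftrightarrow> (\<forall>n. s n \<in> carrier A) \<and> x \<in> carrier A \<and>
    (\<lambda>n. nrm A (s n \<ominus>\<^bsub>A\<^esub> x)) \<longlonglongrightarrow> 0"

context pre_cstar
begin

lemma nrm_zero [simp]: "nrm A \<zero> = 0"
  by simp

lemma nrm_uminus [simp]: "x \<in> carrier A \<Longrightarrow> nrm A (\<ominus> x) = nrm A x"
  by (simp add: a_inv_smult)

lemma nrm_minus_commute: "x \<in> carrier A \<Longrightarrow> y \<in> carrier A \<Longrightarrow> nrm A (x \<ominus> y) = nrm A (y \<ominus> x)"
proof -
  assume "x \<in> carrier A" "y \<in> carrier A"
  then have "x \<ominus> y = \<ominus> (y \<ominus> x)"
    by (simp add: minus_eq minus_add a_comm)
  with \<open>x \<in> carrier A\<close> \<open>y \<in> carrier A\<close> show ?thesis by simp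
qed

lemma nrm_minus_le: "x \<in> carrier A \<Longrightarrow> y \<in> carrier A \<Longrightarrow> nrm A (x \<ominus> y) \<le> nrm A x + nrm A y"
  using nrm_triangle[of x "\<ominus> y"] by (simp add: minus_eq)

lemma nrm_minus_triangle:
  assumes "x \<in> carrier A" "y \<in> carrier A" "z \<in> carrier A"
  shows "nrm A (x \<ominus> z) \<le> nrm A (x \<ominus> y) + nrm A (y \<ominus> z)"
proof -
  obtain L where L: "coords L x y z x"
    using linear4[OF assms assms(1)] .
  note L = coordsD[OF L]
  have "x \<ominus> z = (x \<ominus> y) \<oplus> (y \<ominus> z)"
    by (simp add: L)
  then show ?thesis using nrm_triangle[of "x \<ominus> y" "y \<ominus> z"] assms by simp
qed

lemma nrm_diff_le: "x \<in> carrier A \<Longrightarrow> y \<in> carrier A \<Longrightarrow> nrm A x \<le> nrm A (x \<ominus> y) + nrm A y"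
  using nrm_minus_triangle[of x y \<zero>] by simp

lemma nrm_diff_abs: "x \<in> carrier A \<Longrightarrow> y \<in> carrier A \<Longrightarrow> \<bar>nrm A x - nrm A y\<bar> \<le> nrm A (x \<ominus> y)"
  using nrm_diff_le[of x y] nrm_diff_le[of y x] nrm_minus_commute[of x y] by linarith

text \<open>The C*-identity and submultiplicativity bound the square of \<open>nrm A y\<close> by
  \<open>nrm A (adj A y) * nrm A y\<close>. Cancelling gives one inequality, and exchanging
  \<open>y\<close> with its adjoint gives the other.\<close>

lemma nrm_adj [simp]:
  assumes "x \<in> carrier A"
  shows "nrm A (adj A x) = nrm A x"
proof -
  have le: "nrm A y \<le> nrm A (adj A y)" if y: "y \<in> carrier A" for y
  proof (cases "nrm A y = 0")
    case False
    have "(nrm A y)\<^sup>2 \<le> nrm A (adj A y) * nrm A y"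
      using nrm_mult[of "adj A y" y] cstar_identity[OF y] y by simp
    then have "nrm A y * nrm A y \<le> nrm A (adj A y) * nrm A y"
      by (simp only: power2_eq_square)
    moreover have "nrm A y > 0" using False nrm_nonneg[OF y] by linarith
    ultimately show ?thesis by (simp only: mult_le_cancel_right_pos)
  qed (use y in simp)
  show ?thesis using le[OF assms] le[of "adj A x"] assms by simp
qed

lemma cstar_identity': "x \<in> carrier A \<Longrightarrow> nrm A (x \<otimes> adj A x) = (nrm A x)\<^sup>2"
  using cstar_identity[of "adj A x"] by simp

sublocale metric: Metric_space "carrier A" "ndist A"
proof
  show "0 \<le> ndist A x y" for x y by (simp add: ndist_def)
  show "ndist A x y = ndist A y x" for x y
    using nrm_minus_commute[of x y] by (simp add: ndist_def)
  show "ndist A x y = 0 \<longleftrightarrow> x = y" if "x \<in> carrier A" "y \<in> carrier A" for x y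
    using that by (simp add: ndist_def minus_eq_zero_iff)
  show "ndist A x z \<le> ndist A x y + ndist A y z"
    if "x \<in> carrier A" "y \<in> carrier A" "z \<in> carrier A" for x y z
    using that nrm_minus_triangle[of x y z] by (simp add: ndist_def)
qed

lemma MCauchy_iff: "metric.MCauchy = cauchy A"
  by (rule ext) (auto simp: metric.MCauchy_def cauchy_def ndist_def image_subset_iff)

lemma limitin_iff_conv:
  "(\<And>n. s n \<in> carrier A) \<Longrightarrow> limitin metric.mtopology s x sequentially \<longleftrightarrow> conv A s x"
  by (auto simp: metric.limitin_metric conv_def tendsto_iff ndist_def)

lemma closedin_iff:
  "closedin metric.mtopology S \<longleftrightarrow>
    S \<subseteq> carrier A \<and> (\<forall>s x. (\<forall>n. s n \<in> S) \<and> conv A s x \<longrightarrow> x \<in> S)"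
  unfolding metric.metric_closedin_iff_sequentially_closed
proof (rule conj_cong[OF refl])
  assume S: "S \<subseteq> carrier A"
  have "range s \<subseteq> S \<and> limitin metric.mtopology s x sequentially \<longleftrightarrow> (\<forall>n. s n \<in> S) \<and> conv A s x"
    for s x
    using limitin_iff_conv[of s x] S by blast
  then show "(\<forall>s x. range s \<subseteq> S \<and> limitin metric.mtopology s x sequentially \<longrightarrow> x \<in> S) \<longleftrightarrow>
      (\<forall>s x. (\<forall>n. s n \<in> S) \<and> conv A s x \<longrightarrow> x \<in> S)"
    by (simp only:)
qed

lemma conv_in: "conv A s x \<Longrightarrow> x \<in> carrier A" "conv A s x \<Longrightarrow> s n \<in> carrier A"
  by (auto simp: conv_def)

lemma convI:
  assumes "\<And>n. s n \<in> carrier A" "x \<in> carrier A" "\<And>n. nrm A (s n \<ominus> x) \<le> b n" "b \<longlonglongrightarrow> 0"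
  shows "conv A s x"
proof -
  have "(\<lambda>n. nrm A (s n \<ominus> x)) \<longlonglongrightarrow> 0"
    by (rule tendsto_sandwich[OF _ _ tendsto_const assms(4)]) (simp_all add: assms)
  then show ?thesis using assms by (simp add: conv_def)
qed

lemma conv_const [simp]: "x \<in> carrier A \<Longrightarrow> conv A (\<lambda>n. x) x"
  by (simp add: conv_def minus_eq r_neg)

lemma conv_norm:
  assumes "conv A s x"
  shows "(\<lambda>n. nrm A (s n)) \<longlonglongrightarrow> nrm A x"
proof -
  have s: "\<And>n. s n \<in> carrier A" "x \<in> carrier A" "(\<lambda>n. nrm A (s n \<ominus> x)) \<longlonglongrightarrow> 0"
    using assms by (auto simp: conv_def)
  have "(\<lambda>n. \<bar>nrm A (s n) - nrm A x\<bar>) \<longlonglongrightarrow> 0"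
    by (rule tendsto_sandwich[OF _ _ tendsto_const s(3)]) (simp_all add: s nrm_diff_abs)
  then have "(\<lambda>n. nrm A (s n) - nrm A x) \<longlonglongrightarrow> 0" by (rule tendsto_rabs_zero_cancel)
  then show ?thesis by (rule LIM_zero_cancel)
qed

lemma conv_unique: "conv A s x \<Longrightarrow> conv A s y \<Longrightarrow> x = y"
  using metric.limitin_metric_unique[of s x sequentially y] limitin_iff_conv[of s] conv_in(2)[of s]
  by simp

lemma conv_smult: "conv A s x \<Longrightarrow> conv A (\<lambda>n. c \<odot> s n) (c \<odot> x)"
  unfolding conv_def by (auto simp: tendsto_mult_right_zero simp flip: smult_minus)

lemma nrm_add_minus_le:
  assumes "x \<in> carrier A" "y \<in> carrier A" "x' \<in> carrier A" "y' \<in> carrier A"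
  shows "nrm A ((x \<oplus> y) \<ominus> (x' \<oplus> y')) \<le> nrm A (x \<ominus> x') + nrm A (y \<ominus> y')"
proof -
  obtain L where L: "coords L x y x' y'"
    using linear4[OF assms] .
  note L = coordsD[OF L]
  have "(x \<oplus> y) \<ominus> (x' \<oplus> y') = (x \<ominus> x') \<oplus> (y \<ominus> y')"
    by (simp add: L)
  then show ?thesis using nrm_triangle[of "x \<ominus> x'" "y \<ominus> y'"] assms by simp
qed

lemma nrm_mult_minus_le:
  assumes "x \<in> carrier A" "y \<in> carrier A" "x' \<in> carrier A" "y' \<in> carrier A"
  shows "nrm A (x \<otimes> y \<ominus> x' \<otimes> y') \<le> nrm A (x \<ominus> x') * nrm A y + nrm A x' * nrm A (y \<ominus> y')"
proof -
  have "nrm A (x \<otimes> y \<ominus> x' \<otimes> y') \<le> nrm A ((x \<ominus> x') \<otimes> y) + nrm A (x' \<otimes> (y \<ominus> y'))"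
    using nrm_minus_triangle[of "x \<otimes> y" "x' \<otimes> y" "x' \<otimes> y'"] assms
    by (simp add: mult_minus_left mult_minus_right)
  also have "\<dots> \<le> nrm A (x \<ominus> x') * nrm A y + nrm A x' * nrm A (y \<ominus> y')"
    by (intro add_mono nrm_mult) (use assms in auto)
  finally show ?thesis .
qed

lemma conv_add:
  assumes "conv A s x" "conv A t y"
  shows "conv A (\<lambda>n. s n \<oplus> t n) (x \<oplus> y)"
proof (rule convI)
  show "(\<lambda>n. nrm A (s n \<ominus> x) + nrm A (t n \<ominus> y)) \<longlonglongrightarrow> 0"
    using assms by (auto simp: conv_def intro!: tendsto_add_zero)
qed (use assms nrm_add_minus_le in \<open>auto simp: conv_def\<close>)

lemma conv_minus: "conv A s x \<Longrightarrow> conv A t y \<Longrightarrow> conv A (\<lambda>n. s n \<ominus> t n) (x \<ominus> y)"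
  using conv_add[OF _ conv_smult[of t y "- 1"]] conv_in by (simp add: minus_smult)

lemma conv_mult:
  assumes "conv A s x" "conv A t y"
  shows "conv A (\<lambda>n. s n \<otimes> t n) (x \<otimes> y)"
proof (rule convI)
  show "(\<lambda>n. nrm A (s n \<ominus> x) * nrm A (t n) + nrm A x * nrm A (t n \<ominus> y)) \<longlonglongrightarrow> 0"
    using tendsto_add[OF tendsto_mult[of "\<lambda>n. nrm A (s n \<ominus> x)" 0, OF _ conv_norm[OF assms(2)]]
        tendsto_mult[OF tendsto_const, of "\<lambda>n. nrm A (t n \<ominus> y)" 0 _ "nrm A x"]] assms
    by (simp add: conv_def)
qed (use assms nrm_mult_minus_le in \<open>auto simp: conv_def\<close>)

lemma conv_adj: "conv A s x \<Longrightarrow> conv A (\<lambda>n. adj A (s n)) (adj A x)"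
  unfolding conv_def by (auto simp flip: adj_minus)

lemma conv_norm_le: "conv A s x \<Longrightarrow> (\<And>n. nrm A (s n) \<le> c) \<Longrightarrow> nrm A x \<le> c"
  using conv_norm[of s x] by (rule LIMSEQ_le_const2) auto

lemma conv_Suc: "conv A s x \<Longrightarrow> conv A (\<lambda>n. s (Suc n)) x"
  unfolding conv_def using LIMSEQ_Suc by fast

lemma cauchy_in: "cauchy A s \<Longrightarrow> s n \<in> carrier A"
  by (simp add: cauchy_def)

lemma conv_imp_cauchy: "conv A s x \<Longrightarrow> cauchy A s"
  using metric.convergent_imp_MCauchy[of s x] limitin_iff_conv[of s x] conv_in[of s x]
  by (auto simp: MCauchy_iff)

lemma cauchyI:
  assumes "\<And>n. s n \<in> carrier A"
    and "\<And>e. e > 0 \<Longrightarrow> \<exists>N. \<forall>m\<ge>N. \<forall>n\<ge>N. nrm A (s m \<ominus> s n) < e"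
  shows "cauchy A s"
  using assms by (auto simp: cauchy_def)

lemma cauchyD: "cauchy A s \<Longrightarrow> e > 0 \<Longrightarrow> \<exists>N. \<forall>m\<ge>N. \<forall>n\<ge>N. nrm A (s m \<ominus> s n) < e"
  by (simp add: cauchy_def)

lemma cauchy_norm_convergent: "cauchy A s \<Longrightarrow> convergent (\<lambda>n. nrm A (s n))"
proof -
  assume s: "cauchy A s"
  have "Cauchy (\<lambda>n. nrm A (s n))"
  proof (rule metric_CauchyI)
    fix e :: real assume e: "e > 0"
    obtain N where "\<forall>m\<ge>N. \<forall>n\<ge>N. nrm A (s m \<ominus> s n) < e"
    using cauchyD[OF s e] by blast
  note N = this[rule_format]
    show "\<exists>N. \<forall>m\<ge>N. \<forall>n\<ge>N. dist (nrm A (s m)) (nrm A (s n)) < e"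
      unfolding dist_real_def using le_less_trans[OF nrm_diff_abs[OF cauchy_in[OF s] cauchy_in[OF s]] N]
      by blast
  qed
  then show ?thesis by (simp add: Cauchy_convergent_iff)
qed

lemma cauchy_bounded:
  assumes "cauchy A s"
  shows "\<exists>M>0. \<forall>n. nrm A (s n) \<le> M"
proof -
  have "Bseq (\<lambda>n. nrm A (s n))"
    using cauchy_norm_convergent[OF assms] by (rule convergent_imp_Bseq)
  then show ?thesis using assms by (simp add: Bseq_def cauchy_in)
qed

text \<open>One estimate for several operations: the increments of a sum, a product of bounded
  sequences or a scalar multiple are all dominated in this form.\<close>

lemma cauchy_bound:
  assumes "cauchy A s" "cauchy A t" "\<And>n. u n \<in> carrier A" "a \<ge> 0" "b \<ge> 0"
    and le: "\<And>m n. nrm A (u m \<ominus> u n) \<le> a * nrm A (s m \<ominus> s n) + b * nrm A (t m \<ominus> t n)"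
  shows "cauchy A u"
proof (rule cauchyI)
  fix e :: real assume "e > 0"
  \<comment> \<open>The summand 1 keeps the denominator positive when \<open>a = b = 0\<close> and
    makes the final inequality strict.\<close>
  define d where "d = e / (a + b + 1)"
  have d: "d > 0" using \<open>e > 0\<close> assms(4,5) by (simp add: d_def)
  obtain M where M: "\<forall>m\<ge>M. \<forall>n\<ge>M. nrm A (s m \<ominus> s n) < d" using cauchyD[OF assms(1) d] by blast
  obtain N where N: "\<forall>m\<ge>N. \<forall>n\<ge>N. nrm A (t m \<ominus> t n) < d" using cauchyD[OF assms(2) d] by blast
  have "nrm A (u m \<ominus> u n) < e" if "m \<ge> max M N" "n \<ge> max M N" for m n
  proof -
    have "nrm A (u m \<ominus> u n) \<le> a * d + b * d"
      using that M N by (intro order_trans[OF le add_mono] mult_left_mono assms(4,5)) (auto simp: less_imp_le)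
    also have "\<dots> < (a + b + 1) * d" using d by (simp add: algebra_simps)
    also have "\<dots> = e" using assms(4,5) by (simp add: d_def)
    finally show ?thesis .
  qed
  then show "\<exists>N. \<forall>m\<ge>N. \<forall>n\<ge>N. nrm A (u m \<ominus> u n) < e" by blast
qed (rule assms(3))

lemma cauchy_add:
  assumes "cauchy A s" "cauchy A t"
  shows "cauchy A (\<lambda>n. s n \<oplus> t n)"
  by (rule cauchy_bound[OF assms, of _ 1 1]) (simp_all add: assms cauchy_in nrm_add_minus_le)

lemma cauchy_mult:
  assumes "cauchy A s" "cauchy A t"
  shows "cauchy A (\<lambda>n. s n \<otimes> t n)"
proof -
  obtain a where a: "a > 0" "\<And>n. nrm A (s n) \<le> a" using cauchy_bounded[OF assms(1)] by blast
  obtain b where b: "b > 0" "\<And>n. nrm A (t n) \<le> b" using cauchy_bounded[OF assms(2)] by blast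
  show ?thesis
  proof (rule cauchy_bound[OF assms, of _ b a])
    fix m n
    have "nrm A (s m \<otimes> t m \<ominus> s n \<otimes> t n) \<le>
        nrm A (s m \<ominus> s n) * nrm A (t m) + nrm A (s n) * nrm A (t m \<ominus> t n)"
      by (rule nrm_mult_minus_le) (simp_all add: assms cauchy_in)
    also have "\<dots> \<le> nrm A (s m \<ominus> s n) * b + a * nrm A (t m \<ominus> t n)"
      by (intro add_mono mult_left_mono mult_right_mono a b) (simp_all add: assms cauchy_in)
    finally show "nrm A (s m \<otimes> t m \<ominus> s n \<otimes> t n)
        \<le> b * nrm A (s m \<ominus> s n) + a * nrm A (t m \<ominus> t n)"
      by (simp add: mult.commute)
  qed (use assms a(1) b(1) in \<open>simp_all add: cauchy_in\<close>)
qed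

lemma cauchy_smult:
  assumes "cauchy A s"
  shows "cauchy A (\<lambda>n. c \<odot> s n)"
  by (rule cauchy_bound[OF assms assms, of _ "cmod c" 0])
    (simp_all add: assms cauchy_in flip: smult_minus)

lemma cauchy_minus: "cauchy A s \<Longrightarrow> cauchy A t \<Longrightarrow> cauchy A (\<lambda>n. s n \<ominus> t n)"
  using cauchy_add[OF _ cauchy_smult[of t "- 1"]] by (simp add: minus_smult cauchy_in)

lemma cauchy_adj: "cauchy A s \<Longrightarrow> cauchy A (\<lambda>n. adj A (s n))"
  unfolding cauchy_def by (auto simp flip: adj_minus)

lemma cauchy_geometric:
  assumes s: "\<And>n. s n \<in> carrier A" and r: "0 \<le> r" "r < 1"
    and step: "\<And>n. nrm A (s (Suc n) \<ominus> s n) \<le> c * r ^ n"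
  shows "cauchy A s"
proof (rule cauchyI)
  have c: "c \<ge> 0" using order_trans[OF nrm_nonneg step[of 0]] s by simp
  \<comment> \<open>The exact geometric sum is kept, because the weaker bound
    \<open>c * r ^ n / (1 - r)\<close> would not survive the induction on \<open>k\<close>.\<close>
  have sum: "nrm A (s (n + k) \<ominus> s n) \<le> c * (r ^ n - r ^ (n + k)) / (1 - r)" for n k
  proof (induction k)
    case 0
    then show ?case using s by (simp add: minus_eq r_neg)
  next
    case (Suc k)
    have "nrm A (s (n + Suc k) \<ominus> s n) \<le> c * r ^ (n + k) + c * (r ^ n - r ^ (n + k)) / (1 - r)"
      using nrm_minus_triangle[of "s (n + Suc k)" "s (n + k)" "s n"] step[of "n + k"] Suc s
      by simp
    also have "\<dots> = c * (r ^ n - r ^ (n + Suc k)) / (1 - r)"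
      using r by (simp add: field_simps)
    finally show ?case .
  qed
  have bound: "nrm A (s m \<ominus> s n) \<le> c * r ^ n / (1 - r)" if "n \<le> m" for m n
  proof -
    have "nrm A (s m \<ominus> s n) \<le> c * (r ^ n - r ^ m) / (1 - r)"
      using sum[of n "m - n"] that by simp
    also have "\<dots> \<le> c * r ^ n / (1 - r)"
      using c r by (intro divide_right_mono mult_left_mono) auto
    finally show ?thesis .
  qed
  fix e :: real assume "e > 0"
  have "(\<lambda>n. c * r ^ n / (1 - r)) \<longlonglongrightarrow> c * 0 / (1 - r)"
    using r by (intro tendsto_intros LIMSEQ_realpow_zero) auto
  then have "\<forall>\<^sub>F n in sequentially. c * r ^ n / (1 - r) < e"
    using \<open>e > 0\<close> by (auto dest: order_tendstoD(2)[of _ _ _ e])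
  then obtain N where N: "\<And>n. n \<ge> N \<Longrightarrow> c * r ^ n / (1 - r) < e"
    by (auto simp: eventually_sequentially)
  have "nrm A (s m \<ominus> s n) < e" if "m \<ge> N" "n \<ge> N" for m n
    using bound[of m n] bound[of n m] N[of m] N[of n] nrm_minus_commute[of "s m" "s n"] s that
    by (cases "n \<le> m") (auto intro: le_less_trans)
  then show "\<exists>N. \<forall>m\<ge>N. \<forall>n\<ge>N. nrm A (s m \<ominus> s n) < e" by blast
qed (rule s)

end

locale cstar = pre_cstar +
  assumes cauchy_conv: "cauchy A s \<Longrightarrow> \<exists>x. conv A s x"

lemma cstar_iff: "cstar A \<longleftrightarrow> cstar_algebra A"
proof
  assume "cstar A"
  then interpret cstar A .
  have "metric.mcomplete"
    unfolding metric.mcomplete_def MCauchy_iff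
  proof (intro allI impI)
    fix s assume s: "cauchy A s"
    then show "\<exists>x. limitin metric.mtopology s x sequentially"
      using cauchy_conv[OF s] limitin_iff_conv[of s, OF cauchy_in[OF s]] by simp
  qed
  then show "cstar_algebra A"
    using pre_cstar_axioms by (simp add: pre_cstar_iff cstar_algebra_def cstar_algebra_axioms_def)
next
  assume A: "cstar_algebra A"
  then interpret pre_cstar A by (simp add: pre_cstar_iff cstar_algebra_def)
  show "cstar A"
  proof
    fix s assume s: "cauchy A s"
    then have "\<exists>x. limitin metric.mtopology s x sequentially"
      using cstar_algebra.complete[OF A] by (simp add: metric.mcomplete_def MCauchy_iff)
    then show "\<exists>x. conv A s x"
      using limitin_iff_conv[of s, OF cauchy_in[OF s]] by simp
  qed
qed

definition star_subalgebra :: "'a set \<Rightarrow> ('a, 'm) star_algebra_scheme \<Rightarrow> bool"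
  where "star_subalgebra S A \<longleftrightarrow> S \<subseteq> carrier A \<and> \<zero>\<^bsub>A\<^esub> \<in> S \<and>
    (\<forall>x\<in>S. \<forall>y\<in>S. x \<oplus>\<^bsub>A\<^esub> y \<in> S \<and> x \<otimes>\<^bsub>A\<^esub> y \<in> S) \<and>
    (\<forall>x\<in>S. adj A x \<in> S \<and> (\<forall>c. c \<odot>\<^bsub>A\<^esub> x \<in> S))"

context pre_cstar
begin

lemma pre_cstar_restrict:
  assumes "star_subalgebra S A"
  shows "pre_cstar (A\<lparr>carrier := S\<rparr>)"
proof (rule pre_cstar.intro)
  note S = assms[unfolded star_subalgebra_def]
  show "star_algebra_laws (A\<lparr>carrier := S\<rparr>)"
    by (rule star_algebra_laws_inherit_inj[OF star_algebra_laws_axioms, where T = UNIV and e = "\<lambda>t x. x"])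
      (use S in auto)
  show "pre_cstar_axioms (A\<lparr>carrier := S\<rparr>)"
    by unfold_locales (use S in \<open>auto intro!: nrm_triangle nrm_mult cstar_identity simp: subset_iff\<close>)
qed

lemma restrict_minus:
  assumes "star_subalgebra S A" "x \<in> S" "y \<in> S"
  shows "x \<ominus>\<^bsub>A\<lparr>carrier := S\<rparr>\<^esub> y = x \<ominus> y"
proof -
  interpret S: pre_cstar "A\<lparr>carrier := S\<rparr>" using assms(1) by (rule pre_cstar_restrict)
  show ?thesis using assms S.minus_smult[of x y] minus_smult[of x y]
    by (auto simp: star_subalgebra_def subset_iff)
qed

lemma conv_restrict:
  assumes "star_subalgebra S A"
  shows "conv (A\<lparr>carrier := S\<rparr>) s x \<longleftrightarrow> (\<forall>n. s n \<in> S) \<and> x \<in> S \<and> conv A s x"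
  using assms by (auto simp: conv_def restrict_minus star_subalgebra_def cong: conj_cong)

lemma cauchy_restrict:
  assumes "star_subalgebra S A"
  shows "cauchy (A\<lparr>carrier := S\<rparr>) s \<longleftrightarrow> (\<forall>n. s n \<in> S) \<and> cauchy A s"
  using assms by (auto simp: cauchy_def restrict_minus star_subalgebra_def subset_iff cong: conj_cong)

end

lemma (in cstar) cstar_restrict:
  assumes S: "star_subalgebra S A" and closed: "closedin metric.mtopology S"
  shows "cstar (A\<lparr>carrier := S\<rparr>)"
proof -
  interpret S: pre_cstar "A\<lparr>carrier := S\<rparr>" using S by (rule pre_cstar_restrict)
  show ?thesis
  proof
    fix s assume "cauchy (A\<lparr>carrier := S\<rparr>) s"
    then have s: "\<forall>n. s n \<in> S" "cauchy A s" by (simp_all add: cauchy_restrict S)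
    then obtain x where x: "conv A s x" using cauchy_conv by blast
    moreover have "x \<in> S" using closed s x unfolding closedin_iff by blast
    ultimately show "\<exists>x. conv (A\<lparr>carrier := S\<rparr>) s x"
      using s by (auto simp: conv_restrict S)
  qed
qed

section \<open>Norm estimates in C*-algebras\<close>

text \<open>Right multiplication by a self-adjoint \<open>a\<close>, possibly from the unitization,
  has this property: both sides are \<open>z a (adj w)\<close>. It is self-adjointness with respect
  to the pairing \<open>z (adj w)\<close>.\<close>

definition sa_op :: "('a, 'm) star_algebra_scheme \<Rightarrow> ('a \<Rightarrow> 'a) \<Rightarrow> bool"
  where "sa_op A X \<longleftrightarrow> (\<forall>z\<in>carrier A. X z \<in> carrier A \<and>
    (\<forall>w\<in>carrier A. X z \<otimes>\<^bsub>A\<^esub> adj A w = z \<otimes>\<^bsub>A\<^esub> adj A (X w)))"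

text \<open>Right multiplication by \<open>r - a\<close>, which makes sense without a unit.\<close>

definition rop :: "('a, 'm) star_algebra_scheme \<Rightarrow> real \<Rightarrow> 'a \<Rightarrow> 'a \<Rightarrow> 'a"
  where "rop A r a z = complex_of_real r \<odot>\<^bsub>A\<^esub> z \<ominus>\<^bsub>A\<^esub> z \<otimes>\<^bsub>A\<^esub> a"

context pre_cstar
begin

text \<open>If \<open>X\<close> and \<open>Y\<close> commute, then \<open>X + iY\<close> and \<open>X - iY\<close> are multiples of unitaries.\<close>

lemma nrm_add_imaginary:
  assumes X: "sa_op A X" and Y: "sa_op A Y"
    and comm: "\<And>z. z \<in> carrier A \<Longrightarrow> X (Y z) = Y (X z)"
    and sum: "\<And>z. z \<in> carrier A \<Longrightarrow> X (X z) \<oplus> Y (Y z) = complex_of_real r \<odot> z"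
    and r: "r \<ge> 0" and z: "z \<in> carrier A" and c: "c * cnj c = 1" "cnj c = - c"
  shows "nrm A (X z \<oplus> c \<odot> Y z) = sqrt r * nrm A z"
proof -
  have cl [simp]: "X z \<in> carrier A" "Y z \<in> carrier A" if "z \<in> carrier A" for z
    using X Y that by (auto simp: sa_op_def)
  have sa: "X z \<otimes> adj A w = z \<otimes> adj A (X w)" "Y z \<otimes> adj A w = z \<otimes> adj A (Y w)"
    if "z \<in> carrier A" "w \<in> carrier A" for z w
    using X Y that by (auto simp: sa_op_def)
  define P where "P = X z \<otimes> adj A (X z)"
  define Q where "Q = X z \<otimes> adj A (Y z)"
  define R where "R = Y z \<otimes> adj A (Y z)"
  \<comment> \<open>Commutation enters here: the two mixed products agree, so their coefficients
    \<open>c\<close> and \<open>cnj c\<close> cancel.\<close>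
  have Q': "Y z \<otimes> adj A (X z) = Q"
    using z by (simp add: Q_def sa comm)
  have PR: "P \<oplus> R = complex_of_real r \<odot> (z \<otimes> adj A z)"
    using z by (simp add: P_def R_def sa smult_mult_right sum adj_smult flip: mult_add_right adj_add)
  have PQR: "P \<in> carrier A" "Q \<in> carrier A" "R \<in> carrier A"
    using z by (simp_all add: P_def Q_def R_def)
  obtain L where L: "coords L P Q R z" by (rule linear4[OF PQR z])
  note L = coordsD[OF L]
  have "(X z \<oplus> c \<odot> Y z) \<otimes> adj A (X z \<oplus> c \<odot> Y z)
      = P \<oplus> c \<odot> Q \<oplus> cnj c \<odot> (Q \<oplus> c \<odot> R)"
    using z by (simp add: adj_add adj_smult mult_add_left mult_add_right smult_mult_left
        smult_mult_right Q' flip: P_def Q_def R_def)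
  also have "\<dots> = P \<oplus> R"
    using c mult.commute[of "cnj c" c] by (simp add: L(1-3) L(6-9))
  finally have "(nrm A (X z \<oplus> c \<odot> Y z))\<^sup>2 = r * (nrm A z)\<^sup>2"
    using z r cstar_identity'[of "X z \<oplus> c \<odot> Y z"] by (simp add: PR cstar_identity')
  then have "(nrm A (X z \<oplus> c \<odot> Y z))\<^sup>2 = (sqrt r * nrm A z)\<^sup>2"
    using r by (simp add: power_mult_distrib)
  then show ?thesis
    using z r by (simp add: power2_eq_iff_nonneg)
qed

text \<open>A commuting partner \<open>Y\<close> with \<open>X\<^sup>2 + Y\<^sup>2 = r\<close>
  certifies the bound \<open>sqrt r\<close>, since \<open>X\<close> is the mean of
  \<open>X + i Y\<close> and \<open>X - i Y\<close>, each of which scales all norms by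
  \<open>sqrt r\<close>. Exhibiting such partners replaces all arguments about spectra.\<close>

lemma nrm_sa_op_le:
  assumes "sa_op A X" "sa_op A Y"
    and "\<And>z. z \<in> carrier A \<Longrightarrow> X (Y z) = Y (X z)"
    and "\<And>z. z \<in> carrier A \<Longrightarrow> X (X z) \<oplus> Y (Y z) = complex_of_real r \<odot> z"
    and "r \<ge> 0" and z: "z \<in> carrier A"
  shows "nrm A (X z) \<le> sqrt r * nrm A z"
proof -
  have XY: "X z \<in> carrier A" "Y z \<in> carrier A"
    using assms by (auto simp: sa_op_def)
  obtain L where L: "coords L (X z) (Y z) z z" by (rule linear4[OF XY z z])
  note L = coordsD[OF L]
  have "2 \<odot> X z = (X z \<oplus> \<i> \<odot> Y z) \<oplus> (X z \<oplus> (- \<i>) \<odot> Y z)"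
    by (simp add: L(1,2) L(6-9))
  then have "2 * nrm A (X z) = nrm A ((X z \<oplus> \<i> \<odot> Y z) \<oplus> (X z \<oplus> (- \<i>) \<odot> Y z))"
    using XY by (metis nrm_smult norm_numeral)
  also have "\<dots> \<le> nrm A (X z \<oplus> \<i> \<odot> Y z) + nrm A (X z \<oplus> (- \<i>) \<odot> Y z)"
    using XY by (intro nrm_triangle) auto
  also have "\<dots> = 2 * (sqrt r * nrm A z)"
    using nrm_add_imaginary[OF assms, of \<i>] nrm_add_imaginary[OF assms, of "- \<i>"] by simp
  finally show ?thesis by simp
qed

lemma a_inv_zero [simp]: "\<ominus> \<zero> = \<zero>"
  by (simp add: a_inv_smult)

lemma rop_closed [simp]: "a \<in> carrier A \<Longrightarrow> z \<in> carrier A \<Longrightarrow> rop A r a z \<in> carrier A"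
  by (simp add: rop_def)

lemma sa_op_rop: "a \<in> carrier A \<Longrightarrow> adj A a = a \<Longrightarrow> sa_op A (rop A r a)"
  by (simp add: sa_op_def rop_def mult_minus_left mult_minus_right adj_minus adj_smult adj_mult
      smult_mult_left smult_mult_right mult_assoc)

lemma sa_op_comp:
  assumes "sa_op A X" "sa_op A Y" "\<And>z. z \<in> carrier A \<Longrightarrow> X (Y z) = Y (X z)"
  shows "sa_op A (\<lambda>z. X (Y z))"
  using assms by (auto simp: sa_op_def)

lemma rop_rop:
  assumes "a \<in> carrier A" "b \<in> carrier A" "z \<in> carrier A"
  shows "rop A r a (rop A t b z)
    = complex_of_real (r * t) \<odot> z \<ominus> complex_of_real r \<odot> (z \<otimes> b)
      \<ominus> complex_of_real t \<odot> (z \<otimes> a) \<oplus> z \<otimes> (b \<otimes> a)"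
proof -
  have cl: "z \<otimes> b \<in> carrier A" "z \<otimes> a \<in> carrier A" "z \<otimes> (b \<otimes> a) \<in> carrier A"
    using assms by auto
  obtain L where L: "coords L z (z \<otimes> b) (z \<otimes> a) (z \<otimes> (b \<otimes> a))"
    by (rule linear4[OF assms(3) cl])
  note L = coordsD[OF L]
  have "rop A r a (rop A t b z) = complex_of_real r \<odot> (complex_of_real t \<odot> z \<ominus> z \<otimes> b)
      \<ominus> (complex_of_real t \<odot> (z \<otimes> a) \<ominus> z \<otimes> (b \<otimes> a))"
    using assms by (simp add: rop_def mult_minus_left smult_mult_left mult_assoc)
  \<comment> \<open>The products contain \<open>z\<close>, so they must be turned into coordinates
    before \<open>z\<close> itself is; otherwise they would no longer match. This explains the two
    passes here and in similar computations below.\<close>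
  then show ?thesis by (simp add: L(6-9) L(4) L(3) L(2) flip: L(1)) (simp add: L(1) L(6-9))
qed

lemma rop_commute:
  assumes "a \<in> carrier A" "b \<in> carrier A" "z \<in> carrier A" "a \<otimes> b = b \<otimes> a"
  shows "rop A r a (rop A t b z) = rop A t b (rop A r a z)"
proof -
  have cl: "z \<otimes> b \<in> carrier A" "z \<otimes> a \<in> carrier A" "z \<otimes> (b \<otimes> a) \<in> carrier A"
    using assms by auto
  obtain L where L: "coords L z (z \<otimes> b) (z \<otimes> a) (z \<otimes> (b \<otimes> a))"
    by (rule linear4[OF assms(3) cl])
  note L = coordsD[OF L]
  show ?thesis
    using assms(4) by (simp add: rop_rop assms(1-3) L(2-4)) (simp add: L(1) L(6-9) mult.commute)
qed

text \<open>The hypothesis is the unit-free form of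
  \<open>(r - a)\<^sup>2 = r\<^sup>2 - h\<close>.\<close>

lemma rop_square:
  assumes "a \<in> carrier A" "h \<in> carrier A" "z \<in> carrier A" "a \<otimes> a \<oplus> h = complex_of_real (2 * r) \<odot> a"
  shows "rop A r a (rop A r a z) = rop A (r\<^sup>2) h z"
proof -
  have cl: "z \<otimes> h \<in> carrier A" "z \<otimes> a \<in> carrier A" "z \<otimes> (a \<otimes> a) \<in> carrier A"
    using assms by auto
  obtain L where L: "coords L z (z \<otimes> h) (z \<otimes> a) (z \<otimes> (a \<otimes> a))"
    by (rule linear4[OF assms(3) cl])
  note L = coordsD[OF L]
  have "z \<otimes> (a \<otimes> a) \<oplus> z \<otimes> h = complex_of_real (2 * r) \<odot> (z \<otimes> a)"
    using assms by (simp add: smult_mult_right flip: mult_add_right)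
  then have zh: "z \<otimes> h = complex_of_real (2 * r) \<odot> (z \<otimes> a) \<ominus> z \<otimes> (a \<otimes> a)"
    using cl by (metis a_comm add.inv_solve_right minus_eq smult_in)
  show ?thesis
    unfolding rop_rop[OF assms(1,1,3)] unfolding rop_def zh
    by (simp add: L(3,4)) (simp add: L(1) L(6-9) power2_eq_square)
qed

text \<open>Testing with \<open>z = adj A b\<close> turns the assumption into
  \<open>nrm A b * nrm A b \<le> c * nrm A b\<close> by the C*-identity.\<close>

lemma nrm_le_of_rop:
  assumes b: "b \<in> carrier A" and c: "c \<ge> 0"
    and le: "\<And>z. z \<in> carrier A \<Longrightarrow> nrm A (z \<otimes> b) \<le> c * nrm A z"
  shows "nrm A b \<le> c"
proof (cases "nrm A b = 0")
  case False
  have "nrm A b * nrm A b \<le> c * nrm A b"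
    using le[of "adj A b"] b by (simp add: cstar_identity power2_eq_square)
  moreover have "nrm A b > 0" using False nrm_nonneg[OF b] by linarith
  ultimately show ?thesis by simp
qed (use c in simp)

lemma closed_ideal_iff:
  "closed_ideal I A \<longleftrightarrow> I \<subseteq> carrier A \<and> \<zero> \<in> I \<and> (\<forall>x\<in>I. \<forall>y\<in>I. x \<oplus> y \<in> I) \<and>
    (\<forall>x\<in>I. \<forall>c. c \<odot> x \<in> I) \<and> (\<forall>x\<in>I. \<forall>a\<in>carrier A. a \<otimes> x \<in> I \<and> x \<otimes> a \<in> I) \<and>
    (\<forall>s x. (\<forall>n. s n \<in> I) \<and> conv A s x \<longrightarrow> x \<in> I)" (is "_ \<longleftrightarrow> ?R")
proof
  assume I: "closed_ideal I A"
  then have sub: "submodule I complex_ring A" by (simp add: closed_ideal_def)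
  note E = submoduleE[OF sub]
  have "\<zero> \<in> I" using subgroup.one_closed[OF submodule.axioms(1)[OF sub]] by simp
  then show ?R using I E unfolding closed_ideal_def closedin_iff by simp
next
  assume R: ?R
  have "submodule I complex_ring A"
  proof (rule submoduleI)
    show "\<ominus> x \<in> I" if "x \<in> I" for x
      using R that a_inv_smult[of x] by (auto simp: subset_iff)
  qed (use R in auto)
  then show "closed_ideal I A"
    using R unfolding closed_ideal_def closedin_iff by blast
qed

lemma closed_idealD:
  assumes "closed_ideal I A"
  shows "x \<in> I \<Longrightarrow> x \<in> carrier A" "\<zero> \<in> I" "x \<in> I \<Longrightarrow> y \<in> I \<Longrightarrow> x \<oplus> y \<in> I" "x \<in> I \<Longrightarrow> c \<odot> x \<in> I"
    "x \<in> I \<Longrightarrow> a \<in> carrier A \<Longrightarrow> a \<otimes> x \<in> I" "x \<in> I \<Longrightarrow> a \<in> carrier A \<Longrightarrow> x \<otimes> a \<in> I"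
    "(\<And>n. s n \<in> I) \<Longrightarrow> conv A s x \<Longrightarrow> x \<in> I"
    "x \<in> I \<Longrightarrow> y \<in> I \<Longrightarrow> x \<ominus> y \<in> I"
proof -
  note R = assms[unfolded closed_ideal_iff]
  show "x \<in> I \<Longrightarrow> x \<in> carrier A" "\<zero> \<in> I" "x \<in> I \<Longrightarrow> y \<in> I \<Longrightarrow> x \<oplus> y \<in> I" "x \<in> I \<Longrightarrow> c \<odot> x \<in> I"
    "x \<in> I \<Longrightarrow> a \<in> carrier A \<Longrightarrow> a \<otimes> x \<in> I" "x \<in> I \<Longrightarrow> a \<in> carrier A \<Longrightarrow> x \<otimes> a \<in> I"
    "(\<And>n. s n \<in> I) \<Longrightarrow> conv A s x \<Longrightarrow> x \<in> I"
    using R by blast+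
  show "x \<in> I \<Longrightarrow> y \<in> I \<Longrightarrow> x \<ominus> y \<in> I"
    using R by (simp add: minus_smult subset_iff)
qed

lemma closed_ideal_carrier: "closed_ideal (carrier A) A"
  by (auto simp: closed_ideal_iff conv_in)

end

section \<open>Square roots and approximate units\<close>

context cstar
begin

text \<open>
  The element \<open>s\<close> plays the role of \<open>r - sqrt (r\<^sup>2 - y\<^sup>2)\<close>; it is the fixed point of
  \<open>s \<mapsto> (y\<^sup>2 + s\<^sup>2) / (2 r)\<close>.
\<close>

lemma sqrt_exists:
  assumes I: "closed_ideal I A" and y: "y \<in> I" "adj A y = y" and r: "nrm A y < r"
  shows "\<exists>s\<in>I. adj A s = s \<and> (\<forall>z\<in>carrier A. z \<otimes> y = y \<otimes> z \<longrightarrow> z \<otimes> s = s \<otimes> z) \<and>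
    s \<otimes> s \<oplus> y \<otimes> y = complex_of_real (2 * r) \<odot> s"
proof -
  note D = closed_idealD[OF I]
  have yA [simp]: "y \<in> carrier A" using y D by auto
  have r0: "r > 0" using r nrm_nonneg[OF yA] by linarith
  have less: "(nrm A y)\<^sup>2 < r\<^sup>2" using r by (intro power_strict_mono) auto
  \<comment> \<open>This is the fixed point of the same iteration for the number
    \<open>nrm A y\<close> in place of \<open>y\<close>, so the ball of radius \<open>q\<close> is
    mapped into itself.\<close>
  define q where "q = r - sqrt (r\<^sup>2 - (nrm A y)\<^sup>2)"
  have q0: "q \<ge> 0" "q < r"
    using less r0 by (auto simp: q_def intro!: real_le_lsqrt)
  have q: "(nrm A y)\<^sup>2 + q\<^sup>2 = 2 * r * q"
  proof -
    have "(r - q)\<^sup>2 = r\<^sup>2 - (nrm A y)\<^sup>2" using less by (simp add: q_def)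
    then show ?thesis by (simp add: power2_eq_square algebra_simps)
  qed
  define c where "c = complex_of_real (1 / (2 * r))"
  have c_norm: "cmod c = 1 / (2 * r)" using r0 by (simp add: c_def norm_divide)
  define T where "T s = c \<odot> (y \<otimes> y \<oplus> s \<otimes> s)" for s
  define s where "s n = (T ^^ n) \<zero>" for n
  have s_Suc: "s (Suc n) = T (s n)" and s_0: "s 0 = \<zero>" for n by (simp_all add: s_def)
  \<comment> \<open>The iterates are real polynomials in \<open>y\<close> without constant term.
    Hence they lie in \<open>I\<close>, are self-adjoint and commute with whatever commutes with
    \<open>y\<close>; all three properties pass to the limit.\<close>
  have sI: "s n \<in> I" for n
  proof (induction n)
    case (Suc n)
    then show ?case unfolding s_Suc T_def by (intro D(3,4,5) y(1) yA D(1)[of "s n"])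
  qed (simp add: s_0 D)
  then have sA [simp]: "s n \<in> carrier A" for n using D(1) by blast
  have s_adj: "adj A (s n) = s n" for n
    by (induction n) (simp_all add: s_Suc s_0 T_def adj_smult adj_add adj_mult y c_def)
  have s_comm: "z \<otimes> s n = s n \<otimes> z" if z: "z \<in> carrier A" "z \<otimes> y = y \<otimes> z" for n z
  proof (induction n)
    case (Suc n)
    have "z \<otimes> (x \<otimes> x) = (x \<otimes> x) \<otimes> z" if "x \<in> carrier A" "z \<otimes> x = x \<otimes> z" for x
      using that z by (metis mult_assoc)
    then show ?case using z Suc
      by (simp add: s_Suc T_def smult_mult_right smult_mult_left mult_add_right mult_add_left)
  qed (use z in \<open>simp add: s_0\<close>)
  have s_norm: "nrm A (s n) \<le> q" for n
  proof (induction n)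
    case (Suc n)
    have "nrm A (s (Suc n)) \<le> cmod c * (nrm A y * nrm A y + nrm A (s n) * nrm A (s n))"
      unfolding s_Suc T_def
      by (simp, intro mult_left_mono order_trans[OF nrm_triangle] add_mono nrm_mult) auto
    also have "\<dots> \<le> cmod c * ((nrm A y)\<^sup>2 + q\<^sup>2)"
      unfolding power2_eq_square using q0 Suc
      by (intro mult_left_mono add_mono mult_mono) auto
    also have "\<dots> = q" using r0 by (simp add: q c_norm)
    finally show ?case .
  qed (simp add: s_0 q0)
  \<comment> \<open>On the ball of radius \<open>q\<close> the iteration has Lipschitz constant
    \<open>2 q / (2 r) = q / r\<close>, which is less than 1 because
    \<open>nrm A y < r\<close>.\<close>
  have lip: "nrm A (s (Suc (Suc n)) \<ominus> s (Suc n)) \<le> q / r * nrm A (s (Suc n) \<ominus> s n)" for n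
  proof -
    have "nrm A (s (Suc (Suc n)) \<ominus> s (Suc n))
        = cmod c * nrm A ((y \<otimes> y \<oplus> s (Suc n) \<otimes> s (Suc n)) \<ominus> (y \<otimes> y \<oplus> s n \<otimes> s n))"
      unfolding s_Suc[of "Suc n"] s_Suc[of n] T_def[of "T (s n)"] T_def[of "s n"]
      by (simp add: T_def flip: smult_minus)
    also have "\<dots> \<le> cmod c * (nrm A (s (Suc n) \<ominus> s n) * nrm A (s (Suc n))
        + nrm A (s n) * nrm A (s (Suc n) \<ominus> s n))"
      using nrm_add_minus_le[of "y \<otimes> y" "s (Suc n) \<otimes> s (Suc n)" "y \<otimes> y" "s n \<otimes> s n"]
        nrm_mult_minus_le[of "s (Suc n)" "s (Suc n)" "s n" "s n"]
      by (intro mult_left_mono) (auto simp: minus_eq r_neg)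
    also have "\<dots> \<le> cmod c * (nrm A (s (Suc n) \<ominus> s n) * q + q * nrm A (s (Suc n) \<ominus> s n))"
      using s_norm by (intro mult_left_mono add_mono mult_right_mono) auto
    also have "\<dots> = q / r * nrm A (s (Suc n) \<ominus> s n)" using r0 by (simp add: c_norm field_simps)
    finally show ?thesis .
  qed
  have "nrm A (s (Suc n) \<ominus> s n) \<le> nrm A (s 1 \<ominus> s 0) * (q / r) ^ n" for n
  proof (induction n)
    case (Suc n)
    have "nrm A (s (Suc (Suc n)) \<ominus> s (Suc n)) \<le> q / r * (nrm A (s 1 \<ominus> s 0) * (q / r) ^ n)"
      by (rule order_trans[OF lip mult_left_mono[OF Suc]]) (use q0 r0 in auto)
    then show ?case by (simp add: ac_simps)
  qed simp
  then have "cauchy A s"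
    using q0 r0 by (intro cauchy_geometric[of s "q / r"]) auto
  then obtain l where l: "conv A s l" using cauchy_conv by blast
  have lA [simp]: "l \<in> carrier A" using l by (rule conv_in)
  have "conv A (\<lambda>n. s (Suc n)) (c \<odot> (y \<otimes> y \<oplus> l \<otimes> l))"
    unfolding s_Suc T_def by (intro conv_smult conv_add conv_mult l conv_const yA)
  with conv_Suc[OF l] have "l = c \<odot> (y \<otimes> y \<oplus> l \<otimes> l)" by (rule conv_unique)
  then have "complex_of_real (2 * r) \<odot> l = complex_of_real (2 * r) \<odot> (c \<odot> (y \<otimes> y \<oplus> l \<otimes> l))"
    by simp
  also have "\<dots> = y \<otimes> y \<oplus> l \<otimes> l"
    using r0 by (simp add: smult_smult c_def)
  finally have eq: "l \<otimes> l \<oplus> y \<otimes> y = complex_of_real (2 * r) \<odot> l"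
    by (simp add: a_comm)
  have "conv A s (adj A l)" using conv_adj[OF l] by (simp add: s_adj)
  then have "adj A l = l" using l by (rule conv_unique)
  moreover have "z \<otimes> l = l \<otimes> z" if z: "z \<in> carrier A" "z \<otimes> y = y \<otimes> z" for z
  proof (rule conv_unique)
    show "conv A (\<lambda>n. z \<otimes> s n) (z \<otimes> l)" by (rule conv_mult[OF conv_const[OF z(1)] l])
    show "conv A (\<lambda>n. z \<otimes> s n) (l \<otimes> z)"
      unfolding s_comm[OF z] by (rule conv_mult[OF l conv_const[OF z(1)]])
  qed
  moreover have "l \<in> I" using D(7)[OF sI l] .
  ultimately show ?thesis using eq by blast
qed

text \<open>With \<open>h = y\<^sup>2\<close> and \<open>(1 - s)\<^sup>2 = 1 - h\<close>, the
  element \<open>y (1 - s)\<close> has square \<open>h (1 - h)\<close>. As \<open>t (1 - t)\<close>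
  increases on \<open>[0, 1/2]\<close>, a bound \<open>r (1 - r)\<close> is expected. It is
  certified by the factorization \<open>r (1 - r) - h (1 - h) = (r - h) (1 - r - h)\<close>: both
  factors have square roots, obtained from \<open>p\<close> and \<open>q\<close>, because the
  squared norm of \<open>y\<close> is below \<open>r\<close> and
  \<open>r \<le> 1 - r\<close>.\<close>

lemma approx_unit_step:
  assumes I: "closed_ideal I A" and y: "y \<in> I" "adj A y = y"
    and r: "(nrm A y)\<^sup>2 < r" "r \<le> 1 / 2"
  shows "\<exists>s\<in>I. (\<forall>z\<in>carrier A. nrm A (z \<ominus> z \<otimes> s) \<le> nrm A z) \<and>
    adj A (y \<ominus> y \<otimes> s) = y \<ominus> y \<otimes> s \<and> (nrm A (y \<ominus> y \<otimes> s))\<^sup>2 \<le> r * (1 - r)"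
proof -
  note D = closed_idealD[OF I]
  have yA [simp]: "y \<in> carrier A" using y D by auto
  have r0: "r > 0" using r by (smt (verit) zero_le_power2)
  define h where "h = y \<otimes> y"
  have hA [simp]: "h \<in> carrier A" by (simp add: h_def)
  \<comment> \<open>\<open>sq t s\<close> says that \<open>sqrt t - s\<close> is a self-adjoint
    square root of \<open>t - h\<close> in the double commutant of \<open>y\<close>.\<close>
  define sq where "sq t s \<longleftrightarrow> s \<in> I \<and> adj A s = s \<and>
    (\<forall>z\<in>carrier A. z \<otimes> y = y \<otimes> z \<longrightarrow> z \<otimes> s = s \<otimes> z) \<and>
    s \<otimes> s \<oplus> h = complex_of_real (2 * sqrt t) \<odot> s" for t s
  have ex: "\<exists>s. sq t s" if "r \<le> t" for t
    using sqrt_exists[OF I y, of "sqrt t"] that r unfolding h_def sq_def Bex_def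
    by (simp add: real_less_rsqrt)
  have sqD: "s \<in> I" "adj A s = s" "z \<in> carrier A \<Longrightarrow> z \<otimes> y = y \<otimes> z \<Longrightarrow> z \<otimes> s = s \<otimes> z"
    "s \<otimes> s \<oplus> h = complex_of_real (2 * sqrt t) \<odot> s" if "sq t s" for s t z
    using that by (simp_all add: sq_def)
  obtain s where s0: "sq 1 s" using ex[of 1] r by auto
  obtain p where p0: "sq r p" using ex[of r] by auto
  obtain q where q0: "sq (1 - r) q" using ex[of "1 - r"] r by auto
  note s = sqD[OF s0] and p = sqD[OF p0] and q = sqD[OF q0]
  have [simp]: "s \<in> carrier A" "p \<in> carrier A" "q \<in> carrier A"
    using D(1) s(1) p(1) q(1) by blast+
  have comm: "y \<otimes> s = s \<otimes> y" "y \<otimes> p = p \<otimes> y" "y \<otimes> q = q \<otimes> y"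
    using s(3)[of y] p(3)[of y] q(3)[of y] by simp_all
  \<comment> \<open>Each root commutes with everything that commutes with \<open>y\<close>, hence
    with the other roots.\<close>
  then have comm': "p \<otimes> s = s \<otimes> p" "q \<otimes> s = s \<otimes> q" "p \<otimes> q = q \<otimes> p"
    using s(3)[of p] s(3)[of q] q(3)[of p] by simp_all
  have sqs: "rop A 1 s (rop A 1 s z) = rop A 1 h z"
    "rop A (sqrt r) p (rop A (sqrt r) p z) = rop A r h z"
    "rop A (sqrt (1 - r)) q (rop A (sqrt (1 - r)) q z) = rop A (1 - r) h z"
    if "z \<in> carrier A" for z
    using rop_square[of s h z 1] rop_square[of p h z "sqrt r"] rop_square[of q h z "sqrt (1 - r)"]
      that s(4) p(4) q(4) r r0 by simp_all
  have sqy: "rop A 0 y (rop A 0 y z) = z \<otimes> h" if "z \<in> carrier A" for z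
    using that by (simp add: rop_rop h_def minus_eq)
  \<comment> \<open>The partner of \<open>1 - s\<close> is \<open>y\<close> itself, up to sign:
    \<open>rop A 0 y\<close> is right multiplication by \<open>- y\<close>, and
    \<open>(1 - s)\<^sup>2 + y\<^sup>2 = 1\<close>.\<close>
  have contr: "nrm A (z \<ominus> z \<otimes> s) \<le> nrm A z" if z: "z \<in> carrier A" for z
  proof -
    have "nrm A (rop A 1 s z) \<le> sqrt 1 * nrm A z"
    proof (rule nrm_sa_op_le[where Y = "rop A 0 y"])
      show "rop A 1 s (rop A 1 s z) \<oplus> rop A 0 y (rop A 0 y z) = complex_of_real 1 \<odot> z"
        if "z \<in> carrier A" for z
        using that by (simp add: sqs sqy) (simp add: rop_def minus_eq a_assoc l_neg)
    qed (simp_all add: z s(2) y(2) comm sa_op_rop rop_commute[of s y])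
    then show ?thesis using z by (simp add: rop_def)
  qed
  have sa: "adj A (y \<ominus> y \<otimes> s) = y \<ominus> y \<otimes> s"
    by (simp add: adj_minus adj_mult s(2) y(2) comm)
  have "nrm A (y \<ominus> y \<otimes> s) \<le> sqrt (r * (1 - r))"
  proof (rule nrm_le_of_rop)
    fix z assume z: "z \<in> carrier A"
    let ?X = "\<lambda>z. rop A 0 y (rop A 1 s z)"
    let ?Y = "\<lambda>z. rop A (sqrt r) p (rop A (sqrt (1 - r)) q z)"
    have XX: "?X (?X z) = rop A 1 h z \<otimes> h" if "z \<in> carrier A" for z
      using that comm by (simp add: sqs sqy rop_commute[of s y])
    have YY: "?Y (?Y z) = rop A r h (rop A (1 - r) h z)" if "z \<in> carrier A" for z
      using that comm' by (simp add: sqs rop_commute[of q p])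
    have "nrm A (?X z) \<le> sqrt (r * (1 - r)) * nrm A z"
    proof (rule nrm_sa_op_le[where Y = ?Y])
      fix z assume z [simp]: "z \<in> carrier A"
      have zh: "z \<otimes> h \<in> carrier A" "z \<otimes> (h \<otimes> h) \<in> carrier A" by simp_all
      obtain L where L: "coords L z (z \<otimes> h) (z \<otimes> (h \<otimes> h)) z" by (rule linear4[OF z zh z])
      note L = coordsD[OF L]
      have "rop A 1 h z \<otimes> h = z \<otimes> h \<ominus> z \<otimes> (h \<otimes> h)"
        by (simp add: rop_def mult_minus_left mult_assoc)
      then show "?X (?X z) \<oplus> ?Y (?Y z) = complex_of_real (r * (1 - r)) \<odot> z"
        unfolding XX[OF z] YY[OF z]
        by (simp add: rop_rop L(2,3)) (simp add: L(1) L(6-9) algebra_simps)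
      show "?X (?Y z) = ?Y (?X z)"
        by (simp add: rop_commute[OF _ _ _ comm'(1)[symmetric]] rop_commute[OF _ _ _ comm'(2)[symmetric]]
            rop_commute[OF _ _ _ comm(2)] rop_commute[OF _ _ _ comm(3)])
    next
      show "sa_op A ?X"
        by (rule sa_op_comp[OF sa_op_rop sa_op_rop]) (simp_all add: s(2) y(2) comm rop_commute[of y s])
      show "sa_op A ?Y"
        by (rule sa_op_comp[OF sa_op_rop sa_op_rop]) (simp_all add: p(2) q(2) comm' rop_commute[of p q])
    qed (use z r r0 in auto)
    moreover have "?X z = \<ominus> (z \<otimes> (y \<ominus> y \<otimes> s))"
      using z by (simp add: rop_def mult_minus_right mult_minus_left mult_assoc comm(1) minus_eq[of \<zero>])
    ultimately show "nrm A (z \<otimes> (y \<ominus> y \<otimes> s)) \<le> sqrt (r * (1 - r)) * nrm A z"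
      using z by simp
  qed (use r r0 in auto)
  then have "(nrm A (y \<ominus> y \<otimes> s))\<^sup>2 \<le> (sqrt (r * (1 - r)))\<^sup>2"
    by (intro power_mono) auto
  then show ?thesis using contr sa s(1) r r0 by (intro bexI[of _ s]) (simp_all add: less_imp_le)
qed


end

text \<open>This is \<open>(1 - u) (1 - v) = 1 - (u + v - u v)\<close> without a unit. It shows that
  products of factors \<open>1 - u\<close> with \<open>u\<close> in an ideal are again of this
  form.\<close>

lemma (in star_algebra_laws) minus_mult_circle:
  assumes z: "z \<in> carrier A" and u: "u \<in> carrier A" and v: "v \<in> carrier A"
  shows "z \<ominus> z \<otimes> (u \<oplus> v \<ominus> u \<otimes> v) = (z \<ominus> z \<otimes> u) \<ominus> (z \<ominus> z \<otimes> u) \<otimes> v"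
proof -
  have cl: "z \<otimes> u \<in> carrier A" "z \<otimes> v \<in> carrier A" "z \<otimes> (u \<otimes> v) \<in> carrier A"
    using assms by auto
  obtain L where L: "coords L z (z \<otimes> u) (z \<otimes> v) (z \<otimes> (u \<otimes> v))" by (rule linear4[OF z cl])
  note L = coordsD[OF L]
  have "z \<otimes> (u \<oplus> v \<ominus> u \<otimes> v) = z \<otimes> u \<oplus> z \<otimes> v \<ominus> z \<otimes> (u \<otimes> v)"
    "(z \<ominus> z \<otimes> u) \<otimes> v = z \<otimes> v \<ominus> z \<otimes> (u \<otimes> v)"
    using assms by (simp_all add: mult_minus_right mult_minus_left mult_add_right mult_assoc)
  then show ?thesis by (simp add: L(2-4)) (simp add: L(1) L(6-9))
qed

context cstar
begin

text \<open>The approximate unit of the ideal; \<open>1 - u\<close> is the product of the factors \<open>1 - s\<close> above.\<close>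

lemma approx_unit_sa:
  assumes I: "closed_ideal I A" and y: "y \<in> I" "adj A y = y" "(nrm A y)\<^sup>2 < 1 / 2"
  shows "\<exists>u\<in>I. (\<forall>z\<in>carrier A. nrm A (z \<ominus> z \<otimes> u) \<le> nrm A z) \<and>
    adj A (y \<ominus> y \<otimes> u) = y \<ominus> y \<otimes> u \<and> (nrm A (y \<ominus> y \<otimes> u))\<^sup>2 < 1 / (real k + 2)"
proof (induction k)
  case 0
  have "y \<in> carrier A" using y(1) by (rule closed_idealD(1)[OF I])
  then show ?case using y closed_idealD(2)[OF I] by (intro bexI[of _ \<zero>]) auto
next
  case (Suc k)
  note D = closed_idealD[OF I]
  have yA [simp]: "y \<in> carrier A" using y(1) by (rule D(1))
  from Suc obtain u where u: "u \<in> I" "\<forall>z\<in>carrier A. nrm A (z \<ominus> z \<otimes> u) \<le> nrm A z"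
    "adj A (y \<ominus> y \<otimes> u) = y \<ominus> y \<otimes> u" "(nrm A (y \<ominus> y \<otimes> u))\<^sup>2 < 1 / (real k + 2)"
    by blast
  have uA [simp]: "u \<in> carrier A" using u(1) by (rule D(1))
  define x where "x = y \<ominus> y \<otimes> u"
  have xI: "x \<in> I" unfolding x_def by (intro D(8) D(6) y(1) uA)
  have r: "1 / (real k + 2) \<le> 1 / 2" by (simp add: field_simps)
  obtain s where s: "s \<in> I" "\<forall>z\<in>carrier A. nrm A (z \<ominus> z \<otimes> s) \<le> nrm A z"
    "adj A (x \<ominus> x \<otimes> s) = x \<ominus> x \<otimes> s"
    "(nrm A (x \<ominus> x \<otimes> s))\<^sup>2 \<le> 1 / (real k + 2) * (1 - 1 / (real k + 2))"
    using approx_unit_step[OF I xI u(3,4)[folded x_def] r] by blast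
  have sA [simp]: "s \<in> carrier A" using s(1) by (rule D(1))
  define v where "v = u \<oplus> s \<ominus> u \<otimes> s"
  have eq: "z \<ominus> z \<otimes> v = (z \<ominus> z \<otimes> u) \<ominus> (z \<ominus> z \<otimes> u) \<otimes> s" if z: "z \<in> carrier A" for z
    unfolding v_def by (rule minus_mult_circle[OF z uA sA])
  \<comment> \<open>The bound evolves by \<open>r (1 - r)\<close>, which sends
    \<open>1 / (k + 2)\<close> strictly below \<open>1 / (k + 3)\<close> because
    \<open>(k + 1) (k + 3) < (k + 2)\<^sup>2\<close>. The start \<open>1 / 2\<close> is the largest
    \<open>r\<close> that a single step admits.\<close>
  have "1 / (real (Suc k) + 2) - 1 / (real k + 2) * (1 - 1 / (real k + 2))
      = 1 / ((real k + 3) * (real k + 2) * (real k + 2))"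
    by (simp add: divide_simps) (simp add: algebra_simps)
  moreover have "1 / ((real k + 3) * (real k + 2) * (real k + 2)) > 0" by simp
  ultimately have "1 / (real k + 2) * (1 - 1 / (real k + 2)) < 1 / (real (Suc k) + 2)" by linarith
  with s(4) have "(nrm A (x \<ominus> x \<otimes> s))\<^sup>2 < 1 / (real (Suc k) + 2)" by linarith
  moreover have "v \<in> I" unfolding v_def by (intro D(8) D(6) D(3) u(1) s(1) sA)
  moreover have "nrm A (z \<ominus> z \<otimes> v) \<le> nrm A z" if z: "z \<in> carrier A" for z
    unfolding eq[OF z] using u(2) s(2) z by (meson minus_in mult_closed order_trans uA)
  ultimately show ?case
    using s(3) unfolding x_def eq[OF yA, symmetric] by (intro bexI[of _ v]) auto
qed

lemma nrm_minus_mult_square_le: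
  assumes "x \<in> carrier A" "u \<in> carrier A"
    and le: "\<And>z. z \<in> carrier A \<Longrightarrow> nrm A (z \<ominus> z \<otimes> u) \<le> nrm A z"
  shows "(nrm A (x \<ominus> x \<otimes> u))\<^sup>2 \<le> nrm A (adj A x \<otimes> x \<ominus> adj A x \<otimes> x \<otimes> u)"
proof -
  define g where "g = adj A x \<otimes> x \<ominus> adj A x \<otimes> x \<otimes> u"
  have gA [simp]: "g \<in> carrier A" using assms by (simp add: g_def)
  have "adj A (x \<ominus> x \<otimes> u) \<otimes> (x \<ominus> x \<otimes> u) = g \<ominus> adj A u \<otimes> g"
    using assms by (simp add: g_def adj_minus adj_mult mult_minus_left mult_minus_right mult_assoc)
      (simp add: minus_eq minus_add a_ac)
  also have "\<dots> = adj A (adj A g \<ominus> adj A g \<otimes> u)"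
    using assms by (simp add: adj_minus adj_mult)
  finally have "(nrm A (x \<ominus> x \<otimes> u))\<^sup>2 = nrm A (adj A g \<ominus> adj A g \<otimes> u)"
    using assms cstar_identity[of "x \<ominus> x \<otimes> u"] by simp
  also have "\<dots> \<le> nrm A (adj A g)" by (rule le) simp
  finally show ?thesis by (simp flip: g_def)
qed

text \<open>The self-adjoint case is applied to a small multiple of
  \<open>adj A y \<otimes> y\<close>, which again lies in the ideal; the square estimate then bounds
  \<open>y (1 - u)\<close>.\<close>

lemma approx_unit:
  assumes I: "closed_ideal I A" and y: "y \<in> I" and e: "e > 0"
  shows "\<exists>u\<in>I. (\<forall>z\<in>carrier A. nrm A (z \<ominus> z \<otimes> u) \<le> nrm A z) \<and> nrm A (y \<ominus> y \<otimes> u) < e"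
proof -
  note D = closed_idealD[OF I]
  have yA [simp]: "y \<in> carrier A" using y by (rule D(1))
  define h where "h = adj A y \<otimes> y"
  have hI: "h \<in> I" unfolding h_def by (intro D(5) y adj_closed yA)
  have hA [simp]: "h \<in> carrier A" using hI by (rule D(1))
  define t where "t = 1 / (2 * (nrm A h + 1))"
  have t: "t > 0" using nrm_nonneg[OF hA] by (simp add: t_def add_nonneg_pos)
  define x where "x = complex_of_real t \<odot> h"
  have x: "x \<in> I" "adj A x = x"
    unfolding x_def by (rule D(4)[OF hI], simp add: adj_smult h_def adj_mult)
  have "t * nrm A h < t * (nrm A h + 1)" using t by simp
  also have "\<dots> = 1 / 2" using nrm_nonneg[OF hA] by (simp add: t_def add_nonneg_eq_0_iff)
  finally have "t * nrm A h < 1 / 2" .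
  then have "(t * nrm A h)\<^sup>2 < (1 / 2)\<^sup>2" using t by (intro power_strict_mono) auto
  then have xs: "(nrm A x)\<^sup>2 < 1 / 2"
    using t by (simp add: x_def power2_eq_square)
  \<comment> \<open>Two square roots are taken: one because the self-adjoint case bounds a squared
    norm, and one in passing from \<open>h\<close> back to \<open>y\<close>.\<close>
  obtain k where k: "1 / (real k + 2) < (t * e\<^sup>2)\<^sup>2"
  proof -
    have "(t * e\<^sup>2)\<^sup>2 > 0" using t e by simp
    then obtain k where "inverse (real (Suc k)) < (t * e\<^sup>2)\<^sup>2" using reals_Archimedean by blast
    moreover have "1 / (real k + 2) \<le> inverse (real (Suc k))" by (simp add: field_simps)
    ultimately show ?thesis using that[of k] by linarith
  qed
  obtain u where u: "u \<in> I" "\<forall>z\<in>carrier A. nrm A (z \<ominus> z \<otimes> u) \<le> nrm A z"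
    "(nrm A (x \<ominus> x \<otimes> u))\<^sup>2 < 1 / (real k + 2)"
    using approx_unit_sa[OF I x xs, of k] by blast
  have uA [simp]: "u \<in> carrier A" using u(1) by (rule D(1))
  have "(nrm A (x \<ominus> x \<otimes> u))\<^sup>2 < (t * e\<^sup>2)\<^sup>2" using u(3) k by linarith
  then have "nrm A (x \<ominus> x \<otimes> u) < t * e\<^sup>2" by (rule power_less_imp_less_base) (use t in simp)
  moreover have "x \<ominus> x \<otimes> u = complex_of_real t \<odot> (h \<ominus> h \<otimes> u)"
    by (simp add: x_def smult_minus smult_mult_left)
  ultimately have "nrm A (h \<ominus> h \<otimes> u) < e\<^sup>2" using t by simp
  moreover have "(nrm A (y \<ominus> y \<otimes> u))\<^sup>2 \<le> nrm A (h \<ominus> h \<otimes> u)"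
    unfolding h_def using u(2) by (intro nrm_minus_mult_square_le) auto
  ultimately have "(nrm A (y \<ominus> y \<otimes> u))\<^sup>2 < e\<^sup>2" by linarith
  then have "nrm A (y \<ominus> y \<otimes> u) < e" by (rule power_less_imp_less_base) (use e in simp)
  with u show ?thesis by blast
qed

text \<open>The definition of a closed ideal does not mention the involution. The adjoint of
  \<open>x\<close> is recovered as a limit of elements \<open>adj A x \<otimes> u\<close> of the
  ideal, with \<open>u\<close> an approximate unit for \<open>x \<otimes> adj A x\<close>; the
  square estimate for \<open>adj A x\<close> gives the convergence.\<close>

lemma closed_ideal_adj:
  assumes I: "closed_ideal I A" and x: "x \<in> I"
  shows "adj A x \<in> I"
proof -
  note D = closed_idealD[OF I]
  have xA [simp]: "x \<in> carrier A" using x by (rule D(1))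
  have "\<exists>v\<in>I. nrm A (v \<ominus> adj A x) < 1 / real (Suc n)" for n
  proof -
    define e where "e = (1 / real (Suc n))\<^sup>2"
    have "x \<otimes> adj A x \<in> I" by (intro D(6) x adj_closed xA)
    then obtain u where u: "u \<in> I" "\<forall>z\<in>carrier A. nrm A (z \<ominus> z \<otimes> u) \<le> nrm A z"
      "nrm A (x \<otimes> adj A x \<ominus> x \<otimes> adj A x \<otimes> u) < e"
      using approx_unit[OF I, of "x \<otimes> adj A x" e] by (auto simp: e_def)
    have uA [simp]: "u \<in> carrier A" using u(1) by (rule D(1))
    have "(nrm A (adj A x \<ominus> adj A x \<otimes> u))\<^sup>2 \<le> nrm A (x \<otimes> adj A x \<ominus> x \<otimes> adj A x \<otimes> u)"
      using nrm_minus_mult_square_le[of "adj A x" u] u(2) by simp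
    then have "(nrm A (adj A x \<ominus> adj A x \<otimes> u))\<^sup>2 < (1 / real (Suc n))\<^sup>2"
      using u(3) by (simp add: e_def)
    then have "nrm A (adj A x \<ominus> adj A x \<otimes> u) < 1 / real (Suc n)"
      by (rule power_less_imp_less_base) simp
    moreover have "adj A x \<otimes> u \<in> I" by (intro D(5) u(1) adj_closed xA)
    ultimately show ?thesis
      using nrm_minus_commute[of "adj A x \<otimes> u" "adj A x"] by (intro bexI[of _ "adj A x \<otimes> u"]) simp_all
  qed
  then obtain v where v: "\<And>n. v n \<in> I" "\<And>n. nrm A (v n \<ominus> adj A x) < 1 / real (Suc n)"
    by metis
  have "conv A v (adj A x)"
  proof (rule convI)
    show "nrm A (v n \<ominus> adj A x) \<le> 1 / real (Suc n)" for n using v(2)[of n] by simp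
    show "v n \<in> carrier A" for n using v(1) by (rule D(1))
    show "(\<lambda>n. 1 / real (Suc n)) \<longlonglongrightarrow> 0" by (rule LIMSEQ_Suc[OF lim_1_over_n])
  qed simp
  with v(1) show ?thesis by (rule D(7))
qed

lemma cstar_closed_ideal:
  assumes I: "closed_ideal I A"
  shows "star_subalgebra I A"
  unfolding star_subalgebra_def
proof (intro conjI ballI allI subsetI)
  note D = closed_idealD[OF I]
  show "x \<in> I \<Longrightarrow> x \<in> carrier A" for x by (rule D(1))
  show "\<zero> \<in> I" by (rule D(2))
  show "x \<in> I \<Longrightarrow> y \<in> I \<Longrightarrow> x \<oplus> y \<in> I" for x y by (rule D(3))
  show "x \<in> I \<Longrightarrow> y \<in> I \<Longrightarrow> x \<otimes> y \<in> I" for x y by (rule D(5)[OF _ D(1)])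
  show "x \<in> I \<Longrightarrow> adj A x \<in> I" for x by (rule closed_ideal_adj[OF I])
  show "x \<in> I \<Longrightarrow> c \<odot> x \<in> I" for x c by (rule D(4))
qed

lemma cstar_restrict_closed_ideal: "closed_ideal I A \<Longrightarrow> cstar (A\<lparr>carrier := I\<rparr>)"
  by (rule cstar_restrict[OF cstar_closed_ideal]) (simp_all add: closed_ideal_def)

end

section \<open>Homomorphisms\<close>

lemma star_homD:
  assumes "f \<in> star_hom A B"
  shows "x \<in> carrier A \<Longrightarrow> f x \<in> carrier B"
    "x \<in> carrier A \<Longrightarrow> y \<in> carrier A \<Longrightarrow> f (x \<oplus>\<^bsub>A\<^esub> y) = f x \<oplus>\<^bsub>B\<^esub> f y"
    "x \<in> carrier A \<Longrightarrow> y \<in> carrier A \<Longrightarrow> f (x \<otimes>\<^bsub>A\<^esub> y) = f x \<otimes>\<^bsub>B\<^esub> f y"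
    "x \<in> carrier A \<Longrightarrow> f (c \<odot>\<^bsub>A\<^esub> x) = c \<odot>\<^bsub>B\<^esub> f x"
    "x \<in> carrier A \<Longrightarrow> f (adj A x) = adj B (f x)"
  using assms by (auto simp: star_hom_def hom_def)

lemma star_homI:
  assumes "\<And>x. x \<in> carrier A \<Longrightarrow> f x \<in> carrier B"
    "\<And>x y. x \<in> carrier A \<Longrightarrow> y \<in> carrier A \<Longrightarrow> f (x \<oplus>\<^bsub>A\<^esub> y) = f x \<oplus>\<^bsub>B\<^esub> f y"
    "\<And>x y. x \<in> carrier A \<Longrightarrow> y \<in> carrier A \<Longrightarrow> f (x \<otimes>\<^bsub>A\<^esub> y) = f x \<otimes>\<^bsub>B\<^esub> f y"
    "\<And>c x. x \<in> carrier A \<Longrightarrow> f (c \<odot>\<^bsub>A\<^esub> x) = c \<odot>\<^bsub>B\<^esub> f x"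
    "\<And>x. x \<in> carrier A \<Longrightarrow> f (adj A x) = adj B (f x)"
  shows "f \<in> star_hom A B"
  using assms by (auto simp: star_hom_def hom_def)

locale star_hom_pair = A: star_algebra_laws A + B: star_algebra_laws B
  for A :: "('a, 'm) star_algebra_scheme" and B :: "('b, 'n) star_algebra_scheme" and f +
  assumes f: "f \<in> star_hom A B"
begin

lemmas hom_in [simp] = star_homD(1)[OF f]
lemmas hom_simps [simp] = star_homD(2-5)[OF f]

lemma hom_zero [simp]: "f \<zero>\<^bsub>A\<^esub> = \<zero>\<^bsub>B\<^esub>"
  using star_homD(4)[OF f, of "\<zero>\<^bsub>A\<^esub>" 0] by simp

lemma hom_minus [simp]: "x \<in> carrier A \<Longrightarrow> y \<in> carrier A \<Longrightarrow> f (x \<ominus>\<^bsub>A\<^esub> y) = f x \<ominus>\<^bsub>B\<^esub> f y"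
  by (simp add: A.minus_smult B.minus_smult)

end

text \<open>The root \<open>s\<close> is formed in the complete source, and \<open>1 - f s\<close>
  is then the partner of \<open>f x\<close> in the target.\<close>

lemma star_hom_nrm_le_1:
  assumes "cstar A" "pre_cstar B" and f: "f \<in> star_hom A B"
    and x: "x \<in> carrier A" "adj A x = x" "nrm A x < 1"
  shows "nrm B (f x) \<le> 1"
proof -
  interpret A: cstar A by fact
  interpret B: pre_cstar B by fact
  interpret star_hom_pair A B f by unfold_locales (rule f)
  obtain s where s: "s \<in> carrier A" "adj A s = s" "x \<otimes>\<^bsub>A\<^esub> s = s \<otimes>\<^bsub>A\<^esub> x"
    "s \<otimes>\<^bsub>A\<^esub> s \<oplus>\<^bsub>A\<^esub> x \<otimes>\<^bsub>A\<^esub> x = complex_of_real (2 * 1) \<odot>\<^bsub>A\<^esub> s"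
    using A.sqrt_exists[OF A.closed_ideal_carrier x] x(1) by blast
  have b: "f x \<in> carrier B" "adj B (f x) = f x" and d: "f s \<in> carrier B" "adj B (f s) = f s"
    using x s by (simp_all flip: hom_simps(4))
  have comm: "f x \<otimes>\<^bsub>B\<^esub> f s = f s \<otimes>\<^bsub>B\<^esub> f x"
    using x s by (simp flip: hom_simps(2))
  have sq: "f s \<otimes>\<^bsub>B\<^esub> f s \<oplus>\<^bsub>B\<^esub> f x \<otimes>\<^bsub>B\<^esub> f x = complex_of_real (2 * 1) \<odot>\<^bsub>B\<^esub> f s"
    using x s by (simp flip: hom_simps)
  have "nrm B (z \<otimes>\<^bsub>B\<^esub> f x) \<le> 1 * nrm B z" if z: "z \<in> carrier B" for z
  proof -
    have "nrm B (rop B 0 (f x) z) \<le> sqrt 1 * nrm B z"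
    proof (rule B.nrm_sa_op_le[where Y = "rop B 1 (f s)"])
      fix z assume z: "z \<in> carrier B"
      have "rop B 1 (f s) (rop B 1 (f s) z) = z \<ominus>\<^bsub>B\<^esub> z \<otimes>\<^bsub>B\<^esub> (f x \<otimes>\<^bsub>B\<^esub> f x)"
        using B.rop_square[OF d(1) _ z sq] b z by (simp add: rop_def)
      moreover have "rop B 0 (f x) (rop B 0 (f x) z) = z \<otimes>\<^bsub>B\<^esub> (f x \<otimes>\<^bsub>B\<^esub> f x)"
        using b z by (simp add: B.rop_rop B.minus_eq)
      ultimately show "rop B 0 (f x) (rop B 0 (f x) z) \<oplus>\<^bsub>B\<^esub> rop B 1 (f s) (rop B 1 (f s) z)
          = complex_of_real 1 \<odot>\<^bsub>B\<^esub> z"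
        using b z by (simp add: B.minus_eq B.a_lcomm[of _ z] B.r_neg)
    qed (simp_all add: z b d comm B.sa_op_rop B.rop_commute[of "f x" "f s"])
    then show ?thesis using z b by (simp add: rop_def B.minus_eq)
  qed
  then show ?thesis using B.nrm_le_of_rop[OF b(1) zero_le_one] by simp
qed

lemma star_hom_contractive:
  assumes "cstar A" "pre_cstar B" and f: "f \<in> star_hom A B" and x: "x \<in> carrier A"
  shows "nrm B (f x) \<le> nrm A x"
proof -
  interpret A: cstar A by fact
  interpret B: pre_cstar B by fact
  interpret star_hom_pair A B f by unfold_locales (rule f)
  have sa: "nrm B (f y) \<le> nrm A y" if y: "y \<in> carrier A" "adj A y = y" for y
  proof (rule field_le_epsilon)
    fix e :: real assume e: "e > 0"
    \<comment> \<open>Dividing by slightly more than \<open>nrm A y\<close> makes the norm strictly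
      less than 1, as the existence of the root requires, and covers \<open>y = 0\<close>.\<close>
    define t where "t = nrm A y + e"
    have t: "t > 0" "nrm A y < t" using e A.nrm_nonneg[OF y(1)] by (simp_all add: t_def add_nonneg_pos)
    define z where "z = complex_of_real (1 / t) \<odot>\<^bsub>A\<^esub> y"
    have "nrm B (f z) \<le> 1"
      using t y by (intro star_hom_nrm_le_1[OF assms(1-3)]) (simp_all add: z_def A.adj_smult norm_divide)
    then show "nrm B (f y) \<le> nrm A y + e"
      using t y unfolding t_def[symmetric] by (simp add: z_def norm_divide field_simps)
  qed
  have "(nrm B (f x))\<^sup>2 = nrm B (f (adj A x \<otimes>\<^bsub>A\<^esub> x))"
    using x B.cstar_identity[of "f x"] by simp
  also have "\<dots> \<le> nrm A (adj A x \<otimes>\<^bsub>A\<^esub> x)"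
    using x by (intro sa) (simp_all add: A.adj_mult)
  finally have "(nrm B (f x))\<^sup>2 \<le> (nrm A x)\<^sup>2" using x by (simp add: A.cstar_identity)
  then show ?thesis by (rule power2_le_imp_le) (simp add: x)
qed

lemma star_hom_inv_into:
  assumes "star_algebra_laws A" "star_algebra_laws B"
    and f: "f \<in> star_hom A B" and bij: "bij_betw f (carrier A) (carrier B)"
  shows "inv_into (carrier A) f \<in> star_hom B A"
proof -
  interpret A: star_algebra_laws A by fact
  interpret B: star_algebra_laws B by fact
  interpret star_hom_pair A B f by unfold_locales (rule f)
  let ?g = "inv_into (carrier A) f"
  have g: "?g y \<in> carrier A" "f (?g y) = y" if "y \<in> carrier B" for y
    using that bij by (auto simp: bij_betw_def inv_into_into f_inv_into_f)
  have gf: "?g y = x" if "x \<in> carrier A" "f x = y" for x y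
    using that bij by (auto simp: bij_betw_def)
  show ?thesis
    by (rule star_homI) (auto intro!: gf simp: g)
qed

lemma star_hom_bij_isometric:
  assumes "cstar A" "cstar B" and f: "f \<in> star_hom A B"
    and bij: "bij_betw f (carrier A) (carrier B)" and x: "x \<in> carrier A"
  shows "nrm B (f x) = nrm A x"
proof (rule antisym)
  interpret A: cstar A by fact
  interpret B: cstar B by fact
  show "nrm B (f x) \<le> nrm A x"
    by (rule star_hom_contractive[OF assms(1) B.pre_cstar_axioms f x])
  have "inv_into (carrier A) f \<in> star_hom B A"
    by (rule star_hom_inv_into[OF A.star_algebra_laws_axioms B.star_algebra_laws_axioms f bij])
  from star_hom_contractive[OF assms(2) A.pre_cstar_axioms this, of "f x"]
  show "nrm A x \<le> nrm B (f x)"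
    using x bij star_homD(1)[OF f x] by (simp add: bij_betw_def)
qed

section \<open>Quotients\<close>

context star_algebra_laws
begin

lemma add_minus_cancel:
  assumes "x \<in> carrier A" "y \<in> carrier A"
  shows "x \<oplus> (y \<ominus> x) = y" "x \<oplus> y \<ominus> x = y" "x \<ominus> y \<ominus> x = \<ominus> y" "x \<ominus> (x \<ominus> y) = y"
    "x \<ominus> y \<oplus> y = x"
proof -
  obtain L where L: "coords L x y x y" by (rule linear4[OF assms assms])
  note L = coordsD[OF L]
  show "x \<oplus> (y \<ominus> x) = y" "x \<oplus> y \<ominus> x = y" "x \<ominus> y \<ominus> x = \<ominus> y" "x \<ominus> (x \<ominus> y) = y"
    "x \<ominus> y \<oplus> y = x"
    by (simp_all add: L(1,2) L(6-9))
qed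

end

lemma (in pre_cstar) conv_subseq:
  assumes s: "cauchy A s" and r: "strict_mono r" and "conv A (\<lambda>k. s (r k)) x"
  shows "conv A s x"
proof -
  have in_A: "s n \<in> carrier A" for n using s by (rule cauchy_in)
  have "limitin metric.mtopology (s \<circ> r) x sequentially"
    using limitin_iff_conv[of "s \<circ> r" x] assms(3) in_A by (simp add: o_def)
  then have "limitin metric.mtopology s x sequentially"
    by (rule metric.MCauchy_convergent_subsequence[OF _ r, rotated]) (simp add: MCauchy_iff s)
  then show ?thesis using limitin_iff_conv[of s x] in_A by simp
qed

text \<open>
  The lift is built along a rapidly converging subsequence, lifting the increments one by one.
\<close>

lemma cauchy_lift:
  assumes "pre_cstar M" "pre_cstar N" and g: "g \<in> star_hom M N"
    and lift: "\<And>c. c \<in> carrier N \<Longrightarrow> \<exists>b\<in>carrier M. g b = c \<and> nrm M b \<le> 2 * nrm N c"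
    and s: "cauchy N s"
  shows "\<exists>r t. strict_mono r \<and> cauchy M t \<and> (\<forall>k. g (t k) = s (r k))"
proof -
  interpret M: pre_cstar M by fact
  interpret N: pre_cstar N by fact
  interpret star_hom_pair M N g by unfold_locales (rule g)
  have s_in: "s n \<in> carrier N" for n using s by (rule N.cauchy_in)
  have "\<forall>k. \<exists>m. \<forall>i\<ge>m. \<forall>j\<ge>m. nrm N (s i \<ominus>\<^bsub>N\<^esub> s j) < (1 / 2) ^ k"
    using N.cauchyD[OF s] by simp
  then obtain m where m: "\<And>k i j. i \<ge> m k \<Longrightarrow> j \<ge> m k \<Longrightarrow> nrm N (s i \<ominus>\<^bsub>N\<^esub> s j) < (1 / 2) ^ k"
    by metis
  \<comment> \<open>The sum of the thresholds dominates each single one, and the added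
    \<open>k\<close> makes \<open>r\<close> strictly increasing.\<close>
  define r where "r k = (\<Sum>i\<le>k. m i) + k" for k
  have r: "strict_mono r" by (simp add: strict_mono_Suc_iff r_def)
  have r_ge: "r k \<ge> m k" for k
    using member_le_sum[of k "{..k}" m] by (simp add: r_def trans_le_add1)
  have rapid: "nrm N (s (r (Suc k)) \<ominus>\<^bsub>N\<^esub> s (r k)) < (1 / 2) ^ k" for k
    using r_ge[of k] strict_mono_mono[OF r, THEN monoD, of k "Suc k"] by (intro m) auto
  have "\<exists>t. \<forall>n. (t n \<in> carrier M \<and> g (t n) = s (r n)) \<and> nrm M (t (Suc n) \<ominus>\<^bsub>M\<^esub> t n) \<le> 2 * (1 / 2) ^ n"
  proof (rule dependent_nat_choice)
    show "\<exists>x. x \<in> carrier M \<and> g x = s (r 0)" using lift[OF s_in] by blast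
    fix x n assume x: "x \<in> carrier M \<and> g x = s (r n)"
    obtain b where b: "b \<in> carrier M" "g b = s (r (Suc n)) \<ominus>\<^bsub>N\<^esub> s (r n)"
      "nrm M b \<le> 2 * nrm N (s (r (Suc n)) \<ominus>\<^bsub>N\<^esub> s (r n))"
      using lift[of "s (r (Suc n)) \<ominus>\<^bsub>N\<^esub> s (r n)"] s_in by auto
    show "\<exists>y. (y \<in> carrier M \<and> g y = s (r (Suc n))) \<and> nrm M (y \<ominus>\<^bsub>M\<^esub> x) \<le> 2 * (1 / 2) ^ n"
    proof (intro exI conjI)
      show "g (x \<oplus>\<^bsub>M\<^esub> b) = s (r (Suc n))"
        using x b s_in by (simp add: N.add_minus_cancel)
      have "x \<oplus>\<^bsub>M\<^esub> b \<ominus>\<^bsub>M\<^esub> x = b"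
        using x b by (simp add: M.add_minus_cancel)
      then show "nrm M (x \<oplus>\<^bsub>M\<^esub> b \<ominus>\<^bsub>M\<^esub> x) \<le> 2 * (1 / 2) ^ n"
        using b(3) rapid[of n] by simp
    qed (use x b in auto)
  qed
  then obtain t where t: "\<And>n. t n \<in> carrier M" "\<And>n. g (t n) = s (r n)"
    "\<And>n. nrm M (t (Suc n) \<ominus>\<^bsub>M\<^esub> t n) \<le> 2 * (1 / 2) ^ n" by blast
  have "cauchy M t" by (rule M.cauchy_geometric[OF t(1) _ _ t(3)]) auto
  with r t(2) show ?thesis by blast
qed

lemma le_mult_INF:
  fixes f :: "'a \<Rightarrow> real"
  assumes "S \<noteq> {}" "c \<ge> 0" "\<And>z. z \<in> S \<Longrightarrow> p \<le> c * f z"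
  shows "p \<le> c * (INF z\<in>S. f z)"
proof (cases "c = 0")
  case True
  then show ?thesis using assms by force
next
  case False
  then have "p / c \<le> (INF z\<in>S. f z)"
    using assms by (intro cINF_greatest) (auto simp: field_simps)
  then show ?thesis using False assms by (simp add: field_simps)
qed

locale cstar_with_ideal = cstar +
  fixes I
  assumes I: "closed_ideal I A"
begin

lemmas ideal_in [simp] = closed_idealD(1)[OF I]
lemmas ideal_zero [simp] = closed_idealD(2)[OF I]
lemmas ideal_add = closed_idealD(3)[OF I]
lemmas ideal_smult = closed_idealD(4)[OF I]
lemmas ideal_mult_left = closed_idealD(5)[OF I]
lemmas ideal_mult_right = closed_idealD(6)[OF I]
lemmas ideal_closed = closed_idealD(7)[OF I]
lemmas ideal_minus = closed_idealD(8)[OF I]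
lemmas ideal_adj = closed_ideal_adj[OF I]

lemma coset_iff:
  assumes x: "x \<in> carrier A"
  shows "z \<in> I +> x \<longleftrightarrow> z \<in> carrier A \<and> z \<ominus> x \<in> I"
proof
  assume "z \<in> I +> x"
  then obtain i where i: "i \<in> I" "z = i \<oplus> x" by (auto simp: a_r_coset_def')
  moreover from i have "z \<ominus> x = i" using x by (simp add: minus_eq a_assoc r_neg)
  ultimately show "z \<in> carrier A \<and> z \<ominus> x \<in> I" using x by simp
next
  assume z: "z \<in> carrier A \<and> z \<ominus> x \<in> I"
  then have "z = (z \<ominus> x) \<oplus> x" using x by (simp add: minus_eq a_assoc l_neg)
  with z show "z \<in> I +> x" by (auto simp: a_r_coset_def')
qed

lemma coset_self: "x \<in> carrier A \<Longrightarrow> x \<in> I +> x"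
  by (simp add: coset_iff minus_eq r_neg)

lemma coset_nonempty [simp]: "x \<in> carrier A \<Longrightarrow> I +> x \<noteq> {}"
  using coset_self by blast

lemma coset_carrier: "x \<in> carrier A \<Longrightarrow> z \<in> I +> x \<Longrightarrow> z \<in> carrier A"
  by (simp add: coset_iff)

lemma coset_eq_iff:
  assumes x: "x \<in> carrier A" and y: "y \<in> carrier A"
  shows "I +> x = I +> y \<longleftrightarrow> x \<ominus> y \<in> I"
proof
  assume "I +> x = I +> y"
  then show "x \<ominus> y \<in> I" using coset_self[OF x] by (simp add: coset_iff y)
next
  assume xy: "x \<ominus> y \<in> I"
  have "z \<ominus> x \<in> I \<longleftrightarrow> z \<ominus> y \<in> I" if z: "z \<in> carrier A" for z
  proof -
    obtain L where L: "coords L x y z z" by (rule linear4[OF x y z z])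
    note L = coordsD[OF L]
    have "z \<ominus> y = (z \<ominus> x) \<oplus> (x \<ominus> y)" "z \<ominus> x = (z \<ominus> y) \<ominus> (x \<ominus> y)"
      by (simp_all add: L)
    then show ?thesis using xy ideal_add ideal_minus by metis
  qed
  then show "I +> x = I +> y" using x y by (auto simp: coset_iff)
qed

lemma coset_eqI: "x \<in> carrier A \<Longrightarrow> z \<in> I +> x \<Longrightarrow> I +> z = I +> x"
  by (simp add: coset_eq_iff coset_iff)

lemma coset_UN:
  assumes x: "x \<in> carrier A" and F: "\<And>z. z \<in> I +> x \<Longrightarrow> F z = c"
  shows "(\<Union>z\<in>I +> x. F z) = c"
  using coset_self[OF x] F by auto

abbreviation "Q \<equiv> quotient_algebra A I"

lemma coset_zero: "I +> \<zero> = I"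
  using coset_iff[of \<zero>] ideal_in by (auto simp del: ideal_in)

lemma Q_simps:
  "carrier Q = (\<lambda>x. I +> x) ` carrier A"
  "\<zero>\<^bsub>Q\<^esub> = I +> \<zero>"
  by (auto simp: quotient_algebra_def A_RCOSETS_def' coset_zero)

lemma Q_nrm: "nrm Q X = (INF z\<in>X. nrm A z)"
  by (simp add: quotient_algebra_def)

text \<open>\<open>set_add\<close> is the set of all sums of representatives, so two inclusions are
  needed. The other operations are unions of cosets that turn out to coincide.\<close>

lemma Q_add:
  assumes x: "x \<in> carrier A" and y: "y \<in> carrier A"
  shows "(I +> x) \<oplus>\<^bsub>Q\<^esub> (I +> y) = I +> (x \<oplus> y)"
proof -
  have "(I +> x) \<oplus>\<^bsub>Q\<^esub> (I +> y) = {u \<oplus> v | u v. u \<in> I +> x \<and> v \<in> I +> y}"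
    by (auto simp: quotient_algebra_def set_add_def')
  also have "\<dots> = I +> (x \<oplus> y)"
  proof (intro equalityI subsetI)
    fix z assume "z \<in> {u \<oplus> v | u v. u \<in> I +> x \<and> v \<in> I +> y}"
    then obtain u v where z: "z = u \<oplus> v" "u \<in> I +> x" "v \<in> I +> y" by blast
    then have uv: "u \<in> carrier A" "v \<in> carrier A" "u \<ominus> x \<in> I" "v \<ominus> y \<in> I"
      using x y by (auto simp: coset_iff)
    obtain L where L: "coords L x y u v" by (rule linear4[OF x y uv(1,2)])
    note L = coordsD[OF L]
    have "z \<ominus> (x \<oplus> y) = (u \<ominus> x) \<oplus> (v \<ominus> y)" unfolding z by (simp add: L)
    then show "z \<in> I +> (x \<oplus> y)" using x y uv ideal_add by (simp add: coset_iff z(1))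
  next
    fix z assume "z \<in> I +> (x \<oplus> y)"
    then have z: "z \<in> carrier A" "z \<ominus> (x \<oplus> y) \<in> I" using x y by (auto simp: coset_iff)
    obtain L where L: "coords L x y z z" by (rule linear4[OF x y z(1) z(1)])
    note L = coordsD[OF L]
    have e: "(z \<ominus> y) \<ominus> x = z \<ominus> (x \<oplus> y)" "z = (z \<ominus> y) \<oplus> y" by (simp_all add: L)
    have "z \<ominus> y \<in> I +> x" using x y z e(1) by (simp add: coset_iff)
    with e(2) coset_self[OF y] show "z \<in> {u \<oplus> v | u v. u \<in> I +> x \<and> v \<in> I +> y}" by blast
  qed
  finally show ?thesis .
qed

lemma Q_mult:
  assumes x: "x \<in> carrier A" and y: "y \<in> carrier A"
  shows "(I +> x) \<otimes>\<^bsub>Q\<^esub> (I +> y) = I +> (x \<otimes> y)"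
proof -
  have "I +> (u \<otimes> v) = I +> (x \<otimes> y)" if u: "u \<in> I +> x" and v: "v \<in> I +> y" for u v
  proof -
    have uv: "u \<in> carrier A" "v \<in> carrier A" "u \<ominus> x \<in> I" "v \<ominus> y \<in> I"
      using u v x y by (auto simp: coset_iff)
    have "u \<otimes> v \<ominus> x \<otimes> y = (u \<ominus> x) \<otimes> v \<oplus> x \<otimes> (v \<ominus> y)"
      using uv x y by (simp add: mult_minus_left mult_minus_right) (simp add: minus_eq a_assoc r_neg1)
    also have "\<dots> \<in> I" using uv x y by (intro ideal_add ideal_mult_left ideal_mult_right) auto
    finally show ?thesis using uv x y by (simp add: coset_eq_iff)
  qed
  then show ?thesis
    using x y by (simp add: quotient_algebra_def rcoset_mult_def coset_UN)
qed

lemma Q_smult: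
  assumes x: "x \<in> carrier A"
  shows "c \<odot>\<^bsub>Q\<^esub> (I +> x) = I +> (c \<odot> x)"
proof -
  have "I +> (c \<odot> u) = I +> (c \<odot> x)" if "u \<in> I +> x" for u
    using that x ideal_smult by (simp add: coset_eq_iff coset_iff flip: smult_minus)
  then show ?thesis using x by (simp add: quotient_algebra_def coset_UN)
qed

lemma Q_adj:
  assumes x: "x \<in> carrier A"
  shows "adj Q (I +> x) = I +> adj A x"
proof -
  have "I +> adj A u = I +> adj A x" if "u \<in> I +> x" for u
    using that x ideal_adj by (simp add: coset_eq_iff coset_iff flip: adj_minus)
  then show ?thesis using x by (simp add: quotient_algebra_def coset_UN)
qed

lemma Q_laws: "star_algebra_laws Q"
  by (rule star_algebra_laws_inherit_surj[OF star_algebra_laws_axioms, where p = "\<lambda>x. I +> x"])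
    (simp_all add: Q_simps Q_add Q_mult Q_smult Q_adj)

lemma coset_hom: "(\<lambda>x. I +> x) \<in> star_hom A Q"
  by (rule star_homI) (auto simp: Q_simps Q_add Q_mult Q_smult Q_adj)

lemma coset_bdd_below: "x \<in> carrier A \<Longrightarrow> bdd_below (nrm A ` (I +> x))"
  using coset_carrier by (intro bdd_belowI[of _ 0]) auto

lemma Q_nrm_le: "x \<in> carrier A \<Longrightarrow> z \<in> I +> x \<Longrightarrow> nrm Q (I +> x) \<le> nrm A z"
  unfolding Q_nrm by (intro cINF_lower coset_bdd_below)

lemma Q_nrm_le': "x \<in> carrier A \<Longrightarrow> nrm Q (I +> x) \<le> nrm A x"
  by (simp add: Q_nrm_le coset_self)

lemma Q_nrm_less:
  assumes "x \<in> carrier A" "nrm Q (I +> x) < e"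
  shows "\<exists>z\<in>carrier A. z \<in> I +> x \<and> nrm A z < e"
  using assms cINF_less_iff[OF _ coset_bdd_below[OF assms(1)], of e] coset_self[OF assms(1)]
    coset_carrier[OF assms(1)] unfolding Q_nrm by blast

lemma Q_nrm_nonneg: "x \<in> carrier A \<Longrightarrow> 0 \<le> nrm Q (I +> x)"
  unfolding Q_nrm using coset_self coset_carrier by (intro cINF_greatest) auto

lemma le_mult_Q_nrm:
  "x \<in> carrier A \<Longrightarrow> c \<ge> 0 \<Longrightarrow> (\<And>z. z \<in> carrier A \<Longrightarrow> z \<in> I +> x \<Longrightarrow> p \<le> c * nrm A z) \<Longrightarrow>
    p \<le> c * nrm Q (I +> x)"
  unfolding Q_nrm using coset_carrier by (intro le_mult_INF) auto

text \<open>Closedness of \<open>I\<close> enters here: small elements \<open>z\<close> of the coset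
  give elements \<open>x - z\<close> of \<open>I\<close> that converge to \<open>x\<close>.\<close>

lemma Q_nrm_eq_0:
  assumes x: "x \<in> carrier A" and "nrm Q (I +> x) = 0"
  shows "x \<in> I"
proof -
  have "\<exists>z\<in>I. nrm A (z \<ominus> x) < 1 / real (Suc n)" for n
  proof -
    obtain z where z: "z \<in> carrier A" "z \<in> I +> x" "nrm A z < 1 / real (Suc n)"
      using Q_nrm_less[OF x, of "1 / real (Suc n)"] assms by auto
    have "x \<ominus> z \<in> I"
      using coset_eqI[OF x z(2)] coset_eq_iff[OF x z(1)] by simp
    moreover have "x \<ominus> z \<ominus> x = \<ominus> z"
      using x z by (simp add: add_minus_cancel)
    ultimately show ?thesis using z by (intro bexI[of _ "x \<ominus> z"]) simp_all
  qed
  then obtain z where z: "\<And>n. z n \<in> I" "\<And>n. nrm A (z n \<ominus> x) < 1 / real (Suc n)"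
    by metis
  have "conv A z x"
  proof (rule convI)
    show "nrm A (z n \<ominus> x) \<le> 1 / real (Suc n)" for n using z(2)[of n] by simp
    show "(\<lambda>n. 1 / real (Suc n)) \<longlonglongrightarrow> 0" by (rule LIMSEQ_Suc[OF lim_1_over_n])
  qed (use z x in simp_all)
  with z(1) show ?thesis by (rule ideal_closed)
qed

lemma Q_nrm_mult:
  assumes x: "x \<in> carrier A" and y: "y \<in> carrier A"
  shows "nrm Q (I +> (x \<otimes> y)) \<le> nrm Q (I +> x) * nrm Q (I +> y)"
proof (rule le_mult_Q_nrm)
  fix w assume w: "w \<in> carrier A" "w \<in> I +> y"
  have "nrm Q (I +> (x \<otimes> y)) \<le> nrm A w * nrm Q (I +> x)"
  proof (rule le_mult_Q_nrm)
    fix z assume z: "z \<in> carrier A" "z \<in> I +> x"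
    have "I +> (x \<otimes> y) = I +> (z \<otimes> w)"
      using Q_mult[OF x y] Q_mult[OF z(1) w(1)] coset_eqI[OF x z(2)] coset_eqI[OF y w(2)] by simp
    then have "nrm Q (I +> (x \<otimes> y)) \<le> nrm A (z \<otimes> w)" using z w by (simp add: Q_nrm_le')
    also have "\<dots> \<le> nrm A w * nrm A z" using nrm_mult[OF z(1) w(1)] by (simp add: mult.commute)
    finally show "nrm Q (I +> (x \<otimes> y)) \<le> nrm A w * nrm A z" .
  qed (use x w in auto)
  then show "nrm Q (I +> (x \<otimes> y)) \<le> nrm Q (I +> x) * nrm A w" by (simp add: mult.commute)
qed (use x y Q_nrm_nonneg in auto)

text \<open>The approximate unit of the ideal reduces this to the C*-identity of the algebra itself.\<close>

lemma Q_cstar_le: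
  assumes x: "x \<in> carrier A"
  shows "(nrm Q (I +> x))\<^sup>2 \<le> nrm Q (I +> (adj A x \<otimes> x))"
proof -
  let ?h = "adj A x \<otimes> x"
  have "(nrm Q (I +> x))\<^sup>2 \<le> 1 * nrm Q (I +> ?h)"
  proof (rule le_mult_Q_nrm)
    fix w assume w: "w \<in> carrier A" "w \<in> I +> ?h"
    have h: "?h \<in> carrier A" using x by simp
    define y where "y = w \<ominus> ?h"
    have yI: "y \<in> I" using w h by (simp add: coset_iff y_def)
    \<comment> \<open>The element \<open>x (1 - u)\<close> represents the coset of \<open>x\<close>.
      The square estimate reduces its norm to that of \<open>?h (1 - u)\<close>, which differs from
      \<open>w (1 - u)\<close> only by the small \<open>y (1 - u)\<close>.\<close>
    have "(nrm Q (I +> x))\<^sup>2 \<le> nrm A w + e" if e: "e > 0" for e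
    proof -
      obtain u where u: "u \<in> I" "\<And>z. z \<in> carrier A \<Longrightarrow> nrm A (z \<ominus> z \<otimes> u) \<le> nrm A z"
        "nrm A (y \<ominus> y \<otimes> u) < e"
        using approx_unit[OF I yI e] by blast
      have uA: "u \<in> carrier A" using u(1) by simp
      have cl: "w \<otimes> u \<in> carrier A" "?h \<otimes> u \<in> carrier A" using w h uA by auto
      obtain L where L: "coords L w ?h (w \<otimes> u) (?h \<otimes> u)" by (rule linear4[OF w(1) h cl])
      note L = coordsD[OF L]
      have eq: "?h \<ominus> ?h \<otimes> u = (w \<ominus> w \<otimes> u) \<ominus> (y \<ominus> y \<otimes> u)"
        unfolding y_def mult_minus_left[OF w(1) h uA] by (simp only: L(3,4)) (simp add: L(1,2) L(6-9))
      have "x \<ominus> x \<otimes> u \<in> I +> x"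
        using x uA ideal_mult_left[OF u(1) x] ideal_smult[of "x \<otimes> u" "- 1"]
        by (simp add: coset_iff add_minus_cancel a_inv_smult)
      then have "(nrm Q (I +> x))\<^sup>2 \<le> (nrm A (x \<ominus> x \<otimes> u))\<^sup>2"
        using x by (intro power_mono Q_nrm_le Q_nrm_nonneg)
      also have "\<dots> \<le> nrm A (?h \<ominus> ?h \<otimes> u)" by (rule nrm_minus_mult_square_le[OF x uA u(2)])
      also have "\<dots> \<le> nrm A (w \<ominus> w \<otimes> u) + nrm A (y \<ominus> y \<otimes> u)"
        unfolding eq using w uA yI by (intro nrm_minus_le) auto
      also have "\<dots> \<le> nrm A w + e" using u(2)[OF w(1)] u(3) by simp
      finally show ?thesis .
    qed
    then show "(nrm Q (I +> x))\<^sup>2 \<le> 1 * nrm A w" by (simp add: field_le_epsilon)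
  qed (use x in auto)
  then show ?thesis by simp
qed

lemma Q_pre_cstar: "pre_cstar Q"
proof (rule pre_cstar.intro[OF Q_laws pre_cstar_axioms.intro])
  note simps = Q_simps Q_add Q_mult Q_smult Q_adj
  show "0 \<le> nrm Q X" if X: "X \<in> carrier Q" for X
    using X Q_nrm_nonneg unfolding Q_simps by blast
  show "nrm Q X = 0 \<longleftrightarrow> X = \<zero>\<^bsub>Q\<^esub>" if X: "X \<in> carrier Q" for X
  proof -
    obtain x where x: "x \<in> carrier A" "X = I +> x" using X unfolding Q_simps by blast
    have "nrm Q (I +> \<zero>) = 0"
      using Q_nrm_nonneg[of \<zero>] Q_nrm_le'[of \<zero>] by simp
    moreover have "I +> x = I +> \<zero> \<longleftrightarrow> x \<in> I" using x by (simp add: coset_eq_iff)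
    ultimately show ?thesis
      unfolding x(2) Q_simps(2) using Q_nrm_eq_0[OF x(1)] by metis
  qed
  show "nrm Q (X \<oplus>\<^bsub>Q\<^esub> Y) \<le> nrm Q X + nrm Q Y" if XY: "X \<in> carrier Q" "Y \<in> carrier Q" for X Y
  proof -
    obtain x y where xy: "x \<in> carrier A" "X = I +> x" "y \<in> carrier A" "Y = I +> y"
      using XY unfolding Q_simps by blast
    show ?thesis
    proof (rule field_le_epsilon)
      fix e :: real assume "e > 0"
      then have e: "nrm Q (I +> x) < nrm Q X + e / 2" "nrm Q (I +> y) < nrm Q Y + e / 2"
        using xy by simp_all
      obtain z where z: "z \<in> carrier A" "z \<in> I +> x" "nrm A z < nrm Q X + e / 2"
        using Q_nrm_less[OF xy(1) e(1)] by blast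
      obtain w where w: "w \<in> carrier A" "w \<in> I +> y" "nrm A w < nrm Q Y + e / 2"
        using Q_nrm_less[OF xy(3) e(2)] by blast
      have "X \<oplus>\<^bsub>Q\<^esub> Y = I +> (z \<oplus> w)"
        using z w xy coset_eqI[OF xy(1) z(2)] coset_eqI[OF xy(3) w(2)] by (simp flip: Q_add)
      then have "nrm Q (X \<oplus>\<^bsub>Q\<^esub> Y) \<le> nrm A (z \<oplus> w)" using z w by (simp add: Q_nrm_le')
      then show "nrm Q (X \<oplus>\<^bsub>Q\<^esub> Y) \<le> nrm Q X + nrm Q Y + e"
        using nrm_triangle[OF z(1) w(1)] z(3) w(3) by linarith
    qed
  qed
  have smult_le: "nrm Q (I +> (c \<odot> x)) \<le> cmod c * nrm Q (I +> x)" if x: "x \<in> carrier A" for c x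
  proof (rule le_mult_Q_nrm)
    fix z assume z: "z \<in> carrier A" "z \<in> I +> x"
    have "I +> (c \<odot> x) = I +> (c \<odot> z)"
      using Q_smult[OF x] Q_smult[OF z(1)] coset_eqI[OF x z(2)] by simp
    then show "nrm Q (I +> (c \<odot> x)) \<le> cmod c * nrm A z"
      using z Q_nrm_le'[of "c \<odot> z"] by simp
  qed (use x in auto)
  show "nrm Q (c \<odot>\<^bsub>Q\<^esub> X) = cmod c * nrm Q X" if X: "X \<in> carrier Q" for c X
  proof -
    obtain x where x: "x \<in> carrier A" "X = I +> x" using X unfolding Q_simps by blast
    show ?thesis
    proof (cases "c = 0")
      case True
      have "nrm Q (I +> \<zero>) = 0"
        using Q_nrm_nonneg[of \<zero>] Q_nrm_le'[of \<zero>] by simp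
      then show ?thesis using x True by (simp add: simps)
    next
      case False
      have "nrm Q X \<le> cmod (1 / c) * nrm Q (c \<odot>\<^bsub>Q\<^esub> X)"
        using smult_le[of "c \<odot> x" "1 / c"] x False by (simp add: simps smult_smult)
      then have "cmod c * nrm Q X \<le> nrm Q (c \<odot>\<^bsub>Q\<^esub> X)"
        using False by (simp add: norm_divide field_simps)
      moreover have "nrm Q (c \<odot>\<^bsub>Q\<^esub> X) \<le> cmod c * nrm Q X"
        using smult_le[OF x(1), of c] x by (simp add: simps)
      ultimately show ?thesis by simp
    qed
  qed
  show "nrm Q (X \<otimes>\<^bsub>Q\<^esub> Y) \<le> nrm Q X * nrm Q Y" if XY: "X \<in> carrier Q" "Y \<in> carrier Q" for X Y
  proof -
    obtain x y where xy: "x \<in> carrier A" "X = I +> x" "y \<in> carrier A" "Y = I +> y"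
      using XY unfolding Q_simps by blast
    show ?thesis using Q_nrm_mult[OF xy(1,3)] xy by (simp add: Q_mult)
  qed
  show "nrm Q (adj Q X \<otimes>\<^bsub>Q\<^esub> X) = (nrm Q X)\<^sup>2" if X: "X \<in> carrier Q" for X
  proof -
    obtain x where x: "x \<in> carrier A" "X = I +> x" using X unfolding Q_simps by blast
    have "nrm Q (I +> adj A x) \<le> 1 * nrm Q (I +> x)"
    proof (rule le_mult_Q_nrm)
      fix z assume z: "z \<in> carrier A" "z \<in> I +> x"
      have "I +> adj A x = I +> adj A z"
        using Q_adj[OF x(1)] Q_adj[OF z(1)] coset_eqI[OF x(1) z(2)] by simp
      then show "nrm Q (I +> adj A x) \<le> 1 * nrm A z"
        using z Q_nrm_le'[of "adj A z"] by simp
    qed (use x in auto)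
    then have "nrm Q (I +> adj A x) * nrm Q (I +> x) \<le> (nrm Q (I +> x))\<^sup>2"
      unfolding power2_eq_square using x Q_nrm_nonneg by (intro mult_right_mono) auto
    then have "nrm Q (I +> (adj A x \<otimes> x)) \<le> (nrm Q (I +> x))\<^sup>2"
      using Q_nrm_mult[of "adj A x" x] x by simp
    then show ?thesis using Q_cstar_le[OF x(1)] x by (simp add: simps)
  qed
qed

text \<open>The factor 2 leaves room to stay above the infimum without attaining it. There is no
  such room when the norm is zero, but then zero itself represents the coset.\<close>

lemma Q_lift:
  assumes "X \<in> carrier Q"
  shows "\<exists>x\<in>carrier A. I +> x = X \<and> nrm A x \<le> 2 * nrm Q X"
proof -
  obtain x where x: "x \<in> carrier A" "X = I +> x" using assms unfolding Q_simps by blast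
  show ?thesis
  proof (cases "nrm Q X = 0")
    case True
    then have "X = I +> \<zero>" using Q_nrm_eq_0[OF x(1)] x by (simp add: coset_eq_iff)
    with True show ?thesis by (intro bexI[of _ \<zero>]) auto
  next
    case False
    then have "nrm Q (I +> x) < 2 * nrm Q X" using Q_nrm_nonneg[OF x(1)] x by simp
    then obtain z where "z \<in> carrier A" "z \<in> I +> x" "nrm A z < 2 * nrm Q X"
      using Q_nrm_less[OF x(1)] by blast
    then show ?thesis using coset_eqI[OF x(1)] x(2) by (intro bexI[of _ z]) auto
  qed
qed

lemma Q_cstar: "cstar Q"
proof -
  interpret Q: pre_cstar Q by (rule Q_pre_cstar)
  interpret star_hom_pair A Q "\<lambda>x. I +> x" by unfold_locales (rule coset_hom)
  show ?thesis
  proof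
    fix s assume s: "cauchy Q s"
    obtain r t where r: "strict_mono r" and t: "cauchy A t" and rt: "\<And>k. I +> t k = s (r k)"
      using cauchy_lift[OF pre_cstar_axioms Q_pre_cstar coset_hom Q_lift s] by blast
    obtain x where x: "conv A t x" using cauchy_conv[OF t] by blast
    have in_A: "x \<in> carrier A" "t n \<in> carrier A" for n using conv_in[OF x] by auto
    have "conv Q (\<lambda>k. s (r k)) (I +> x)"
    proof (rule Q.convI)
      show "nrm Q (s (r k) \<ominus>\<^bsub>Q\<^esub> (I +> x)) \<le> nrm A (t k \<ominus> x)" for k
        using in_A Q_nrm_le'[of "t k \<ominus> x"] by (simp flip: rt)
      show "(\<lambda>k. nrm A (t k \<ominus> x)) \<longlonglongrightarrow> 0" using x by (simp add: conv_def)
    qed (use in_A Q.cauchy_in[OF s] in \<open>simp_all add: Q_simps(1)\<close>)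
    then show "\<exists>X. conv Q s X" using Q.conv_subseq[OF s r] by blast
  qed
qed

end

lemma closed_ideal_a_kernel:
  assumes "pre_cstar A" "pre_cstar B" and g: "g \<in> star_hom A B"
    and contr: "\<And>x. x \<in> carrier A \<Longrightarrow> nrm B (g x) \<le> nrm A x"
  shows "closed_ideal (a_kernel A B g) A"
proof -
  interpret A: pre_cstar A by fact
  interpret B: pre_cstar B by fact
  interpret star_hom_pair A B g by unfold_locales (rule g)
  have "x \<in> a_kernel A B g" if s: "\<forall>n. s n \<in> a_kernel A B g" "conv A s x" for s x
  proof -
    have in_A: "s n \<in> carrier A" "x \<in> carrier A" for n using A.conv_in[OF s(2)] by auto
    have s0: "g (s n) = \<zero>\<^bsub>B\<^esub>" for n using s(1) by (simp add: a_kernel_def')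
    have "nrm B (g x) \<le> nrm A (s n \<ominus>\<^bsub>A\<^esub> x)" for n
      using contr[of "x \<ominus>\<^bsub>A\<^esub> s n"] in_A A.nrm_minus_commute[of x "s n"] by (simp add: s0)
    moreover have "(\<lambda>n. nrm A (s n \<ominus>\<^bsub>A\<^esub> x)) \<longlonglongrightarrow> 0" using s(2) by (simp add: conv_def)
    ultimately have "nrm B (g x) \<le> 0" by (intro LIMSEQ_le_const) auto
    then have "nrm B (g x) = 0" using in_A by (simp add: antisym)
    then show ?thesis using in_A by (simp add: a_kernel_def')
  qed
  then have "\<forall>s x. (\<forall>n. s n \<in> a_kernel A B g) \<and> conv A s x \<longrightarrow> x \<in> a_kernel A B g"
    by blast
  moreover have "a_kernel A B g \<subseteq> carrier A \<and> \<zero>\<^bsub>A\<^esub> \<in> a_kernel A B g"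
    "\<forall>x\<in>a_kernel A B g. \<forall>y\<in>a_kernel A B g. x \<oplus>\<^bsub>A\<^esub> y \<in> a_kernel A B g"
    "\<forall>x\<in>a_kernel A B g. \<forall>c. c \<odot>\<^bsub>A\<^esub> x \<in> a_kernel A B g"
    "\<forall>x\<in>a_kernel A B g. \<forall>a\<in>carrier A. a \<otimes>\<^bsub>A\<^esub> x \<in> a_kernel A B g \<and> x \<otimes>\<^bsub>A\<^esub> a \<in> a_kernel A B g"
    by (simp_all add: a_kernel_def' subset_iff)
  ultimately show ?thesis unfolding A.closed_ideal_iff by blast
qed

section \<open>Surjections as quotient maps\<close>

locale cstar_surjection = A: cstar A + B: cstar B
  for A :: "('a, 'm) star_algebra_scheme" and B :: "('b, 'n) star_algebra_scheme" and g +
  assumes g: "g \<in> star_hom A B" and surj: "g ` carrier A = carrier B"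
begin

sublocale hom: star_hom_pair A B g
  by unfold_locales (rule g)

lemma kernel_ideal: "closed_ideal (a_kernel A B g) A"
  by (rule closed_ideal_a_kernel[OF A.pre_cstar_axioms B.pre_cstar_axioms g])
    (rule star_hom_contractive[OF A.cstar_axioms B.pre_cstar_axioms g])

sublocale quot: cstar_with_ideal A "a_kernel A B g"
  by (rule cstar_with_ideal.intro[OF A.cstar_axioms cstar_with_ideal_axioms.intro[OF kernel_ideal]])

declare quot.ideal_in [simp del]

lemma kernel_iff: "x \<in> a_kernel A B g \<longleftrightarrow> x \<in> carrier A \<and> g x = \<zero>\<^bsub>B\<^esub>"
  by (simp add: a_kernel_def')

lemma g_coset:
  assumes x: "x \<in> carrier A"
  shows "the_elem (g ` (a_kernel A B g +>\<^bsub>A\<^esub> x)) = g x"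
proof -
  have "g z = g x" if "z \<in> a_kernel A B g +>\<^bsub>A\<^esub> x" for z
    using that x unfolding quot.coset_iff[OF x] kernel_iff
    by (elim conjE) (simp add: B.minus_eq_zero_iff)
  then have "g ` (a_kernel A B g +>\<^bsub>A\<^esub> x) = {g x}"
    using quot.coset_self[OF x] by blast
  then show ?thesis by simp
qed

lemma first_isomorphism:
  defines "h \<equiv> \<lambda>X. the_elem (g ` X)"
  shows "h \<in> star_hom quot.Q B" "bij_betw h (carrier quot.Q) (carrier B)"
proof -
  note simps = quot.Q_simps quot.Q_add quot.Q_mult quot.Q_smult quot.Q_adj
  have h: "h (a_kernel A B g +>\<^bsub>A\<^esub> x) = g x" if "x \<in> carrier A" for x
    using that by (simp add: h_def g_coset)
  show "h \<in> star_hom quot.Q B"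
  proof (rule star_homI)
    fix X assume "X \<in> carrier quot.Q"
    then obtain x where x: "x \<in> carrier A" "X = a_kernel A B g +>\<^bsub>A\<^esub> x"
      unfolding quot.Q_simps by blast
    show "h X \<in> carrier B" "h (c \<odot>\<^bsub>quot.Q\<^esub> X) = c \<odot>\<^bsub>B\<^esub> h X" "h (adj quot.Q X) = adj B (h X)" for c
      using x(1) unfolding x(2) by (simp_all add: simps h)
    fix Y assume "Y \<in> carrier quot.Q"
    then obtain y where y: "y \<in> carrier A" "Y = a_kernel A B g +>\<^bsub>A\<^esub> y"
      unfolding quot.Q_simps by blast
    show "h (X \<oplus>\<^bsub>quot.Q\<^esub> Y) = h X \<oplus>\<^bsub>B\<^esub> h Y" "h (X \<otimes>\<^bsub>quot.Q\<^esub> Y) = h X \<otimes>\<^bsub>B\<^esub> h Y"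
      using x(1) y(1) unfolding x(2) y(2) by (simp_all add: simps h)
  qed
  have "inj_on h (carrier quot.Q)"
  proof (rule inj_onI)
    fix X Y assume "X \<in> carrier quot.Q" "Y \<in> carrier quot.Q" and eq: "h X = h Y"
    then obtain x y where x: "x \<in> carrier A" "X = a_kernel A B g +>\<^bsub>A\<^esub> x"
      and y: "y \<in> carrier A" "Y = a_kernel A B g +>\<^bsub>A\<^esub> y"
      unfolding quot.Q_simps by blast
    have "g x = g y" using eq x(1) y(1) unfolding x(2) y(2) by (simp add: h)
    then show "X = Y"
      using x(1) y(1) unfolding x(2) y(2)
      by (simp add: quot.coset_eq_iff kernel_iff B.minus_eq_zero_iff)
  qed
  moreover have "h ` carrier quot.Q = carrier B"
    unfolding quot.Q_simps image_image using h surj by auto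
  ultimately show "bij_betw h (carrier quot.Q) (carrier B)" by (simp add: bij_betw_def)
qed

text \<open>The induced bijection from the quotient is a homomorphism between C*-algebras, hence
  isometric. This makes representatives of cosets and approximate units of the kernel available for
  estimating \<open>nrm B (g x)\<close>.\<close>

lemma nrm_quotient: "x \<in> carrier A \<Longrightarrow> nrm quot.Q (a_kernel A B g +>\<^bsub>A\<^esub> x) = nrm B (g x)"
  using star_hom_bij_isometric[OF quot.Q_cstar B.cstar_axioms first_isomorphism,
      of "a_kernel A B g +>\<^bsub>A\<^esub> x"]
  by (simp add: quot.Q_simps g_coset)

lemma lift:
  assumes "y \<in> carrier B"
  shows "\<exists>x\<in>carrier A. g x = y \<and> nrm A x \<le> 2 * nrm B y"
proof -
  obtain z where z: "z \<in> carrier A" "y = g z" using assms surj by blast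
  then have "a_kernel A B g +>\<^bsub>A\<^esub> z \<in> carrier quot.Q" by (simp add: quot.Q_simps)
  then obtain x where x: "x \<in> carrier A" "a_kernel A B g +>\<^bsub>A\<^esub> x = a_kernel A B g +>\<^bsub>A\<^esub> z"
    "nrm A x \<le> 2 * nrm quot.Q (a_kernel A B g +>\<^bsub>A\<^esub> z)"
    using quot.Q_lift by blast
  have "g x = g z" using g_coset[OF x(1)] g_coset[OF z(1)] x(2) by simp
  then show ?thesis using x z nrm_quotient[OF z(1)] by auto
qed

text \<open>Let \<open>z\<close> be a representative of the coset of \<open>x\<close> with norm
  close to \<open>nrm B (g x)\<close>, and \<open>u\<close> an approximate unit for
  \<open>z - x\<close>. Then \<open>x (1 - u)\<close> differs from \<open>z (1 - u)\<close> by a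
  small element.\<close>

lemma compress:
  assumes x: "x \<in> carrier A" and e: "e > 0"
  shows "\<exists>u\<in>a_kernel A B g. (\<forall>z\<in>carrier A. nrm A (z \<ominus>\<^bsub>A\<^esub> z \<otimes>\<^bsub>A\<^esub> u) \<le> nrm A z) \<and>
    nrm A (x \<ominus>\<^bsub>A\<^esub> x \<otimes>\<^bsub>A\<^esub> u) < nrm B (g x) + e"
proof -
  have "nrm quot.Q (a_kernel A B g +>\<^bsub>A\<^esub> x) < nrm B (g x) + e / 2"
    using e by (simp add: nrm_quotient x)
  then obtain z where z: "z \<in> carrier A" "z \<in> a_kernel A B g +>\<^bsub>A\<^esub> x" "nrm A z < nrm B (g x) + e / 2"
    using quot.Q_nrm_less[OF x] by blast
  define y where "y = z \<ominus>\<^bsub>A\<^esub> x"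
  have y: "y \<in> a_kernel A B g" using z x by (simp add: quot.coset_iff y_def)
  then have yA: "y \<in> carrier A" by (rule quot.ideal_in)
  obtain u where u: "u \<in> a_kernel A B g" "\<And>z. z \<in> carrier A \<Longrightarrow> nrm A (z \<ominus>\<^bsub>A\<^esub> z \<otimes>\<^bsub>A\<^esub> u) \<le> nrm A z"
    "nrm A (y \<ominus>\<^bsub>A\<^esub> y \<otimes>\<^bsub>A\<^esub> u) < e / 2"
    using A.approx_unit[OF kernel_ideal y, of "e / 2"] e by auto
  have uA: "u \<in> carrier A" using u(1) by (rule quot.ideal_in)
  have cl: "z \<otimes>\<^bsub>A\<^esub> u \<in> carrier A" "x \<otimes>\<^bsub>A\<^esub> u \<in> carrier A" using z x uA by auto
  obtain L where L: "A.coords L z x (z \<otimes>\<^bsub>A\<^esub> u) (x \<otimes>\<^bsub>A\<^esub> u)" by (rule A.linear4[OF z(1) x cl])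
  note L = A.coordsD[OF L]
  have "x \<ominus>\<^bsub>A\<^esub> x \<otimes>\<^bsub>A\<^esub> u = (z \<ominus>\<^bsub>A\<^esub> z \<otimes>\<^bsub>A\<^esub> u) \<ominus>\<^bsub>A\<^esub> (y \<ominus>\<^bsub>A\<^esub> y \<otimes>\<^bsub>A\<^esub> u)"
    unfolding y_def A.mult_minus_left[OF z(1) x uA] by (simp only: L(3,4)) (simp add: L(1,2) L(6-9))
  then have "nrm A (x \<ominus>\<^bsub>A\<^esub> x \<otimes>\<^bsub>A\<^esub> u) \<le> nrm A (z \<ominus>\<^bsub>A\<^esub> z \<otimes>\<^bsub>A\<^esub> u) + nrm A (y \<ominus>\<^bsub>A\<^esub> y \<otimes>\<^bsub>A\<^esub> u)"
    using z uA yA by (simp add: A.nrm_minus_le)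
  also have "\<dots> < nrm B (g x) + e" using u(2)[OF z(1)] u(3) z(3) by linarith
  finally show ?thesis using u by blast
qed

text \<open>
  One element of the kernel serves finitely many elements at once: its factor \<open>1 - u\<close> is a product
  of factors treating them one after the other.
\<close>

lemma compress_finite:
  assumes "finite T" "T \<subseteq> carrier A" and e: "e > 0"
  shows "\<exists>u\<in>a_kernel A B g. (\<forall>z\<in>carrier A. nrm A (z \<ominus>\<^bsub>A\<^esub> z \<otimes>\<^bsub>A\<^esub> u) \<le> nrm A z) \<and>
    (\<forall>x\<in>T. nrm A (x \<ominus>\<^bsub>A\<^esub> x \<otimes>\<^bsub>A\<^esub> u) < nrm B (g x) + e)"
  using assms(1,2)
proof (induction T rule: finite_induct)
  case empty
  show ?case by (rule bexI[of _ "\<zero>\<^bsub>A\<^esub>"]) (simp_all add: quot.ideal_zero)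
next
  case (insert x T)
  then obtain u where u: "u \<in> a_kernel A B g" "\<And>z. z \<in> carrier A \<Longrightarrow> nrm A (z \<ominus>\<^bsub>A\<^esub> z \<otimes>\<^bsub>A\<^esub> u) \<le> nrm A z"
    "\<And>y. y \<in> T \<Longrightarrow> nrm A (y \<ominus>\<^bsub>A\<^esub> y \<otimes>\<^bsub>A\<^esub> u) < nrm B (g y) + e" by auto
  have uA: "u \<in> carrier A" and gu: "g u = \<zero>\<^bsub>B\<^esub>" using u(1) by (simp_all add: kernel_iff)
  have x: "x \<in> carrier A" using insert by simp
  have xu: "x \<ominus>\<^bsub>A\<^esub> x \<otimes>\<^bsub>A\<^esub> u \<in> carrier A" using x uA by simp
  \<comment> \<open>The new factor is chosen for \<open>x (1 - u)\<close>, which has the same image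
    as \<open>x\<close> because \<open>g u\<close> is zero. Being a contraction, it does not spoil
    the estimates already achieved on \<open>T\<close>.\<close>
  obtain v where v: "v \<in> a_kernel A B g" "\<And>z. z \<in> carrier A \<Longrightarrow> nrm A (z \<ominus>\<^bsub>A\<^esub> z \<otimes>\<^bsub>A\<^esub> v) \<le> nrm A z"
    "nrm A ((x \<ominus>\<^bsub>A\<^esub> x \<otimes>\<^bsub>A\<^esub> u) \<ominus>\<^bsub>A\<^esub> (x \<ominus>\<^bsub>A\<^esub> x \<otimes>\<^bsub>A\<^esub> u) \<otimes>\<^bsub>A\<^esub> v) < nrm B (g x) + e"
    using compress[OF xu e] x uA by (auto simp: gu)
  have vA: "v \<in> carrier A" using v(1) by (rule quot.ideal_in)
  define w where "w = u \<oplus>\<^bsub>A\<^esub> v \<ominus>\<^bsub>A\<^esub> u \<otimes>\<^bsub>A\<^esub> v"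
  have w: "w \<in> a_kernel A B g"
    unfolding w_def by (intro quot.ideal_minus quot.ideal_add quot.ideal_mult_right u v vA)
  have eq: "z \<ominus>\<^bsub>A\<^esub> z \<otimes>\<^bsub>A\<^esub> w = (z \<ominus>\<^bsub>A\<^esub> z \<otimes>\<^bsub>A\<^esub> u) \<ominus>\<^bsub>A\<^esub> (z \<ominus>\<^bsub>A\<^esub> z \<otimes>\<^bsub>A\<^esub> u) \<otimes>\<^bsub>A\<^esub> v"
    if z: "z \<in> carrier A" for z
    unfolding w_def by (rule A.minus_mult_circle[OF z uA vA])
  have "nrm A (z \<ominus>\<^bsub>A\<^esub> z \<otimes>\<^bsub>A\<^esub> w) \<le> nrm A (z \<ominus>\<^bsub>A\<^esub> z \<otimes>\<^bsub>A\<^esub> u)" if z: "z \<in> carrier A" for z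
    unfolding eq[OF z] by (rule v(2)) (simp add: z uA)
  note le = this
  have "\<forall>z\<in>carrier A. nrm A (z \<ominus>\<^bsub>A\<^esub> z \<otimes>\<^bsub>A\<^esub> w) \<le> nrm A z"
    "\<forall>y\<in>T. nrm A (y \<ominus>\<^bsub>A\<^esub> y \<otimes>\<^bsub>A\<^esub> w) < nrm B (g y) + e"
    using order_trans[OF le u(2)] le_less_trans[OF le u(3)] insert.prems by blast+
  moreover have "nrm A (x \<ominus>\<^bsub>A\<^esub> x \<otimes>\<^bsub>A\<^esub> w) < nrm B (g x) + e"
    using v(3) eq[OF x] by simp
  ultimately show ?case using w by blast
qed

end

section \<open>Completion\<close>

context pre_cstar
begin

abbreviation "cls s \<equiv> cauchy_rel A `` {s}"
abbreviation "CA \<equiv> completion A"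

definition null_diff :: "(nat \<Rightarrow> 'a) \<Rightarrow> (nat \<Rightarrow> 'a) \<Rightarrow> bool"
  where "null_diff s t \<longleftrightarrow> (\<lambda>n. nrm A (s n \<ominus> t n)) \<longlonglongrightarrow> 0"

lemma cauchy_rel_iff: "(s, t) \<in> cauchy_rel A \<longleftrightarrow> cauchy A s \<and> cauchy A t \<and> null_diff s t"
  by (auto simp: cauchy_rel_def MCauchy_iff null_diff_def ndist_def cauchy_def)

lemma null_diffI:
  assumes "\<And>n. s n \<in> carrier A" "\<And>n. t n \<in> carrier A"
    "\<And>n. nrm A (s n \<ominus> t n) \<le> b n" "b \<longlonglongrightarrow> 0"
  shows "null_diff s t"
  unfolding null_diff_def
  by (rule tendsto_sandwich[OF _ _ tendsto_const assms(4)]) (simp_all add: assms)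

lemma null_diff_refl: "cauchy A s \<Longrightarrow> null_diff s s"
  by (simp add: null_diff_def minus_eq r_neg cauchy_in)

lemma null_diff_sym: "cauchy A s \<Longrightarrow> cauchy A t \<Longrightarrow> null_diff s t \<Longrightarrow> null_diff t s"
  by (simp add: null_diff_def nrm_minus_commute[of "t n" "s n" for n] cauchy_in)

lemma null_diff_trans:
  assumes "cauchy A s" "cauchy A t" "cauchy A u" "null_diff s t" "null_diff t u"
  shows "null_diff s u"
proof (rule null_diffI)
  show "(\<lambda>n. nrm A (s n \<ominus> t n) + nrm A (t n \<ominus> u n)) \<longlonglongrightarrow> 0"
    using assms(4,5) unfolding null_diff_def by (rule tendsto_add_zero)
qed (use assms in \<open>auto intro: nrm_minus_triangle simp: cauchy_in\<close>)

lemma mem_cls: "t \<in> cls s \<longleftrightarrow> cauchy A s \<and> cauchy A t \<and> null_diff s t"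
  by (simp add: cauchy_rel_iff)

lemma cls_self: "cauchy A s \<Longrightarrow> s \<in> cls s"
  by (simp add: cauchy_rel_iff null_diff_refl)

lemma cls_eq_iff:
  assumes "cauchy A s" "cauchy A t"
  shows "cls s = cls t \<longleftrightarrow> null_diff s t"
proof
  assume "cls s = cls t"
  then have "t \<in> cls s" using cls_self[OF assms(2)] by blast
  then show "null_diff s t" by (simp only: mem_cls)
next
  assume st: "null_diff s t"
  have ts: "null_diff t s" by (rule null_diff_sym[OF assms st])
  have "u \<in> cls s \<longleftrightarrow> u \<in> cls t" for u
    using null_diff_trans[OF assms(1,2) _ st, of u] null_diff_trans[OF assms(2,1) _ ts, of u] assms
    unfolding mem_cls by blast
  then show "cls s = cls t" by blast
qed

lemma cls_carrier: "carrier CA = cls ` {s. cauchy A s}"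
  by (auto simp: completion_def quotient_def MCauchy_iff)

lemma cls_in: "cauchy A s \<Longrightarrow> cls s \<in> carrier CA"
  unfolding cls_carrier by blast

text \<open>This resolves the unions over representatives in \<open>completion\<close>: all sets in
  the union are the same class.\<close>

lemma cls_UN:
  assumes s: "cauchy A s" and F: "\<And>t. cauchy A t \<Longrightarrow> null_diff s t \<Longrightarrow> F t = c"
  shows "(\<Union>t\<in>cls s. F t) = c"
proof -
  have "F t = c" if "t \<in> cls s" for t using that F unfolding mem_cls by blast
  then show ?thesis using cls_self[OF s] by blast
qed

lemma cls_add:
  assumes s: "cauchy A s" and t: "cauchy A t"
  shows "cls s \<oplus>\<^bsub>CA\<^esub> cls t = cls (\<lambda>n. s n \<oplus> t n)"
proof -
  have "cls (\<lambda>n. s' n \<oplus> t' n) = cls (\<lambda>n. s n \<oplus> t n)"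
    if s': "cauchy A s'" "null_diff s s'" and t': "cauchy A t'" "null_diff t t'" for s' t'
  proof -
    have "null_diff (\<lambda>n. s n \<oplus> t n) (\<lambda>n. s' n \<oplus> t' n)"
    proof (rule null_diffI)
      show "(\<lambda>n. nrm A (s n \<ominus> s' n) + nrm A (t n \<ominus> t' n)) \<longlonglongrightarrow> 0"
        using s'(2) t'(2) unfolding null_diff_def by (rule tendsto_add_zero)
    qed (use s t s' t' in \<open>auto intro: nrm_add_minus_le simp: cauchy_in\<close>)
    then show ?thesis
      using cls_eq_iff[OF cauchy_add[OF s t] cauchy_add[OF s'(1) t'(1)]] by simp
  qed
  then have "(\<Union>s\<in>cls s. \<Union>t\<in>cls t. cls (\<lambda>n. s n \<oplus> t n)) = cls (\<lambda>n. s n \<oplus> t n)"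
    by (intro cls_UN s t)
  then show ?thesis by (simp add: completion_def)
qed

lemma cls_mult:
  assumes s: "cauchy A s" and t: "cauchy A t"
  shows "cls s \<otimes>\<^bsub>CA\<^esub> cls t = cls (\<lambda>n. s n \<otimes> t n)"
proof -
  have "cls (\<lambda>n. s' n \<otimes> t' n) = cls (\<lambda>n. s n \<otimes> t n)"
    if s': "cauchy A s'" "null_diff s s'" and t': "cauchy A t'" "null_diff t t'" for s' t'
  proof -
    have "null_diff (\<lambda>n. s n \<otimes> t n) (\<lambda>n. s' n \<otimes> t' n)"
    proof (rule null_diffI)
      obtain a b where "(\<lambda>n. nrm A (t n)) \<longlonglongrightarrow> a" "(\<lambda>n. nrm A (s' n)) \<longlonglongrightarrow> b"
        using cauchy_norm_convergent[OF t] cauchy_norm_convergent[OF s'(1)]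
        by (auto simp: convergent_def)
      then have "(\<lambda>n. nrm A (s n \<ominus> s' n) * nrm A (t n) + nrm A (s' n) * nrm A (t n \<ominus> t' n))
          \<longlonglongrightarrow> 0 * a + b * 0"
        using s'(2) t'(2) unfolding null_diff_def by (intro tendsto_add tendsto_mult)
      then show "(\<lambda>n. nrm A (s n \<ominus> s' n) * nrm A (t n) + nrm A (s' n) * nrm A (t n \<ominus> t' n)) \<longlonglongrightarrow> 0"
        by simp
    qed (use s t s' t' in \<open>auto intro: nrm_mult_minus_le simp: cauchy_in\<close>)
    then show ?thesis
      using cls_eq_iff[OF cauchy_mult[OF s t] cauchy_mult[OF s'(1) t'(1)]] by simp
  qed
  then have "(\<Union>s\<in>cls s. \<Union>t\<in>cls t. cls (\<lambda>n. s n \<otimes> t n)) = cls (\<lambda>n. s n \<otimes> t n)"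
    by (intro cls_UN s t)
  then show ?thesis by (simp add: completion_def)
qed

lemma cls_smult:
  assumes s: "cauchy A s"
  shows "c \<odot>\<^bsub>CA\<^esub> cls s = cls (\<lambda>n. c \<odot> s n)"
proof -
  have "cls (\<lambda>n. c \<odot> s' n) = cls (\<lambda>n. c \<odot> s n)" if s': "cauchy A s'" "null_diff s s'" for s'
  proof -
    have "null_diff (\<lambda>n. c \<odot> s n) (\<lambda>n. c \<odot> s' n)"
      using s s' unfolding null_diff_def
      by (simp add: cauchy_in tendsto_mult_right_zero flip: smult_minus)
    then show ?thesis
      using cls_eq_iff[OF cauchy_smult[OF s, of c] cauchy_smult[OF s'(1), of c]] by simp
  qed
  then have "(\<Union>s\<in>cls s. cls (\<lambda>n. c \<odot> s n)) = cls (\<lambda>n. c \<odot> s n)" by (intro cls_UN s)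
  then show ?thesis by (simp add: completion_def)
qed

lemma cls_adj:
  assumes s: "cauchy A s"
  shows "adj CA (cls s) = cls (\<lambda>n. adj A (s n))"
proof -
  have "cls (\<lambda>n. adj A (s' n)) = cls (\<lambda>n. adj A (s n))" if s': "cauchy A s'" "null_diff s s'" for s'
  proof -
    have "null_diff (\<lambda>n. adj A (s n)) (\<lambda>n. adj A (s' n))"
      using s s' unfolding null_diff_def by (simp add: cauchy_in flip: adj_minus)
    then show ?thesis
      using cls_eq_iff[OF cauchy_adj[OF s] cauchy_adj[OF s'(1)]] by simp
  qed
  then have "(\<Union>s\<in>cls s. cls (\<lambda>n. adj A (s n))) = cls (\<lambda>n. adj A (s n))" by (intro cls_UN s)
  then show ?thesis by (simp add: completion_def)
qed

lemma cls_zero: "\<zero>\<^bsub>CA\<^esub> = cls (\<lambda>n. \<zero>)"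
  by (simp add: completion_def)

lemma cls_norm:
  assumes s: "cauchy A s" and l: "(\<lambda>n. nrm A (s n)) \<longlonglongrightarrow> l"
  shows "nrm CA (cls s) = l"
proof -
  have "lim (\<lambda>n. nrm A (t n)) = l" if t: "cauchy A t" "null_diff s t" for t
  proof (rule limI)
    have "(\<lambda>n. nrm A (t n) - nrm A (s n)) \<longlonglongrightarrow> 0"
    proof (rule tendsto_rabs_zero_cancel, rule tendsto_sandwich[OF _ _ tendsto_const t(2)[unfolded null_diff_def]])
      show "\<forall>\<^sub>F n in sequentially. \<bar>nrm A (t n) - nrm A (s n)\<bar> \<le> nrm A (s n \<ominus> t n)"
        using s t nrm_diff_abs by (simp add: cauchy_in abs_minus_commute)
    qed simp
    from tendsto_add[OF this l] show "(\<lambda>n. nrm A (t n)) \<longlonglongrightarrow> l" by simp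
  qed
  then have "lim (\<lambda>n. nrm A (t n)) = l" if "t \<in> cls s" for t
    using that unfolding mem_cls by blast
  then have "(\<lambda>t. lim (\<lambda>n. nrm A (t n))) ` cls s = {l}"
    using cls_self[OF s] by blast
  then show ?thesis by (simp add: completion_def)
qed

lemma cls_norm_lim: "cauchy A s \<Longrightarrow> (\<lambda>n. nrm A (s n)) \<longlonglongrightarrow> nrm CA (cls s)"
  using cauchy_norm_convergent[of s] cls_norm[of s] unfolding convergent_def by metis

text \<open>An intermediate algebra with entrywise operations: its laws come from the entries, and
  the completion inherits them as its image under \<open>cls\<close>. Only the algebraic laws are
  transferred, so the norm is left undefined.\<close>

definition cauchy_algebra :: "(nat \<Rightarrow> 'a) star_algebra"
  where "cauchy_algebra = \<lparr>carrier = {s. cauchy A s}, mult = (\<lambda>s t n. s n \<otimes> t n), one = undefined,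
    zero = (\<lambda>n. \<zero>), add = (\<lambda>s t n. s n \<oplus> t n), smult = (\<lambda>c s n. c \<odot> s n),
    adj = (\<lambda>s n. adj A (s n)), nrm = undefined\<rparr>"

lemma cauchy_algebra_laws: "star_algebra_laws cauchy_algebra"
proof (rule star_algebra_laws_inherit_inj[OF star_algebra_laws_axioms, where T = UNIV and e = "\<lambda>n s. s n"])
  show "x = y" if "\<And>t. t \<in> UNIV \<Longrightarrow> x t = y t" for x y :: "nat \<Rightarrow> 'a"
    using that by auto
qed (simp_all add: cauchy_algebra_def cauchy_in cauchy_add cauchy_mult cauchy_smult cauchy_adj
    conv_imp_cauchy[OF conv_const])

lemma completion_laws: "star_algebra_laws CA"
  by (rule star_algebra_laws_inherit_surj[OF cauchy_algebra_laws, where p = cls])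
    (simp_all add: cauchy_algebra_def cls_carrier cls_zero cls_add cls_mult cls_smult cls_adj
      del: Image_singleton_iff)

lemma cls_minus:
  assumes s: "cauchy A s" and t: "cauchy A t"
  shows "cls s \<ominus>\<^bsub>CA\<^esub> cls t = cls (\<lambda>n. s n \<ominus> t n)"
proof -
  interpret C: star_algebra_laws CA by (rule completion_laws)
  show ?thesis
    using s t by (simp add: C.minus_smult cls_carrier cls_smult cls_add cauchy_smult minus_smult cauchy_in)
qed

lemma completion_pre_cstar: "pre_cstar CA"
proof (rule pre_cstar.intro[OF completion_laws pre_cstar_axioms.intro])
  fix X assume "X \<in> carrier CA"
  then obtain s where s: "cauchy A s" "X = cls s" by (auto simp: cls_carrier)
  note ls = cls_norm_lim[OF s(1)]
  show "0 \<le> nrm CA X"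
    unfolding s(2) by (rule LIMSEQ_le_const[OF ls]) (simp add: cauchy_in s)
  have "nrm CA (cls s) = 0 \<longleftrightarrow> null_diff s (\<lambda>n. \<zero>)"
    using ls cls_norm[OF s(1), of 0] s(1) by (auto simp: null_diff_def cauchy_in)
  then show "nrm CA X = 0 \<longleftrightarrow> X = \<zero>\<^bsub>CA\<^esub>"
    using cls_eq_iff[OF s(1) conv_imp_cauchy[OF conv_const[of \<zero>]]]
    unfolding s(2) cls_zero by simp
  show "nrm CA (c \<odot>\<^bsub>CA\<^esub> X) = cmod c * nrm CA X" for c
    unfolding s(2) cls_smult[OF s(1)]
    by (rule cls_norm[OF cauchy_smult[OF s(1)]]) (simp add: cauchy_in s(1) tendsto_mult_left[OF ls])
  have "(\<lambda>n. nrm A (adj A (s n) \<otimes> s n)) \<longlonglongrightarrow> (nrm CA (cls s))\<^sup>2"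
    using tendsto_power[OF ls, of 2] by (simp add: cstar_identity cauchy_in s(1))
  then show "nrm CA (adj CA X \<otimes>\<^bsub>CA\<^esub> X) = (nrm CA X)\<^sup>2"
    unfolding s(2) cls_adj[OF s(1)] cls_mult[OF cauchy_adj[OF s(1)] s(1)]
    by (rule cls_norm[OF cauchy_mult[OF cauchy_adj[OF s(1)] s(1)]])
  fix Y assume "Y \<in> carrier CA"
  then obtain t where t: "cauchy A t" "Y = cls t" by (auto simp: cls_carrier)
  note lt = cls_norm_lim[OF t(1)]
  show "nrm CA (X \<oplus>\<^bsub>CA\<^esub> Y) \<le> nrm CA X + nrm CA Y"
    unfolding s(2) t(2) cls_add[OF s(1) t(1)]
    by (rule LIMSEQ_le[OF cls_norm_lim[OF cauchy_add[OF s(1) t(1)]] tendsto_add[OF ls lt]])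
      (simp add: nrm_triangle cauchy_in s(1) t(1))
  show "nrm CA (X \<otimes>\<^bsub>CA\<^esub> Y) \<le> nrm CA X * nrm CA Y"
    unfolding s(2) t(2) cls_mult[OF s(1) t(1)]
    by (rule LIMSEQ_le[OF cls_norm_lim[OF cauchy_mult[OF s(1) t(1)]] tendsto_mult[OF ls lt]])
      (simp add: nrm_mult cauchy_in s(1) t(1))
qed

text \<open>The distance from the constant class at \<open>s n\<close> to the class of
  \<open>s\<close> is the limit over \<open>m\<close> of the norm of \<open>s n - s m\<close>. Thus
  a class is the limit of the terms of any representative.\<close>

lemma embed_conv:
  assumes s: "cauchy A s"
  shows "conv CA (\<lambda>n. cls (\<lambda>m. s n)) (cls s)"
proof -
  interpret C: pre_cstar CA by (rule completion_pre_cstar)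
  have const: "cauchy A (\<lambda>m. s n)" for n by (rule conv_imp_cauchy[OF conv_const]) (simp add: cauchy_in s)
  have "(\<lambda>n. nrm CA (cls (\<lambda>m. s n) \<ominus>\<^bsub>CA\<^esub> cls s)) \<longlonglongrightarrow> 0"
  proof (rule LIMSEQ_I)
    fix e :: real assume "e > 0"
    then obtain N where N: "\<And>m n. m \<ge> N \<Longrightarrow> n \<ge> N \<Longrightarrow> nrm A (s m \<ominus> s n) < e / 2"
      using cauchyD[OF s, of "e / 2"] by auto
    have "norm (nrm CA (cls (\<lambda>m. s n) \<ominus>\<^bsub>CA\<^esub> cls s) - 0) < e" if n: "n \<ge> N" for n
    proof -
      have "nrm CA (cls (\<lambda>m. s n \<ominus> s m)) \<le> e / 2"
        by (rule LIMSEQ_le_const2[OF cls_norm_lim[OF cauchy_minus[OF const[of n] s]]])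
          (use N[OF n] in \<open>force intro: less_imp_le\<close>)
      moreover have "nrm CA (cls (\<lambda>m. s n) \<ominus>\<^bsub>CA\<^esub> cls s) \<ge> 0"
        by (rule C.nrm_nonneg[OF C.minus_in[OF cls_in[OF const] cls_in[OF s]]])
      ultimately show ?thesis using \<open>e > 0\<close> by (simp add: cls_minus const s)
    qed
    then show "\<exists>N. \<forall>n\<ge>N. norm (nrm CA (cls (\<lambda>m. s n) \<ominus>\<^bsub>CA\<^esub> cls s) - 0) < e" by blast
  qed
  then show ?thesis using const s by (auto simp: conv_def cls_carrier)
qed

lemma embed_norm: "x \<in> carrier A \<Longrightarrow> nrm CA (cls (\<lambda>n. x)) = nrm A x"
  by (intro cls_norm conv_imp_cauchy[OF conv_const]) auto

text \<open>The diagonal argument: approximating the \<open>n\<close>-th class within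
  \<open>1 / (n + 1)\<close> by an element \<open>x n\<close> yields a Cauchy sequence whose class
  is the limit. It gives both completeness and the description of closures.\<close>

lemma embed_approx:
  assumes x: "\<And>n. x n \<in> carrier A" and X: "cauchy CA X"
    and approx: "\<And>n. nrm CA (X n \<ominus>\<^bsub>CA\<^esub> cls (\<lambda>m. x n)) < 1 / real (Suc n)"
  shows "cauchy A x" "conv CA X (cls x)"
proof -
  interpret C: pre_cstar CA by (rule completion_pre_cstar)
  have const: "cauchy A (\<lambda>m. x n)" for n by (rule conv_imp_cauchy[OF conv_const]) (rule x)
  have in_C: "X n \<in> carrier CA" "cls (\<lambda>m. x n) \<in> carrier CA" for n
    using const C.cauchy_in[OF X] by (auto simp: cls_carrier)
  have null: "conv CA (\<lambda>n. X n \<ominus>\<^bsub>CA\<^esub> cls (\<lambda>m. x n)) \<zero>\<^bsub>CA\<^esub>"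
  proof (rule C.convI)
    show "nrm CA (X n \<ominus>\<^bsub>CA\<^esub> cls (\<lambda>m. x n) \<ominus>\<^bsub>CA\<^esub> \<zero>\<^bsub>CA\<^esub>) \<le> 1 / real (Suc n)" for n
      using approx[of n] in_C by simp
    show "(\<lambda>n. 1 / real (Suc n)) \<longlonglongrightarrow> 0" by (rule LIMSEQ_Suc[OF lim_1_over_n])
  qed (use in_C in auto)
  have eq: "X n \<ominus>\<^bsub>CA\<^esub> (X n \<ominus>\<^bsub>CA\<^esub> cls (\<lambda>m. x n)) = cls (\<lambda>m. x n)" for n
    using in_C by (simp add: C.add_minus_cancel)
  have "cauchy CA (\<lambda>n. cls (\<lambda>m. x n))"
    using C.cauchy_minus[OF X C.conv_imp_cauchy[OF null]] by (simp only: eq)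
  then show c: "cauchy A x"
    unfolding cauchy_def by (simp add: cls_minus const embed_norm x)
  have eq': "X n \<ominus>\<^bsub>CA\<^esub> cls (\<lambda>m. x n) \<oplus>\<^bsub>CA\<^esub> cls (\<lambda>m. x n) = X n" for n
    using in_C by (simp add: C.add_minus_cancel)
  show "conv CA X (cls x)"
    using C.conv_add[OF null embed_conv[OF c]] by (simp only: eq' C.l_zero[OF cls_in[OF c]])
qed

lemma completion_cstar: "cstar CA"
proof -
  interpret C: pre_cstar CA by (rule completion_pre_cstar)
  show ?thesis
  proof
    fix X assume X: "cauchy CA X"
    have "\<exists>x\<in>carrier A. nrm CA (X n \<ominus>\<^bsub>CA\<^esub> cls (\<lambda>m. x)) < 1 / real (Suc n)" for n
    proof -
      obtain s where s: "cauchy A s" "X n = cls s"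
        using C.cauchy_in[OF X, of n] by (auto simp: cls_carrier)
      have "(\<lambda>m. nrm CA (cls (\<lambda>k. s m) \<ominus>\<^bsub>CA\<^esub> cls s)) \<longlonglongrightarrow> 0"
        using embed_conv[OF s(1)] by (simp add: conv_def)
      then have "\<forall>\<^sub>F m in sequentially. nrm CA (cls (\<lambda>k. s m) \<ominus>\<^bsub>CA\<^esub> cls s) < 1 / real (Suc n)"
        by (rule order_tendstoD(2)) simp
      then obtain m where "nrm CA (cls (\<lambda>k. s m) \<ominus>\<^bsub>CA\<^esub> cls s) < 1 / real (Suc n)"
        by (auto simp: eventually_sequentially)
      moreover have "cls (\<lambda>k. s m) \<in> carrier CA" "cls s \<in> carrier CA"
        using C.conv_in[OF embed_conv[OF s(1)]] by auto
      ultimately show ?thesis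
        using C.nrm_minus_commute[of "cls (\<lambda>k. s m)" "cls s"] s by (intro bexI[of _ "s m"]) (simp_all add: cauchy_in)
    qed
    then obtain x where x: "\<And>n. x n \<in> carrier A"
      "\<And>n. nrm CA (X n \<ominus>\<^bsub>CA\<^esub> cls (\<lambda>m. x n)) < 1 / real (Suc n)" by metis
    show "\<exists>Y. conv CA X Y" using embed_approx(2)[OF x(1) X x(2)] by blast
  qed
qed

text \<open>A point of the closure is approximated from \<open>S\<close>, and the diagonal argument
  for the constant sequence at that point identifies it as the class of the approximants.
  Conversely, a class is the limit of the terms of its representative.\<close>

lemma closure_of_embed:
  assumes S: "S \<subseteq> carrier A"
  shows "ntopology CA closure_of (completion_embed A ` S) = cls ` {s. cauchy A s \<and> (\<forall>n. s n \<in> S)}"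
proof -
  interpret C: pre_cstar CA by (rule completion_pre_cstar)
  have emb: "completion_embed A x = cls (\<lambda>n. x)" for x by (simp add: completion_embed_def)
  have emb_in: "cls (\<lambda>n. x) \<in> carrier CA" if "x \<in> carrier A" for x
    using conv_imp_cauchy[OF conv_const[OF that]] by (auto simp: cls_carrier)
  show ?thesis
  proof (intro equalityI subsetI)
    fix X assume "X \<in> ntopology CA closure_of (completion_embed A ` S)"
    then have X: "X \<in> carrier CA" "\<And>r. r > 0 \<Longrightarrow> \<exists>x\<in>S. cls (\<lambda>n. x) \<in> C.metric.mball X r"
      unfolding C.metric.metric_closure_of by (auto simp: emb)
    have "\<exists>x\<in>S. nrm CA (X \<ominus>\<^bsub>CA\<^esub> cls (\<lambda>n. x)) < 1 / real (Suc n)" for n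
      using X(2)[of "1 / real (Suc n)"] by (auto simp: ndist_def)
    then obtain x where x: "\<And>n. x n \<in> S" "\<And>n. nrm CA (X \<ominus>\<^bsub>CA\<^esub> cls (\<lambda>m. x n)) < 1 / real (Suc n)"
      by metis
    have X_const: "conv CA (\<lambda>n. X) X" using X(1) by simp
    have xA: "x n \<in> carrier A" for n using x(1) S by blast
    note ap = embed_approx[OF xA C.conv_imp_cauchy[OF X_const] x(2)]
    have "X = cls x" using X_const ap(2) by (rule C.conv_unique)
    then show "X \<in> cls ` {s. cauchy A s \<and> (\<forall>n. s n \<in> S)}" using ap(1) x(1) by blast
  next
    fix X assume "X \<in> cls ` {s. cauchy A s \<and> (\<forall>n. s n \<in> S)}"
    then obtain s where s: "cauchy A s" "\<And>n. s n \<in> S" "X = cls s" by blast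
    define K where "K = ntopology CA closure_of (completion_embed A ` S)"
    have "completion_embed A ` S \<subseteq> K"
      unfolding K_def by (rule closure_of_subset) (use S emb_in in \<open>auto simp: emb\<close>)
    then have in_K: "\<forall>n. cls (\<lambda>m. s n) \<in> K" using s(2) by (auto simp: emb)
    have "closedin C.metric.mtopology K" by (simp add: K_def)
    then have "\<forall>s x. (\<forall>n. s n \<in> K) \<and> conv CA s x \<longrightarrow> x \<in> K"
      unfolding C.closedin_iff by (elim conjE)
    from spec[where x = "cls s", OF spec[where x = "\<lambda>n. cls (\<lambda>m. s n)", OF this]]
    have "cls s \<in> K" using in_K embed_conv[OF s(1)] by blast
    then show "X \<in> ntopology CA closure_of (completion_embed A ` S)" by (simp only: s(3) K_def)
  qed
qed

end

section \<open>Extension of contractive homomorphisms to completions\<close>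

locale contractive_hom = A: pre_cstar A + B: pre_cstar B
  for A :: "('a, 'm) star_algebra_scheme" and B :: "('b, 'n) star_algebra_scheme" and f +
  assumes f: "f \<in> star_hom A B" and contractive: "\<And>x. x \<in> carrier A \<Longrightarrow> nrm B (f x) \<le> nrm A x"
begin

sublocale hom: star_hom_pair A B f
  by unfold_locales (rule f)

lemma cauchy_map: "cauchy A s \<Longrightarrow> cauchy B (\<lambda>n. f (s n))"
proof (rule B.cauchyI)
  fix e :: real assume s: "cauchy A s" and "e > 0"
  then obtain N where N: "\<forall>m\<ge>N. \<forall>n\<ge>N. nrm A (s m \<ominus>\<^bsub>A\<^esub> s n) < e"
    using A.cauchyD by blast
  have "nrm B (f (s m) \<ominus>\<^bsub>B\<^esub> f (s n)) \<le> nrm A (s m \<ominus>\<^bsub>A\<^esub> s n)" for m n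
    using contractive[of "s m \<ominus>\<^bsub>A\<^esub> s n"] s by (simp add: A.cauchy_in)
  with N show "\<exists>N. \<forall>m\<ge>N. \<forall>n\<ge>N. nrm B (f (s m) \<ominus>\<^bsub>B\<^esub> f (s n)) < e"
    by (meson le_less_trans)
qed (simp add: A.cauchy_in)

lemma completion_map_cls:
  assumes s: "cauchy A s"
  shows "completion_map A B f (A.cls s) = B.cls (\<lambda>n. f (s n))"
proof -
  have "B.cls (\<lambda>n. f (t n)) = B.cls (\<lambda>n. f (s n))" if t: "cauchy A t" "A.null_diff s t" for t
  proof -
    have "B.null_diff (\<lambda>n. f (s n)) (\<lambda>n. f (t n))"
    proof (rule B.null_diffI)
      show "nrm B (f (s n) \<ominus>\<^bsub>B\<^esub> f (t n)) \<le> nrm A (s n \<ominus>\<^bsub>A\<^esub> t n)" for n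
        using contractive[of "s n \<ominus>\<^bsub>A\<^esub> t n"] s t by (simp add: A.cauchy_in)
      show "(\<lambda>n. nrm A (s n \<ominus>\<^bsub>A\<^esub> t n)) \<longlonglongrightarrow> 0"
        using t(2) by (simp add: A.null_diff_def)
    qed (use s t in \<open>simp_all add: A.cauchy_in\<close>)
    then show ?thesis using B.cls_eq_iff[OF cauchy_map[OF s] cauchy_map[OF t(1)]] by simp
  qed
  then have "(\<Union>t\<in>A.cls s. B.cls (\<lambda>n. f (t n))) = B.cls (\<lambda>n. f (s n))"
    by (intro A.cls_UN s)
  moreover have "A.cls s \<in> carrier (completion A)" using s by (simp add: A.cls_carrier)
  ultimately show ?thesis by (simp add: completion_map_def)
qed

lemma completion_map_hom: "completion_map A B f \<in> star_hom (completion A) (completion B)"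
proof (rule star_homI)
  fix X assume "X \<in> carrier (completion A)"
  then obtain s where s: "cauchy A s" "X = A.cls s" by (auto simp: A.cls_carrier)
  note s_in = A.cauchy_in[OF s(1)] and fs = cauchy_map[OF s(1)]
  show "completion_map A B f X \<in> carrier (completion B)"
    unfolding s(2) completion_map_cls[OF s(1)] using fs by (simp add: B.cls_carrier)
  show "completion_map A B f (c \<odot>\<^bsub>completion A\<^esub> X) = c \<odot>\<^bsub>completion B\<^esub> completion_map A B f X" for c
    unfolding s(2) A.cls_smult[OF s(1)] completion_map_cls[OF s(1)] B.cls_smult[OF fs]
      completion_map_cls[OF A.cauchy_smult[OF s(1)]] by (simp add: s_in)
  show "completion_map A B f (adj (completion A) X) = adj (completion B) (completion_map A B f X)"
    unfolding s(2) A.cls_adj[OF s(1)] completion_map_cls[OF s(1)] B.cls_adj[OF fs]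
      completion_map_cls[OF A.cauchy_adj[OF s(1)]] by (simp add: s_in)
  fix Y assume "Y \<in> carrier (completion A)"
  then obtain t where t: "cauchy A t" "Y = A.cls t" by (auto simp: A.cls_carrier)
  note t_in = A.cauchy_in[OF t(1)] and ft = cauchy_map[OF t(1)]
  show "completion_map A B f (X \<oplus>\<^bsub>completion A\<^esub> Y)
      = completion_map A B f X \<oplus>\<^bsub>completion B\<^esub> completion_map A B f Y"
    unfolding s(2) t(2) A.cls_add[OF s(1) t(1)] completion_map_cls[OF s(1)] completion_map_cls[OF t(1)]
      B.cls_add[OF fs ft] completion_map_cls[OF A.cauchy_add[OF s(1) t(1)]]
    by (simp add: s_in t_in)
  show "completion_map A B f (X \<otimes>\<^bsub>completion A\<^esub> Y)
      = completion_map A B f X \<otimes>\<^bsub>completion B\<^esub> completion_map A B f Y"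
    unfolding s(2) t(2) A.cls_mult[OF s(1) t(1)] completion_map_cls[OF s(1)] completion_map_cls[OF t(1)]
      B.cls_mult[OF fs ft] completion_map_cls[OF A.cauchy_mult[OF s(1) t(1)]]
    by (simp add: s_in t_in)
qed

end

section \<open>Absolutely convergent series\<close>

context star_algebra_laws
begin

abbreviation psum :: "(nat \<Rightarrow> 'a) \<Rightarrow> nat \<Rightarrow> 'a"
  where "psum F n \<equiv> (\<Oplus>k\<in>{..<n}. F k)"

lemma psum_Suc: "(\<And>k. F k \<in> carrier A) \<Longrightarrow> psum F (Suc n) = psum F n \<oplus> F n"
  by (simp add: lessThan_Suc finsum_insert Pi_def a_comm)

lemma psum_in [simp]: "(\<And>k. F k \<in> carrier A) \<Longrightarrow> psum F n \<in> carrier A"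
  by (simp add: finsum_closed Pi_def)

lemma psum_cong: "(\<And>k. k < n \<Longrightarrow> F k = G k) \<Longrightarrow> (\<And>k. G k \<in> carrier A) \<Longrightarrow> psum F n = psum G n"
  by (rule finsum_cong') auto

lemma psum_add:
  assumes "\<And>k. F k \<in> carrier A" "\<And>k. G k \<in> carrier A"
  shows "psum (\<lambda>k. F k \<oplus> G k) n = psum F n \<oplus> psum G n"
  using assms by (simp add: finsum_addf Pi_def)

lemma psum_smult:
  assumes "\<And>k. F k \<in> carrier A"
  shows "psum (\<lambda>k. c \<odot> F k) n = c \<odot> psum F n"
  by (induction n) (simp_all add: psum_Suc assms smult_add_right)

lemma psum_minus:
  assumes "\<And>k. F k \<in> carrier A" "\<And>k. G k \<in> carrier A"
  shows "psum (\<lambda>k. F k \<ominus> G k) n = psum F n \<ominus> psum G n"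
  using assms by (simp add: minus_smult psum_add psum_smult)

lemma psum_mult_right:
  assumes "\<And>k. F k \<in> carrier A" "x \<in> carrier A"
  shows "psum (\<lambda>k. F k \<otimes> x) n = psum F n \<otimes> x"
  by (induction n) (simp_all add: psum_Suc assms mult_add_left)

lemma psum_adj:
  assumes "\<And>k. F k \<in> carrier A"
  shows "psum (\<lambda>k. adj A (F k)) n = adj A (psum F n)"
  by (induction n) (simp_all add: psum_Suc assms adj_add)

lemma psum_shift:
  assumes "\<And>k. F k \<in> carrier A"
  shows "psum F (Suc n) = F 0 \<oplus> psum (\<lambda>k. F (Suc k)) n"
proof (induction n)
  case (Suc n)
  have "psum F (Suc (Suc n)) = psum F (Suc n) \<oplus> F (Suc n)" using assms by (rule psum_Suc)
  also have "\<dots> = F 0 \<oplus> psum (\<lambda>k. F (Suc k)) (Suc n)"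
    unfolding Suc psum_Suc[of "\<lambda>k. F (Suc k)", OF assms] by (simp add: assms a_assoc)
  finally show ?case .
qed (use assms psum_Suc[of F 0] in simp)

text \<open>Both sides sum over the index pairs with total below \<open>n\<close>: on the left by
  total, on the right by the first index.\<close>

lemma psum_rows:
  assumes a: "\<And>k. a k \<in> carrier A" and b: "\<And>k. b k \<in> carrier A"
  shows "psum (\<lambda>n. psum (\<lambda>k. a k \<otimes> b (n - k)) (Suc n)) n = psum (\<lambda>i. a i \<otimes> psum b (n - i)) n"
proof (induction n)
  case (Suc n)
  have "psum (\<lambda>i. a i \<otimes> psum b (Suc n - i)) (Suc n)
      = psum (\<lambda>i. a i \<otimes> psum b (n - i) \<oplus> a i \<otimes> b (n - i)) (Suc n)"
    by (rule psum_cong) (simp_all add: a b Suc_diff_le psum_Suc mult_add_right)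
  also have "\<dots> = psum (\<lambda>i. a i \<otimes> psum b (n - i)) (Suc n) \<oplus> psum (\<lambda>k. a k \<otimes> b (n - k)) (Suc n)"
    by (rule psum_add) (simp_all add: a b)
  \<comment> \<open>The last summand vanishes because its inner sum is empty.\<close>
  also have "psum (\<lambda>i. a i \<otimes> psum b (n - i)) (Suc n) = psum (\<lambda>i. a i \<otimes> psum b (n - i)) n"
    by (simp add: psum_Suc a b)
  also have "\<dots> = psum (\<lambda>n. psum (\<lambda>k. a k \<otimes> b (n - k)) (Suc n)) n" by (rule Suc.IH[symmetric])
  also have "\<dots> \<oplus> psum (\<lambda>k. a k \<otimes> b (n - k)) (Suc n)
      = psum (\<lambda>n. psum (\<lambda>k. a k \<otimes> b (n - k)) (Suc n)) (Suc n)"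
    by (rule psum_Suc[symmetric]) (simp add: a b)
  finally show ?case by (rule sym)
qed simp

end

lemma (in star_hom_pair) hom_psum:
  assumes "\<And>k. F k \<in> carrier A"
  shows "f (A.psum F n) = B.psum (\<lambda>k. f (F k)) n"
  by (induction n) (simp_all add: A.psum_Suc B.psum_Suc assms)

lemma sum_rows_real:
  fixes a b :: "nat \<Rightarrow> real"
  shows "(\<Sum>n<N. \<Sum>k\<le>n. a k * b (n - k)) = (\<Sum>i<N. a i * (\<Sum>k<N - i. b k))"
proof (induction N)
  case (Suc n)
  have "(\<Sum>i<Suc n. a i * (\<Sum>k<Suc n - i. b k)) = (\<Sum>i<Suc n. a i * (\<Sum>k<n - i. b k) + a i * b (n - i))"
    by (rule sum.cong) (simp_all add: Suc_diff_le distrib_left)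
  also have "\<dots> = (\<Sum>i<n. a i * (\<Sum>k<n - i. b k)) + (\<Sum>i\<le>n. a i * b (n - i))"
    by (simp add: sum.distrib lessThan_Suc_atMost[symmetric])
  finally show ?case using Suc by simp
qed simp

context pre_cstar
begin

lemma nrm_psum_le: "(\<And>k. F k \<in> carrier A) \<Longrightarrow> nrm A (psum F n) \<le> (\<Sum>k<n. nrm A (F k))"
proof (induction n)
  case (Suc n)
  then show ?case
    using nrm_triangle[of "psum F n" "F n"] by (simp add: psum_Suc)
qed simp

lemma nrm_psum_diff_le:
  assumes F: "\<And>k. F k \<in> carrier A" and "m \<le> n"
  shows "nrm A (psum F n \<ominus> psum F m) \<le> (\<Sum>k<n. nrm A (F k)) - (\<Sum>k<m. nrm A (F k))"
  using \<open>m \<le> n\<close>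
proof (induction n rule: dec_induct)
  case base
  show ?case using F by (simp add: minus_eq r_neg)
next
  case (step n)
  have "nrm A (psum F (Suc n) \<ominus> psum F m) \<le> nrm A (psum F (Suc n) \<ominus> psum F n) + nrm A (psum F n \<ominus> psum F m)"
    by (rule nrm_minus_triangle) (simp_all add: F)
  also have "psum F (Suc n) \<ominus> psum F n = F n" by (simp add: psum_Suc F add_minus_cancel)
  finally show ?case using step by simp
qed

lemma cauchy_psum:
  assumes F: "\<And>k. F k \<in> carrier A" and sm: "summable (\<lambda>k. nrm A (F k))"
  shows "cauchy A (psum F)"
proof (rule cauchyI)
  fix e :: real assume "e > 0"
  have "Cauchy (\<lambda>n. \<Sum>k<n. nrm A (F k))"
    using sm by (simp add: summable_iff_convergent convergent_Cauchy)
  then obtain N where N: "\<And>m n. m \<ge> N \<Longrightarrow> n \<ge> N \<Longrightarrow> dist (\<Sum>k<m. nrm A (F k)) (\<Sum>k<n. nrm A (F k)) < e"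
    using \<open>e > 0\<close> unfolding Cauchy_def by blast
  have le: "nrm A (psum F n \<ominus> psum F m) < e" if "m \<ge> N" "m \<le> n" for m n
    using nrm_psum_diff_le[of F m n] N[of m n] that F by (simp add: dist_real_def)
  have "nrm A (psum F m \<ominus> psum F n) < e" if "m \<ge> N" "n \<ge> N" for m n
  proof (cases "m \<le> n")
    case True
    then show ?thesis
      using le[of m n] that nrm_minus_commute[of "psum F m" "psum F n"] F by simp
  qed (use le[of n m] that in simp)
  then show "\<exists>N. \<forall>m\<ge>N. \<forall>n\<ge>N. nrm A (psum F m \<ominus> psum F n) < e" by blast
qed (simp add: F)

lemma nrm_sum_le:
  assumes F: "\<And>k. F k \<in> carrier A" and "conv A (psum F) x" and sm: "summable b"
    and le: "\<And>k. nrm A (F k) \<le> b k"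
  shows "nrm A x \<le> suminf b"
proof (rule conv_norm_le[OF assms(2)])
  fix n
  have "nrm A (psum F n) \<le> (\<Sum>k<n. nrm A (F k))" using F by (rule nrm_psum_le)
  also have "\<dots> \<le> (\<Sum>k<n. b k)" by (intro sum_mono le)
  also have "\<dots> \<le> suminf b"
    using order_trans[OF nrm_nonneg[OF F] le] by (intro sum_le_suminf sm) auto
  finally show "nrm A (psum F n) \<le> suminf b" .
qed

lemma nrm_tail_le:
  assumes F: "\<And>k. F k \<in> carrier A" and x: "conv A (psum F) x" and sm: "summable (\<lambda>k. nrm A (F k))"
  shows "nrm A (psum F n \<ominus> x) \<le> (\<Sum>k. nrm A (F k)) - (\<Sum>k<n. nrm A (F k))"
proof -
  have xA: "x \<in> carrier A" using x by (rule conv_in)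
  have "nrm A (psum F m \<ominus> psum F n) \<le> (\<Sum>k. nrm A (F k)) - (\<Sum>k<n. nrm A (F k))" if "m \<ge> n" for m
    using nrm_psum_diff_le[of F, OF F that] sum_le_suminf[OF sm, of "{..<m}"] F by simp
  moreover have "(\<lambda>m. nrm A (psum F m \<ominus> psum F n)) \<longlonglongrightarrow> nrm A (x \<ominus> psum F n)"
    by (rule conv_norm[OF conv_minus[OF x conv_const]]) (simp add: F)
  ultimately have "nrm A (x \<ominus> psum F n) \<le> (\<Sum>k. nrm A (F k)) - (\<Sum>k<n. nrm A (F k))"
    by (intro LIMSEQ_le_const2) auto
  then show ?thesis using nrm_minus_commute[of x "psum F n"] xA F by simp
qed

text \<open>The partial sums of the product differ from \<open>psum a n \<otimes> y\<close> by terms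
  \<open>a i\<close> times a remainder of \<open>b\<close>. Their norms are bounded by the same
  difference for the real series of norms, which tends to zero by the Cauchy product theorem for
  real series.\<close>

lemma Cauchy_product_conv:
  assumes a: "\<And>k. a k \<in> carrier A" and b: "\<And>k. b k \<in> carrier A"
    and sa: "summable (\<lambda>k. nrm A (a k))" and sb: "summable (\<lambda>k. nrm A (b k))"
    and x: "conv A (psum a) x" and y: "conv A (psum b) y"
  shows "conv A (psum (\<lambda>n. psum (\<lambda>k. a k \<otimes> b (n - k)) (Suc n))) (x \<otimes> y)"
proof -
  have xy [simp]: "x \<in> carrier A" "y \<in> carrier A" using conv_in(1)[OF x] conv_in(1)[OF y] .
  define c where "c = (\<lambda>n. psum (\<lambda>k. a k \<otimes> b (n - k)) (Suc n))"
  have cA: "c n \<in> carrier A" for n by (simp add: c_def a b)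
  define S where "S = (\<Sum>k. nrm A (b k))"
  have rows: "psum c n = psum (\<lambda>i. a i \<otimes> psum b (n - i)) n" for n
    unfolding c_def by (rule psum_rows[OF a b])
  have diff: "psum c n \<ominus> psum a n \<otimes> y = psum (\<lambda>i. a i \<otimes> (psum b (n - i) \<ominus> y)) n" for n
    unfolding rows
    by (simp add: a b mult_minus_right psum_minus psum_mult_right)
  have "conv A (\<lambda>n. psum c n \<ominus> psum a n \<otimes> y) \<zero>"
  proof (rule convI)
    fix n
    have "nrm A (psum c n \<ominus> psum a n \<otimes> y) \<le> (\<Sum>i<n. nrm A (a i \<otimes> (psum b (n - i) \<ominus> y)))"
      unfolding diff by (rule nrm_psum_le) (simp add: a b)
    also have "\<dots> \<le> (\<Sum>i<n. nrm A (a i) * (S - (\<Sum>k<n - i. nrm A (b k))))"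
      unfolding S_def
      by (intro sum_mono order_trans[OF nrm_mult] mult_left_mono nrm_tail_le y sb) (simp_all add: a b)
    also have "\<dots> = (\<Sum>i<n. nrm A (a i)) * S - (\<Sum>i<n. nrm A (a i) * (\<Sum>k<n - i. nrm A (b k)))"
      by (simp add: right_diff_distrib sum_subtractf sum_distrib_right)
    also have "\<dots> = (\<Sum>i<n. nrm A (a i)) * S - (\<Sum>m<n. \<Sum>k\<le>m. nrm A (a k) * nrm A (b (m - k)))"
      by (simp add: sum_rows_real[of "\<lambda>k. nrm A (a k)" "\<lambda>k. nrm A (b k)"])
    finally show "nrm A (psum c n \<ominus> psum a n \<otimes> y \<ominus> \<zero>)
        \<le> (\<Sum>i<n. nrm A (a i)) * S - (\<Sum>m<n. \<Sum>k\<le>m. nrm A (a k) * nrm A (b (m - k)))"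
      by (simp add: cA a)
  next
    have "(\<lambda>n. (\<Sum>i<n. nrm A (a i)) * S) \<longlonglongrightarrow> (\<Sum>k. nrm A (a k)) * S"
      by (intro tendsto_mult_right summable_LIMSEQ sa)
    moreover have "(\<lambda>n. \<Sum>m<n. \<Sum>k\<le>m. nrm A (a k) * nrm A (b (m - k))) \<longlonglongrightarrow> (\<Sum>k. nrm A (a k)) * S"
      using Cauchy_product_sums[of "\<lambda>k. nrm A (a k)" "\<lambda>k. nrm A (b k)"] sa sb a b
      by (simp add: S_def sums_def)
    ultimately have "(\<lambda>n. (\<Sum>i<n. nrm A (a i)) * S - (\<Sum>m<n. \<Sum>k\<le>m. nrm A (a k) * nrm A (b (m - k))))
        \<longlonglongrightarrow> (\<Sum>k. nrm A (a k)) * S - (\<Sum>k. nrm A (a k)) * S"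
      by (rule tendsto_diff)
    then show "(\<lambda>n. (\<Sum>i<n. nrm A (a i)) * S - (\<Sum>m<n. \<Sum>k\<le>m. nrm A (a k) * nrm A (b (m - k)))) \<longlonglongrightarrow> 0"
      by simp
  qed (simp_all add: cA a)
  from conv_add[OF this conv_mult[OF x conv_const[of y]]]
  have "conv A (psum c) (\<zero> \<oplus> x \<otimes> y)"
    by (simp add: cA a add_minus_cancel)
  then show ?thesis unfolding c_def by simp
qed

end

section \<open>Power series\<close>

locale series_algebra = cstar +
  fixes K :: "real set"
  assumes K: "K \<subseteq> {-1..1}" and K0: "0 islimpt K"
begin

abbreviation "P \<equiv> power_series K A"
abbreviation "ev F t \<equiv> ps_eval A F t"
abbreviation "trm t F k \<equiv> complex_of_real (t ^ k) \<odot> F k"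

lemma P_carrier: "F \<in> carrier P \<longleftrightarrow> (\<forall>n. F n \<in> carrier A) \<and> summable (\<lambda>n. nrm A (F n))"
  by (simp add: power_series_def)

lemma P_in: "F \<in> carrier P \<Longrightarrow> F n \<in> carrier A"
  by (simp add: P_carrier)

lemma P_simps:
  "\<zero>\<^bsub>P\<^esub> = (\<lambda>n. \<zero>)" "F \<oplus>\<^bsub>P\<^esub> G = (\<lambda>n. F n \<oplus> G n)" "c \<odot>\<^bsub>P\<^esub> F = (\<lambda>n. c \<odot> F n)"
  "adj P F = (\<lambda>n. adj A (F n))"
  "F \<otimes>\<^bsub>P\<^esub> G = (\<lambda>n. psum (\<lambda>k. F k \<otimes> G (n - k)) (Suc n))"
  "nrm P F = (SUP t\<in>K. nrm A (ev F t))"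
  by (simp_all add: power_series_def lessThan_Suc_atMost)

lemma K_abs: "t \<in> K \<Longrightarrow> \<bar>t\<bar> \<le> 1"
  using K by (auto simp: abs_le_iff)

lemma K_nonempty: "K \<noteq> {}"
  using K0 by auto

lemma trm_norm_le:
  assumes "F n \<in> carrier A" "\<bar>t\<bar> \<le> 1"
  shows "nrm A (trm t F n) \<le> nrm A (F n)"
proof -
  have "\<bar>t\<bar> ^ n \<le> 1" using assms(2) by (intro power_le_one) auto
  then have "\<bar>t\<bar> ^ n * nrm A (F n) \<le> 1 * nrm A (F n)" using assms(1) by (intro mult_right_mono) auto
  then show ?thesis using assms(1) by (simp add: norm_power)
qed

lemma trm_summable:
  assumes "F \<in> carrier P" "\<bar>t\<bar> \<le> 1"
  shows "summable (\<lambda>n. nrm A (trm t F n))"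
  by (rule summable_comparison_test'[of "\<lambda>n. nrm A (F n)" 0])
    (use trm_norm_le[OF P_in[OF assms(1)] assms(2)] assms(1) in \<open>simp_all add: P_carrier\<close>)

lemma ev_conv:
  assumes "F \<in> carrier P" "\<bar>t\<bar> \<le> 1"
  shows "conv A (psum (trm t F)) (ev F t)"
proof -
  have trm_A: "trm t F k \<in> carrier A" for k using P_in[OF assms(1)] by simp
  then have in_A: "psum (trm t F) n \<in> carrier A" for n by simp
  obtain x where x: "conv A (psum (trm t F)) x"
    using cauchy_conv[OF cauchy_psum[OF trm_A trm_summable[OF assms]]] by blast
  have lim: "limitin metric.mtopology (psum (trm t F)) y sequentially \<longleftrightarrow> conv A (psum (trm t F)) y" for y
    by (rule limitin_iff_conv[OF in_A])
  have "ev F t = x"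
    unfolding ps_eval_def lim using x conv_unique by blast
  with x show ?thesis by simp
qed

lemma ev_eqI: "F \<in> carrier P \<Longrightarrow> \<bar>t\<bar> \<le> 1 \<Longrightarrow> conv A (psum (trm t F)) x \<Longrightarrow> ev F t = x"
  using ev_conv conv_unique by blast

lemma ev_in [simp]: "F \<in> carrier P \<Longrightarrow> \<bar>t\<bar> \<le> 1 \<Longrightarrow> ev F t \<in> carrier A"
  using ev_conv conv_in(1) by blast

lemma P_zero_in: "\<zero>\<^bsub>P\<^esub> \<in> carrier P"
  by (simp add: P_carrier P_simps)

lemma P_add_in:
  assumes "F \<in> carrier P" "G \<in> carrier P"
  shows "F \<oplus>\<^bsub>P\<^esub> G \<in> carrier P"
proof -
  have "summable (\<lambda>n. nrm A (F n \<oplus> G n))"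
    by (rule summable_comparison_test'[OF summable_add[of "\<lambda>n. nrm A (F n)" "\<lambda>n. nrm A (G n)"], of 0])
      (use assms nrm_triangle in \<open>auto simp: P_carrier\<close>)
  then show ?thesis using assms by (simp add: P_carrier P_simps)
qed

lemma P_smult_in: "F \<in> carrier P \<Longrightarrow> c \<odot>\<^bsub>P\<^esub> F \<in> carrier P"
  by (simp add: P_carrier P_simps summable_mult)

lemma P_adj_in: "F \<in> carrier P \<Longrightarrow> adj P F \<in> carrier P"
  by (simp add: P_carrier P_simps)

lemma P_mult_in:
  assumes "F \<in> carrier P" "G \<in> carrier P"
  shows "F \<otimes>\<^bsub>P\<^esub> G \<in> carrier P"
proof -
  have in_A: "psum (\<lambda>k. F k \<otimes> G (n - k)) (Suc n) \<in> carrier A" for n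
    by (rule psum_in) (simp add: P_in[OF assms(1)] P_in[OF assms(2)])
  have le: "nrm A (psum (\<lambda>k. F k \<otimes> G (n - k)) (Suc n)) \<le> (\<Sum>k\<le>n. nrm A (F k) * nrm A (G (n - k)))" for n
    unfolding lessThan_Suc_atMost[symmetric]
    by (rule order_trans[OF nrm_psum_le sum_mono])
      (simp_all add: nrm_mult P_in[OF assms(1)] P_in[OF assms(2)])
  have sm: "summable (\<lambda>n. \<Sum>k\<le>n. nrm A (F k) * nrm A (G (n - k)))"
    using assms by (intro summable_Cauchy_product) (simp_all add: P_carrier)
  have "norm (nrm A (psum (\<lambda>k. F k \<otimes> G (n - k)) (Suc n))) \<le> (\<Sum>k\<le>n. nrm A (F k) * nrm A (G (n - k)))" for n
    using le[of n] nrm_nonneg[OF in_A[of n]] by (simp only: real_norm_def abs_of_nonneg)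
  then have "summable (\<lambda>n. nrm A (psum (\<lambda>k. F k \<otimes> G (n - k)) (Suc n)))"
    by (intro summable_comparison_test'[OF sm, of 0])
  then show ?thesis
    unfolding P_simps P_carrier using in_A by blast
qed

lemma ev_zero: "\<bar>t\<bar> \<le> 1 \<Longrightarrow> ev \<zero>\<^bsub>P\<^esub> t = \<zero>"
  by (rule ev_eqI[OF P_zero_in]) (simp_all add: P_simps)

lemma ev_add:
  assumes "F \<in> carrier P" "G \<in> carrier P" "\<bar>t\<bar> \<le> 1"
  shows "ev (F \<oplus>\<^bsub>P\<^esub> G) t = ev F t \<oplus> ev G t"
  by (rule ev_eqI[OF P_add_in])
    (use assms conv_add[OF ev_conv[OF assms(1,3)] ev_conv[OF assms(2,3)]] in
      \<open>simp_all add: P_simps smult_add_right psum_add P_in[OF assms(1)] P_in[OF assms(2)]\<close>)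

lemma ev_smult:
  assumes "F \<in> carrier P" "\<bar>t\<bar> \<le> 1"
  shows "ev (c \<odot>\<^bsub>P\<^esub> F) t = c \<odot> ev F t"
proof (rule ev_eqI[OF P_smult_in])
  have "trm t (c \<odot>\<^bsub>P\<^esub> F) k = c \<odot> trm t F k" for k
    by (simp add: P_simps smult_smult mult.commute P_in[OF assms(1)])
  then show "conv A (psum (trm t (c \<odot>\<^bsub>P\<^esub> F))) (c \<odot> ev F t)"
    using conv_smult[OF ev_conv[OF assms]] by (simp add: psum_smult P_in[OF assms(1)])
qed (use assms in auto)

lemma ev_adj:
  assumes "F \<in> carrier P" "\<bar>t\<bar> \<le> 1"
  shows "ev (adj P F) t = adj A (ev F t)"
proof (rule ev_eqI[OF P_adj_in])
  have "trm t (adj P F) k = adj A (trm t F k)" for k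
    by (simp add: P_simps adj_smult P_in[OF assms(1)])
  then show "conv A (psum (trm t (adj P F))) (adj A (ev F t))"
    using conv_adj[OF ev_conv[OF assms]] by (simp add: psum_adj P_in[OF assms(1)])
qed (use assms in auto)

lemma ev_mult:
  assumes F: "F \<in> carrier P" and G: "G \<in> carrier P" and t: "\<bar>t\<bar> \<le> 1"
  shows "ev (F \<otimes>\<^bsub>P\<^esub> G) t = ev F t \<otimes> ev G t"
proof (rule ev_eqI[OF P_mult_in[OF F G] t])
  note in_A = P_in[OF F] P_in[OF G]
  have "trm t (F \<otimes>\<^bsub>P\<^esub> G) n = psum (\<lambda>k. trm t F k \<otimes> trm t G (n - k)) (Suc n)" for n
  proof -
    have "psum (\<lambda>k. trm t F k \<otimes> trm t G (n - k)) (Suc n)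
        = psum (\<lambda>k. complex_of_real (t ^ n) \<odot> (F k \<otimes> G (n - k))) (Suc n)"
    proof (rule psum_cong)
      fix k assume "k < Suc n"
      then have "complex_of_real (t ^ (n - k)) * complex_of_real (t ^ k) = complex_of_real (t ^ n)"
        by (simp flip: of_real_mult power_add)
      then show "trm t F k \<otimes> trm t G (n - k) = complex_of_real (t ^ n) \<odot> (F k \<otimes> G (n - k))"
        by (simp add: in_A smult_mult_left smult_mult_right smult_smult)
    qed (simp add: in_A)
    also have "\<dots> = trm t (F \<otimes>\<^bsub>P\<^esub> G) n"
      unfolding P_simps by (rule psum_smult) (simp add: in_A)
    finally show ?thesis by (rule sym)
  qed
  then show "conv A (psum (trm t (F \<otimes>\<^bsub>P\<^esub> G))) (ev F t \<otimes> ev G t)"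
    using Cauchy_product_conv[OF _ _ trm_summable[OF F t] trm_summable[OF G t] ev_conv[OF F t] ev_conv[OF G t]]
    by (simp add: in_A)
qed

lemma ev_norm_le:
  assumes "F \<in> carrier P" "\<bar>t\<bar> \<le> 1"
  shows "nrm A (ev F t) \<le> (\<Sum>n. nrm A (F n))"
  by (rule nrm_sum_le[OF _ ev_conv[OF assms]])
    (use assms(1) trm_norm_le[OF P_in[OF assms(1)] assms(2)] in \<open>simp_all add: P_carrier\<close>)

lemma shift_in: "F \<in> carrier P \<Longrightarrow> (\<lambda>n. F (Suc n)) \<in> carrier P"
  using summable_Suc_iff[of "\<lambda>n. nrm A (F n)"] by (simp add: P_carrier)

lemma ev_shift:
  assumes F: "F \<in> carrier P" and t: "\<bar>t\<bar> \<le> 1"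
  shows "ev F t = F 0 \<oplus> complex_of_real t \<odot> ev (\<lambda>n. F (Suc n)) t"
proof (rule conv_unique)
  show "conv A (\<lambda>n. psum (trm t F) (Suc n)) (ev F t)"
    by (rule conv_Suc[OF ev_conv[OF F t]])
  have "psum (trm t F) (Suc n) = F 0 \<oplus> complex_of_real t \<odot> psum (trm t (\<lambda>n. F (Suc n))) n" for n
    by (simp add: psum_shift smult_smult P_in[OF F] flip: psum_smult)
  then show "conv A (\<lambda>n. psum (trm t F) (Suc n)) (F 0 \<oplus> complex_of_real t \<odot> ev (\<lambda>n. F (Suc n)) t)"
    using conv_add[OF conv_const conv_smult[OF ev_conv[OF shift_in[OF F] t]]] P_in[OF F] by simp
qed

text \<open>The identity theorem, which is where \<open>0\<close> being a limit point of \<open>K\<close> enters.\<close>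

lemma coeff_0_zero:
  assumes F: "F \<in> carrier P" and zero: "\<And>t. t \<in> K \<Longrightarrow> t \<noteq> 0 \<Longrightarrow> ev F t = \<zero>"
  shows "F 0 = \<zero>"
proof -
  define S where "S = (\<Sum>n. nrm A (F (Suc n)))"
  note sh = shift_in[OF F]
  have S: "S \<ge> 0" unfolding S_def using sh by (intro suminf_nonneg) (simp_all add: P_carrier)
  show ?thesis
  proof (rule ccontr)
    assume "F 0 \<noteq> \<zero>"
    then have pos: "nrm A (F 0) > 0" using P_in[OF F] by (simp add: less_le)
    then have "nrm A (F 0) / (S + 1) > 0" using S by simp
    \<comment> \<open>Write \<open>F(t) = F 0 + t G(t)\<close> with the norm of \<open>G(t)\<close>
      at most \<open>S\<close>. For such a small \<open>t\<close> the second term cannot cancel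
      \<open>F 0\<close>; the summand 1 guards against \<open>S = 0\<close>.\<close>
    then obtain t where t: "t \<in> K" "t \<noteq> 0" "\<bar>t\<bar> < nrm A (F 0) / (S + 1)"
      using K0 by (auto simp: islimpt_approachable dist_real_def)
    have t1: "\<bar>t\<bar> \<le> 1" using t(1) by (rule K_abs)
    have "F 0 = ev F t \<ominus> complex_of_real t \<odot> ev (\<lambda>n. F (Suc n)) t"
      unfolding ev_shift[OF F t1]
      using P_in[OF F, of 0] ev_in[OF sh t1] add_minus_cancel(2)[of "complex_of_real t \<odot> ev (\<lambda>n. F (Suc n)) t" "F 0"]
      by (simp add: a_comm)
    then have "nrm A (F 0) = \<bar>t\<bar> * nrm A (ev (\<lambda>n. F (Suc n)) t)"
      using zero[OF t(1,2)] ev_in[OF sh t1] by (simp add: minus_eq)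
    also have "\<dots> \<le> \<bar>t\<bar> * S"
      unfolding S_def by (intro mult_left_mono ev_norm_le sh t1) auto
    also have "\<dots> \<le> \<bar>t\<bar> * (S + 1)" by (intro mult_left_mono) auto
    also have "\<dots> < nrm A (F 0)" using t(3) S by (simp add: field_simps)
    finally show False by simp
  qed
qed

text \<open>Vanishing is required only at nonzero points, so the induction can divide by
  \<open>t\<close> and pass to the shifted series.\<close>

lemma coeff_zero:
  assumes "F \<in> carrier P" "\<And>t. t \<in> K \<Longrightarrow> t \<noteq> 0 \<Longrightarrow> ev F t = \<zero>"
  shows "F n = \<zero>"
  using assms
proof (induction n arbitrary: F)
  case (0 F)
  then show ?case by (rule coeff_0_zero)
next
  case (Suc n F)
  note sh = shift_in[OF Suc.prems(1)]
  have F0: "F 0 = \<zero>" using Suc.prems by (rule coeff_0_zero)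
  show ?case
  proof (rule Suc.IH[OF sh])
    fix t assume t: "t \<in> K" "t \<noteq> 0"
    have t1: "\<bar>t\<bar> \<le> 1" using t(1) by (rule K_abs)
    have "complex_of_real t \<odot> ev (\<lambda>n. F (Suc n)) t = \<zero>"
      using ev_shift[OF Suc.prems(1) t1] Suc.prems(2)[OF t] ev_in[OF sh t1] by (simp add: F0)
    then have "\<bar>t\<bar> * nrm A (ev (\<lambda>n. F (Suc n)) t) = 0"
      using ev_in[OF sh t1] nrm_smult[of "ev (\<lambda>n. F (Suc n)) t" "complex_of_real t"] by simp
    then show "ev (\<lambda>n. F (Suc n)) t = \<zero>" using t ev_in[OF sh t1] by simp
  qed
qed

lemma ev_inj:
  assumes F: "F \<in> carrier P" and G: "G \<in> carrier P" and eq: "\<And>t. t \<in> K \<Longrightarrow> ev F t = ev G t"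
  shows "F = G"
proof
  fix n
  define H where "H = F \<oplus>\<^bsub>P\<^esub> (- 1) \<odot>\<^bsub>P\<^esub> G"
  have H: "H \<in> carrier P" unfolding H_def by (intro P_add_in P_smult_in F G)
  have ev0: "ev H t = \<zero>" if "t \<in> K" for t
    using F G eq[OF that] K_abs[OF that]
    by (simp add: H_def ev_add ev_smult P_smult_in r_neg flip: a_inv_smult)
  have "H n = \<zero>" by (rule coeff_zero[OF H ev0])
  then have "F n \<ominus> G n = \<zero>" by (simp add: H_def P_simps minus_smult P_in[OF F] P_in[OF G])
  then show "F n = G n" by (simp add: minus_eq_zero_iff P_in[OF F] P_in[OF G])
qed

text \<open>Evaluations at points of \<open>K\<close> separate series by the identity theorem. Hence
  associativity of the Cauchy product and the other laws follow pointwise, without rearranging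
  double sums.\<close>

lemma P_laws: "star_algebra_laws P"
proof (rule star_algebra_laws_inherit_inj[OF star_algebra_laws_axioms, where T = K and e = "\<lambda>t F. ev F t"])
  show "F = G" if "F \<in> carrier P" "G \<in> carrier P" "\<And>t. t \<in> K \<Longrightarrow> ev F t = ev G t" for F G
    using that by (rule ev_inj)
qed (simp_all add: P_zero_in P_add_in P_mult_in P_smult_in P_adj_in ev_zero ev_add ev_mult ev_smult ev_adj K_abs)

lemma ev_le_nrm:
  assumes "F \<in> carrier P" "t \<in> K"
  shows "nrm A (ev F t) \<le> nrm P F"
  unfolding P_simps
proof (rule cSUP_upper[OF assms(2)])
  show "bdd_above ((\<lambda>t. nrm A (ev F t)) ` K)"
    using ev_norm_le[OF assms(1)] K_abs by (intro bdd_aboveI2[of _ _ "\<Sum>n. nrm A (F n)"]) auto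
qed

lemma nrm_P_le: "(\<And>t. t \<in> K \<Longrightarrow> nrm A (ev F t) \<le> c) \<Longrightarrow> nrm P F \<le> c"
  unfolding P_simps by (intro cSUP_least K_nonempty)

lemma P_pre_cstar: "pre_cstar P"
proof (rule pre_cstar.intro[OF P_laws pre_cstar_axioms.intro])
  obtain t0 where t0: "t0 \<in> K" using K_nonempty by blast
  have nonneg: "0 \<le> nrm P F" if F: "F \<in> carrier P" for F
    using order_trans[OF nrm_nonneg[OF ev_in[OF F K_abs[OF t0]]] ev_le_nrm[OF F t0]] .
  fix F assume F: "F \<in> carrier P"
  show "0 \<le> nrm P F" using F by (rule nonneg)
  have ev_F: "ev F t \<in> carrier A" "\<bar>t\<bar> \<le> 1" if "t \<in> K" for t
    using ev_in[OF F K_abs[OF that]] K_abs[OF that] .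
  show "nrm P F = 0 \<longleftrightarrow> F = \<zero>\<^bsub>P\<^esub>"
  proof
    assume "nrm P F = 0"
    then have "nrm A (ev F t) = 0" if "t \<in> K" for t
      using ev_le_nrm[OF F that] nrm_nonneg[OF ev_F(1)[OF that]] by simp
    then show "F = \<zero>\<^bsub>P\<^esub>"
      using ev_F by (intro ev_inj[OF F P_zero_in]) (simp add: ev_zero)
  next
    assume "F = \<zero>\<^bsub>P\<^esub>"
    then have "nrm P F \<le> 0" by (intro nrm_P_le) (simp add: ev_zero K_abs)
    then show "nrm P F = 0" using nonneg[OF F] by simp
  qed
  have smult_le: "nrm P (c \<odot>\<^bsub>P\<^esub> G) \<le> cmod c * nrm P G" if G: "G \<in> carrier P" for c G
    by (rule nrm_P_le) (use ev_le_nrm[OF G] in \<open>simp add: ev_smult G K_abs mult_left_mono\<close>)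
  show "nrm P (c \<odot>\<^bsub>P\<^esub> F) = cmod c * nrm P F" for c
  proof (cases "c = 0")
    case True
    then show ?thesis using smult_le[OF F, of 0] nonneg[OF P_smult_in[OF F, of 0]] by simp
  next
    case False
    have "(1 / c) \<odot>\<^bsub>P\<^esub> (c \<odot>\<^bsub>P\<^esub> F) = F" using False by (simp add: P_simps smult_smult P_in[OF F])
    then have "nrm P F \<le> cmod (1 / c) * nrm P (c \<odot>\<^bsub>P\<^esub> F)"
      using smult_le[OF P_smult_in[OF F, of c], of "1 / c"] by simp
    then have "cmod c * nrm P F \<le> nrm P (c \<odot>\<^bsub>P\<^esub> F)"
      using False by (simp add: norm_divide field_simps)
    then show ?thesis using smult_le[OF F, of c] by simp
  qed
  show "nrm P (adj P F \<otimes>\<^bsub>P\<^esub> F) = (nrm P F)\<^sup>2"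
  proof (rule antisym)
    have evs: "nrm A (ev (adj P F \<otimes>\<^bsub>P\<^esub> F) t) = (nrm A (ev F t))\<^sup>2" if "t \<in> K" for t
      using F ev_F[OF that] by (simp add: ev_mult ev_adj P_adj_in cstar_identity)
    show "nrm P (adj P F \<otimes>\<^bsub>P\<^esub> F) \<le> (nrm P F)\<^sup>2"
      by (rule nrm_P_le) (use ev_le_nrm[OF F] ev_F in \<open>simp add: evs power_mono\<close>)
    have FF: "adj P F \<otimes>\<^bsub>P\<^esub> F \<in> carrier P" by (intro P_mult_in P_adj_in F)
    \<comment> \<open>Passing to square roots turns the pointwise C*-identity into an upper bound
      for all values, to which the supremum applies.\<close>
    have "nrm P F \<le> sqrt (nrm P (adj P F \<otimes>\<^bsub>P\<^esub> F))"
      by (rule nrm_P_le, rule real_le_rsqrt) (use ev_le_nrm[OF FF] in \<open>simp add: evs\<close>)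
    then have "(nrm P F)\<^sup>2 \<le> (sqrt (nrm P (adj P F \<otimes>\<^bsub>P\<^esub> F)))\<^sup>2"
      by (rule power_mono) (rule nonneg[OF F])
    then show "(nrm P F)\<^sup>2 \<le> nrm P (adj P F \<otimes>\<^bsub>P\<^esub> F)" using nonneg[OF FF] by simp
  qed
  fix G assume G: "G \<in> carrier P"
  have ev_G: "ev G t \<in> carrier A" if "t \<in> K" for t
    using ev_in[OF G K_abs[OF that]] .
  show "nrm P (F \<oplus>\<^bsub>P\<^esub> G) \<le> nrm P F + nrm P G"
  proof (rule nrm_P_le)
    fix t assume t: "t \<in> K"
    show "nrm A (ev (F \<oplus>\<^bsub>P\<^esub> G) t) \<le> nrm P F + nrm P G"
      unfolding ev_add[OF F G K_abs[OF t]]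
      by (rule order_trans[OF nrm_triangle add_mono]) (use F G t ev_F ev_G ev_le_nrm in auto)
  qed
  show "nrm P (F \<otimes>\<^bsub>P\<^esub> G) \<le> nrm P F * nrm P G"
  proof (rule nrm_P_le)
    fix t assume t: "t \<in> K"
    show "nrm A (ev (F \<otimes>\<^bsub>P\<^esub> G) t) \<le> nrm P F * nrm P G"
      unfolding ev_mult[OF F G K_abs[OF t]]
      by (rule order_trans[OF nrm_mult mult_mono]) (use F G t ev_F ev_G ev_le_nrm nonneg in auto)
  qed
qed

end

lemma star_hom_restrict:
  assumes "f \<in> star_hom A B" "S \<subseteq> carrier A" "\<And>x. x \<in> S \<Longrightarrow> f x \<in> T"
  shows "f \<in> star_hom (A\<lparr>carrier := S\<rparr>) (B\<lparr>carrier := T\<rparr>)"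
  by (rule star_homI) (simp_all add: assms(3) star_homD[OF assms(1)] subsetD[OF assms(2)])

section \<open>The closure of the series with zero constant term\<close>

context series_algebra
begin

sublocale P: pre_cstar P
  by (rule P_pre_cstar)

abbreviation "H1 \<equiv> hat1 K A"

definition P1 :: "(nat \<Rightarrow> 'a) set"
  where "P1 = {F \<in> carrier P. F 0 = \<zero>}"

lemma P1_iff: "F \<in> P1 \<longleftrightarrow> F \<in> carrier P \<and> F 0 = \<zero>"
  by (simp add: P1_def)

lemma P1_subalgebra: "star_subalgebra P1 P"
  unfolding star_subalgebra_def P1_def
  by (auto simp: P_zero_in P_add_in P_mult_in P_smult_in P_adj_in)
    (simp_all add: P_simps psum_Suc P_in)

text \<open>Every point of the closure has a representative lying in \<open>P1\<close> throughout,
  so lifting can be carried out on series with zero constant term.\<close>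

lemma hat1_carrier: "carrier H1 = P.cls ` {s. cauchy P s \<and> (\<forall>n. s n \<in> P1)}"
proof -
  have "P1 \<subseteq> carrier P" by (auto simp: P1_def)
  from P.closure_of_embed[OF this] show ?thesis
    by (simp add: hat1_def ps_completion_def P1_def)
qed

lemma hat1_eq: "H1 = P.CA\<lparr>carrier := carrier H1\<rparr>"
  by (simp add: hat1_def ps_completion_def)

lemma hat1_closed: "closedin (ntopology P.CA) (carrier H1)"
proof -
  interpret C: pre_cstar P.CA by (rule P.completion_pre_cstar)
  show ?thesis by (simp add: hat1_def ps_completion_def)
qed

lemma hat1_subalgebra: "star_subalgebra (carrier H1) P.CA"
proof -
  note S = P1_subalgebra[unfolded star_subalgebra_def]
  show ?thesis
    unfolding star_subalgebra_def
  proof (intro conjI ballI allI)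
    show "carrier H1 \<subseteq> carrier P.CA" unfolding hat1_carrier P.cls_carrier by blast
    show "\<zero>\<^bsub>P.CA\<^esub> \<in> carrier H1"
      unfolding hat1_carrier P.cls_zero using S P.conv_imp_cauchy[OF P.conv_const[OF P_zero_in]] by blast
    fix X assume "X \<in> carrier H1"
    then obtain s where s: "cauchy P s" "\<And>n. s n \<in> P1" "X = P.cls s" unfolding hat1_carrier by blast
    show "adj P.CA X \<in> carrier H1"
      unfolding s(3) P.cls_adj[OF s(1)] hat1_carrier using P.cauchy_adj[OF s(1)] s(2) S by blast
    show "c \<odot>\<^bsub>P.CA\<^esub> X \<in> carrier H1" for c
      unfolding s(3) P.cls_smult[OF s(1)] hat1_carrier using P.cauchy_smult[OF s(1)] s(2) S by blast
    fix Y assume "Y \<in> carrier H1"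
    then obtain t where t: "cauchy P t" "\<And>n. t n \<in> P1" "Y = P.cls t" unfolding hat1_carrier by blast
    show "X \<oplus>\<^bsub>P.CA\<^esub> Y \<in> carrier H1"
      unfolding s(3) t(3) P.cls_add[OF s(1) t(1)] hat1_carrier
      using P.cauchy_add[OF s(1) t(1)] s(2) t(2) S by blast
    show "X \<otimes>\<^bsub>P.CA\<^esub> Y \<in> carrier H1"
      unfolding s(3) t(3) P.cls_mult[OF s(1) t(1)] hat1_carrier
      using P.cauchy_mult[OF s(1) t(1)] s(2) t(2) S by blast
  qed
qed

lemma hat1_cstar: "cstar H1"
proof -
  interpret C: cstar P.CA by (rule P.completion_cstar)
  show ?thesis
    by (subst hat1_eq, rule C.cstar_restrict[OF hat1_subalgebra hat1_closed])
qed

lemma hat1_ops: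
  "\<zero>\<^bsub>H1\<^esub> = \<zero>\<^bsub>P.CA\<^esub>" "add H1 = add P.CA" "mult H1 = mult P.CA" "smult H1 = smult P.CA"
  "adj H1 = adj P.CA" "nrm H1 = nrm P.CA"
  by (simp_all add: hat1_def ps_completion_def)

lemma hat1E:
  assumes "X \<in> carrier H1"
  obtains s where "cauchy P s" "\<forall>n. s n \<in> P1" "X = P.cls s"
  using assms unfolding hat1_carrier by blast

lemma hat1I: "cauchy P s \<Longrightarrow> \<forall>n. s n \<in> P1 \<Longrightarrow> P.cls s \<in> carrier H1"
  unfolding hat1_carrier by blast

end

section \<open>Induced maps on power series and their closures\<close>

locale series_hom = A: series_algebra A K + B: series_algebra B K
  for A :: "('a, 'm) star_algebra_scheme" and B :: "('b, 'n) star_algebra_scheme" and K and f +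
  assumes f: "f \<in> star_hom A B"
begin

sublocale hom: star_hom_pair A B f
  by unfold_locales (rule f)

lemma f_contractive: "x \<in> carrier A \<Longrightarrow> nrm B (f x) \<le> nrm A x"
  by (rule star_hom_contractive[OF A.cstar_axioms B.pre_cstar_axioms f])

abbreviation tilde :: "(nat \<Rightarrow> 'a) \<Rightarrow> nat \<Rightarrow> 'b"
  where "tilde F \<equiv> \<lambda>n. f (F n)"

lemma tilde_in:
  assumes F: "F \<in> carrier A.P"
  shows "tilde F \<in> carrier B.P"
proof -
  have "summable (\<lambda>n. nrm B (f (F n)))"
    by (rule summable_comparison_test'[of "\<lambda>n. nrm A (F n)" 0])
      (use F f_contractive[OF A.P_in[OF F]] A.P_in[OF F] in \<open>simp_all add: A.P_carrier\<close>)
  then show ?thesis using A.P_in[OF F] by (simp add: B.P_carrier)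
qed

lemma tilde_P1: "F \<in> A.P1 \<Longrightarrow> tilde F \<in> B.P1"
  by (simp add: A.P1_iff B.P1_iff tilde_in)

lemma tilde_hom: "tilde \<in> star_hom A.P B.P"
proof (rule star_homI)
  fix F assume F: "F \<in> carrier A.P"
  note F_in = A.P_in[OF F]
  show "tilde F \<in> carrier B.P" using F by (rule tilde_in)
  show "tilde (c \<odot>\<^bsub>A.P\<^esub> F) = c \<odot>\<^bsub>B.P\<^esub> tilde F" for c
    unfolding A.P_simps B.P_simps using F_in by simp
  show "tilde (adj A.P F) = adj B.P (tilde F)"
    unfolding A.P_simps B.P_simps using F_in by simp
  fix G assume G: "G \<in> carrier A.P"
  note G_in = A.P_in[OF G]
  show "tilde (F \<oplus>\<^bsub>A.P\<^esub> G) = tilde F \<oplus>\<^bsub>B.P\<^esub> tilde G"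
    unfolding A.P_simps B.P_simps using F_in G_in by simp
  have "f (A.psum (\<lambda>k. F k \<otimes>\<^bsub>A\<^esub> G (n - k)) (Suc n))
      = B.psum (\<lambda>k. f (F k) \<otimes>\<^bsub>B\<^esub> f (G (n - k))) (Suc n)" for n
    using hom.hom_psum[of "\<lambda>k. F k \<otimes>\<^bsub>A\<^esub> G (n - k)" "Suc n"] F_in G_in by simp
  then show "tilde (F \<otimes>\<^bsub>A.P\<^esub> G) = tilde F \<otimes>\<^bsub>B.P\<^esub> tilde G"
    unfolding A.P_simps B.P_simps by (rule ext)
qed

lemma conv_map: "conv A s x \<Longrightarrow> conv B (\<lambda>n. f (s n)) (f x)"
proof (rule B.convI)
  assume s: "conv A s x"
  note in_A = A.conv_in(1)[OF s] A.conv_in(2)[OF s]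
  show "nrm B (f (s n) \<ominus>\<^bsub>B\<^esub> f x) \<le> nrm A (s n \<ominus>\<^bsub>A\<^esub> x)" for n
    using f_contractive[of "s n \<ominus>\<^bsub>A\<^esub> x"] in_A by simp
  show "(\<lambda>n. nrm A (s n \<ominus>\<^bsub>A\<^esub> x)) \<longlonglongrightarrow> 0" using s by (simp add: conv_def)
qed (simp_all add: conv_def)

text \<open>Contractivity makes \<open>f\<close> continuous, so it commutes with the limit of
  partial sums that defines evaluation.\<close>

lemma ev_tilde:
  assumes F: "F \<in> carrier A.P" and t: "\<bar>t\<bar> \<le> 1"
  shows "B.ev (tilde F) t = f (A.ev F t)"
proof (rule B.ev_eqI[OF tilde_in[OF F] t])
  show "conv B (B.psum (B.trm t (tilde F))) (f (A.ev F t))"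
    using conv_map[OF A.ev_conv[OF F t]] A.P_in[OF F] by (simp add: hom.hom_psum)
qed

lemma tilde_contractive:
  assumes F: "F \<in> carrier A.P"
  shows "nrm B.P (tilde F) \<le> nrm A.P F"
proof (rule B.nrm_P_le)
  fix t assume t: "t \<in> K"
  have "nrm B (B.ev (tilde F) t) \<le> nrm A (A.ev F t)"
    unfolding ev_tilde[OF F A.K_abs[OF t]] by (rule f_contractive[OF A.ev_in[OF F A.K_abs[OF t]]])
  also have "\<dots> \<le> nrm A.P F" by (rule A.ev_le_nrm[OF F t])
  finally show "nrm B (B.ev (tilde F) t) \<le> nrm A.P F" .
qed

sublocale ext: contractive_hom A.P B.P tilde
  by (rule contractive_hom.intro[OF A.P_pre_cstar B.P_pre_cstar
      contractive_hom_axioms.intro[OF tilde_hom tilde_contractive]])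

lemma hat1_map_cls:
  assumes "cauchy A.P s" "\<forall>n. s n \<in> A.P1"
  shows "hat1_map K A B f (A.P.cls s) = B.P.cls (\<lambda>n. tilde (s n))"
  unfolding hat1_map_def hat_map_def using A.hat1I[OF assms] ext.completion_map_cls[OF assms(1)] by simp

lemma hat1_map_in: "X \<in> carrier A.H1 \<Longrightarrow> hat1_map K A B f X \<in> carrier B.H1"
proof (erule A.hat1E)
  fix s assume s: "cauchy A.P s" "\<forall>n. s n \<in> A.P1" "X = A.P.cls s"
  show "hat1_map K A B f X \<in> carrier B.H1"
    unfolding s(3) hat1_map_cls[OF s(1,2)]
    using ext.cauchy_map[OF s(1)] s(2) tilde_P1 by (intro B.hat1I) auto
qed

lemma hat1_map_hom: "hat1_map K A B f \<in> star_hom A.H1 B.H1"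
proof (rule star_homI)
  have sub: "X \<in> carrier A.P.CA" if "X \<in> carrier A.H1" for X
    using that A.hat1_subalgebra by (auto simp: star_subalgebra_def)
  have eq: "hat1_map K A B f X = completion_map A.P B.P tilde X" if "X \<in> carrier A.H1" for X
    using that by (simp add: hat1_map_def hat_map_def)
  note S = A.hat1_subalgebra[unfolded star_subalgebra_def]
  fix X assume X: "X \<in> carrier A.H1"
  show "hat1_map K A B f X \<in> carrier B.H1" using X by (rule hat1_map_in)
  show "hat1_map K A B f (c \<odot>\<^bsub>A.H1\<^esub> X) = c \<odot>\<^bsub>B.H1\<^esub> hat1_map K A B f X" for c
    unfolding A.hat1_ops B.hat1_ops using S X star_homD(4)[OF ext.completion_map_hom sub[OF X]]
    by (simp add: eq)
  show "hat1_map K A B f (adj A.H1 X) = adj B.H1 (hat1_map K A B f X)"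
    unfolding A.hat1_ops B.hat1_ops using S X star_homD(5)[OF ext.completion_map_hom sub[OF X]]
    by (simp add: eq)
  fix Y assume Y: "Y \<in> carrier A.H1"
  show "hat1_map K A B f (X \<oplus>\<^bsub>A.H1\<^esub> Y) = hat1_map K A B f X \<oplus>\<^bsub>B.H1\<^esub> hat1_map K A B f Y"
    unfolding A.hat1_ops B.hat1_ops
    using S X Y star_homD(2)[OF ext.completion_map_hom sub[OF X] sub[OF Y]] by (simp add: eq)
  show "hat1_map K A B f (X \<otimes>\<^bsub>A.H1\<^esub> Y) = hat1_map K A B f X \<otimes>\<^bsub>B.H1\<^esub> hat1_map K A B f Y"
    unfolding A.hat1_ops B.hat1_ops
    using S X Y star_homD(3)[OF ext.completion_map_hom sub[OF X] sub[OF Y]] by (simp add: eq)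
qed

end

section \<open>Isometric embeddings\<close>

locale series_embedding = series_hom +
  assumes isometric: "x \<in> carrier A \<Longrightarrow> nrm B (f x) = nrm A x"
begin

lemma tilde_isometric:
  assumes F: "F \<in> carrier A.P"
  shows "nrm B.P (tilde F) = nrm A.P F"
  unfolding A.P_simps B.P_simps
  by (rule SUP_cong[OF refl])
    (simp add: ev_tilde[OF F A.K_abs] isometric A.ev_in[OF F A.K_abs])

text \<open>For exactness in the middle: a Cauchy sequence of series over \<open>B\<close> whose
  coefficients lie in the image of \<open>f\<close> is pulled back to a Cauchy sequence over
  \<open>A\<close>.\<close>

lemma cauchy_reflect:
  assumes "\<And>n. s n \<in> carrier A.P" "cauchy B.P (\<lambda>n. tilde (s n))"
  shows "cauchy A.P s"
proof -
  have "nrm B.P (tilde (s m) \<ominus>\<^bsub>B.P\<^esub> tilde (s n)) = nrm A.P (s m \<ominus>\<^bsub>A.P\<^esub> s n)" for m n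
    using ext.hom.hom_minus[OF assms(1) assms(1), of m n] tilde_isometric[of "s m \<ominus>\<^bsub>A.P\<^esub> s n"] assms(1)
    by simp
  then show ?thesis using assms unfolding cauchy_def by simp
qed

lemma hat1_map_isometric:
  assumes "X \<in> carrier A.H1"
  shows "nrm B.H1 (hat1_map K A B f X) = nrm A.H1 X"
  using assms
proof (rule A.hat1E)
  fix s assume s: "cauchy A.P s" "\<forall>n. s n \<in> A.P1" "X = A.P.cls s"
  have "(\<lambda>n. nrm B.P (tilde (s n))) \<longlonglongrightarrow> nrm A.P.CA (A.P.cls s)"
    using A.P.cls_norm_lim[OF s(1)] by (simp add: tilde_isometric A.P.cauchy_in[OF s(1)])
  then show ?thesis
    unfolding s(3) A.hat1_ops B.hat1_ops hat1_map_cls[OF s(1,2)]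
    by (rule B.P.cls_norm[OF ext.cauchy_map[OF s(1)]])
qed

lemma hat1_map_inj: "inj_on (hat1_map K A B f) (carrier A.H1)"
proof (rule inj_onI)
  interpret HA: cstar A.H1 by (rule A.hat1_cstar)
  interpret HB: cstar B.H1 by (rule B.hat1_cstar)
  interpret H: star_hom_pair A.H1 B.H1 "hat1_map K A B f" by unfold_locales (rule hat1_map_hom)
  fix X Y assume XY: "X \<in> carrier A.H1" "Y \<in> carrier A.H1" "hat1_map K A B f X = hat1_map K A B f Y"
  have "nrm A.H1 (X \<ominus>\<^bsub>A.H1\<^esub> Y) = nrm B.H1 (hat1_map K A B f (X \<ominus>\<^bsub>A.H1\<^esub> Y))"
    by (rule hat1_map_isometric[symmetric]) (simp add: XY)
  also have "\<dots> = 0" using XY by (simp add: HB.minus_eq HB.r_neg)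
  finally show "X = Y" using XY by (simp add: HA.minus_eq_zero_iff)
qed

end

section \<open>Lifting power series\<close>

text \<open>The polynomial part below degree \<open>n\<close> is Lipschitz, as
  \<open>\<bar>s ^ k - t ^ k\<bar> \<le> k * \<bar>s - t\<bar>\<close> on the unit interval around
  zero. Each of the two remainders is bounded by the tail of the coefficient norms.\<close>

lemma (in series_algebra) ev_minus_le:
  assumes F: "F \<in> carrier P" and s: "\<bar>s\<bar> \<le> 1" and t: "\<bar>t\<bar> \<le> 1"
  shows "nrm A (ev F s \<ominus> ev F t)
    \<le> real n * \<bar>s - t\<bar> * (\<Sum>k<n. nrm A (F k)) + 2 * ((\<Sum>k. nrm A (F k)) - (\<Sum>k<n. nrm A (F k)))"
proof -
  note F_in = P_in[OF F]
  have F_sum: "summable (\<lambda>k. nrm A (F k))" using F by (simp add: P_carrier)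
  have tail: "nrm A (psum (trm u F) n \<ominus> ev F u) \<le> (\<Sum>k. nrm A (F k)) - (\<Sum>k<n. nrm A (F k))"
    if u: "\<bar>u\<bar> \<le> 1" for u
  proof -
    have le: "nrm A (trm u F k) \<le> nrm A (F k)" for k by (rule trm_norm_le[where F = F, OF F_in u])
    have sm: "summable (\<lambda>k. nrm A (trm u F k))" by (rule trm_summable[OF F u])
    have "nrm A (psum (trm u F) n \<ominus> ev F u)
        \<le> (\<Sum>k. nrm A (trm u F k)) - (\<Sum>k<n. nrm A (trm u F k))"
      by (rule nrm_tail_le[OF _ ev_conv[OF F u] sm]) (simp add: F_in)
    also have "\<dots> = (\<Sum>k. nrm A (trm u F (k + n)))"
      using suminf_split_initial_segment[OF sm, of n] by simp
    also have "\<dots> \<le> (\<Sum>k. nrm A (F (k + n)))"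
      by (intro suminf_le le summable_ignore_initial_segment[OF sm] summable_ignore_initial_segment[OF F_sum])
    also have "\<dots> = (\<Sum>k. nrm A (F k)) - (\<Sum>k<n. nrm A (F k))"
      using suminf_split_initial_segment[OF F_sum, of n] by simp
    finally show ?thesis .
  qed
  have trm_diff: "nrm A (trm s F k \<ominus> trm t F k) \<le> real n * \<bar>s - t\<bar> * nrm A (F k)" if "k < n" for k
  proof -
    have "trm s F k \<ominus> trm t F k = complex_of_real (s ^ k - t ^ k) \<odot> F k"
      using smult_add_left[OF F_in[of k], of "complex_of_real (s ^ k)" "- complex_of_real (t ^ k)"]
      by (simp add: minus_smult F_in smult_smult)
    then have "nrm A (trm s F k \<ominus> trm t F k) = \<bar>s ^ k - t ^ k\<bar> * nrm A (F k)"
      using nrm_smult[OF F_in[of k], of "complex_of_real (s ^ k - t ^ k)"] by (simp only: norm_of_real real_norm_def)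
    also have "\<dots> \<le> (real k * \<bar>s - t\<bar>) * nrm A (F k)"
      using norm_power_diff[of s t k] s t by (intro mult_right_mono) (simp_all add: F_in)
    also have "\<dots> \<le> real n * \<bar>s - t\<bar> * nrm A (F k)"
      using that by (intro mult_right_mono) (simp_all add: F_in)
    finally show ?thesis .
  qed
  have "nrm A (psum (trm s F) n \<ominus> psum (trm t F) n) = nrm A (psum (\<lambda>k. trm s F k \<ominus> trm t F k) n)"
    by (subst psum_minus) (simp_all add: F_in)
  also have "\<dots> \<le> (\<Sum>k<n. nrm A (trm s F k \<ominus> trm t F k))"
    by (rule nrm_psum_le) (simp add: F_in)
  also have "\<dots> \<le> (\<Sum>k<n. real n * \<bar>s - t\<bar> * nrm A (F k))"
    by (rule sum_mono, rule trm_diff) simp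
  also have "\<dots> = real n * \<bar>s - t\<bar> * (\<Sum>k<n. nrm A (F k))" by (simp add: sum_distrib_left)
  finally have mid: "nrm A (psum (trm s F) n \<ominus> psum (trm t F) n) \<le> real n * \<bar>s - t\<bar> * (\<Sum>k<n. nrm A (F k))" .
  have cl: "ev F s \<in> carrier A" "ev F t \<in> carrier A" "psum (trm s F) n \<in> carrier A" "psum (trm t F) n \<in> carrier A"
    using ev_in[OF F s] ev_in[OF F t] by (simp_all add: F_in)
  have "nrm A (ev F s \<ominus> ev F t) \<le> nrm A (ev F s \<ominus> psum (trm s F) n)
      + (nrm A (psum (trm s F) n \<ominus> psum (trm t F) n) + nrm A (psum (trm t F) n \<ominus> ev F t))"
    using nrm_minus_triangle[OF cl(1,3,2)] nrm_minus_triangle[OF cl(3,4,2)] by linarith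
  moreover have "x \<le> m + 2 * r" if "x \<le> a + (b + c)" "a' \<le> r" "c \<le> r" "b \<le> m" "a = a'"
    for x a b c r m a' :: real
    using that by linarith
  ultimately show ?thesis
    using tail[OF s] tail[OF t] mid nrm_minus_commute[OF cl(1,3)] by blast
qed

lemma (in series_algebra) ev_uniformly_continuous:
  assumes F: "F \<in> carrier P" and e: "e > 0"
  shows "\<exists>d>0. \<forall>s t. \<bar>s\<bar> \<le> 1 \<longrightarrow> \<bar>t\<bar> \<le> 1 \<longrightarrow> \<bar>s - t\<bar> < d \<longrightarrow> nrm A (ev F s \<ominus> ev F t) < e"
proof -
  define S where "S = (\<Sum>k. nrm A (F k))"
  have "(\<lambda>n. \<Sum>k<n. nrm A (F k)) \<longlonglongrightarrow> S"
    unfolding S_def using F by (intro summable_LIMSEQ) (simp add: P_carrier)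
  \<comment> \<open>The two tails cost less than \<open>2 * (e / 4)\<close>, which leaves
    \<open>e / 2\<close> for the polynomial part.\<close>
  then have "\<forall>\<^sub>F n in sequentially. (\<Sum>k<n. nrm A (F k)) > S - e / 4"
    by (rule order_tendstoD(1)) (use e in simp)
  then obtain n where n: "(\<Sum>k<n. nrm A (F k)) > S - e / 4" by (auto simp: eventually_sequentially)
  define c where "c = real n * (\<Sum>k<n. nrm A (F k)) + 1"
  have c: "c > 0" unfolding c_def by (intro add_nonneg_pos mult_nonneg_nonneg sum_nonneg) (simp_all add: P_in[OF F])
  have "nrm A (ev F s \<ominus> ev F t) < e" if "\<bar>s\<bar> \<le> 1" "\<bar>t\<bar> \<le> 1" "\<bar>s - t\<bar> < e / (2 * c)" for s t
  proof -
    have "real n * \<bar>s - t\<bar> * (\<Sum>k<n. nrm A (F k)) \<le> \<bar>s - t\<bar> * c"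
      by (simp add: c_def algebra_simps)
    also have "\<dots> < e / (2 * c) * c" using that(3) c by (rule mult_strict_right_mono)
    also have "\<dots> = e / 2" using c by simp
    finally show ?thesis
      using ev_minus_le[OF F that(1,2), of n] n by (simp add: S_def)
  qed
  then show ?thesis using e c by (intro exI[of _ "e / (2 * c)"]) auto
qed

locale series_surjection = series_hom +
  assumes surj: "f ` carrier A = carrier B"
begin

sublocale sur: cstar_surjection A B f
  by (rule cstar_surjection.intro[OF A.cstar_axioms B.cstar_axioms
      cstar_surjection_axioms.intro[OF f surj]])

declare sur.quot.ideal_in [simp del]

lemma lift_series:
  assumes F: "F \<in> B.P1"
  shows "\<exists>H\<in>A.P1. tilde H = F \<and> nrm A.P H \<le> 2 * nrm B.P F"
proof (cases "nrm B.P F = 0")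
  case True
  then have "F = \<zero>\<^bsub>B.P\<^esub>" using F by (simp add: B.P1_iff)
  moreover have "\<zero>\<^bsub>A.P\<^esub> \<in> A.P1" "tilde \<zero>\<^bsub>A.P\<^esub> = \<zero>\<^bsub>B.P\<^esub>"
    by (simp_all add: A.P1_iff A.P_zero_in) (simp_all add: A.P_simps B.P_simps)
  ultimately show ?thesis using True by (intro bexI[of _ "\<zero>\<^bsub>A.P\<^esub>"]) simp_all
next
  case False
  have FP: "F \<in> carrier B.P" "F 0 = \<zero>\<^bsub>B\<^esub>" using F by (simp_all add: B.P1_iff)
  note F_in = B.P_in[OF FP(1)]
  \<comment> \<open>Three errors of size \<open>e\<close> occur: moving \<open>H\<close> from
    \<open>t\<close> to a net point, the slack in the compression there, and moving the image of
    \<open>G\<close> back to \<open>t\<close>. Added to \<open>nrm B.P F\<close> they give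
    \<open>2 * nrm B.P F\<close>.\<close>
  define e where "e = nrm B.P F / 3"
  have e: "e > 0" using False B.P.nrm_nonneg[OF FP(1)] by (simp add: e_def)
  obtain G where G: "\<And>n. G n \<in> carrier A" "\<And>n. f (G n) = F n" "\<And>n. nrm A (G n) \<le> 2 * nrm B (F n)"
    using sur.lift[OF F_in] by metis
  have "summable (\<lambda>n. nrm A (G n))"
    by (rule summable_comparison_test'[of "\<lambda>n. 2 * nrm B (F n)" 0])
      (use FP(1) G in \<open>simp_all add: B.P_carrier summable_mult\<close>)
  then have GP: "G \<in> carrier A.P" using G(1) by (simp add: A.P_carrier)
  \<comment> \<open>Choosing lifts with a norm bound forces the constant term to be zero, so the
    lift stays in \<open>P1\<close>.\<close>
  have G0: "G 0 = \<zero>\<^bsub>A\<^esub>"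
  proof -
    have "nrm A (G 0) = 0" using G(3)[of 0] A.nrm_nonneg[OF G(1)[of 0]] FP(2) by simp
    then show ?thesis using A.nrm_eq_0_iff[OF G(1)[of 0]] by simp
  qed
  have tG: "tilde G = F" using G(2) by (rule ext)
  obtain d where d: "d > 0" "\<And>s t. \<bar>s\<bar> \<le> 1 \<Longrightarrow> \<bar>t\<bar> \<le> 1 \<Longrightarrow> \<bar>s - t\<bar> < d \<Longrightarrow> nrm A (A.ev G s \<ominus>\<^bsub>A\<^esub> A.ev G t) < e"
    using A.ev_uniformly_continuous[OF GP e] by blast
  obtain T where T: "finite T" "T \<subseteq> {-1..1::real}" "{-1..1} \<subseteq> (\<Union>x\<in>T. ball x d)"
    using seq_compact_imp_totally_bounded[OF compact_imp_seq_compact[OF compact_Icc]] d(1) by meson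
  have T1: "\<bar>t\<bar> \<le> 1" if "t \<in> T" for t using subsetD[OF T(2) that] by (simp add: abs_le_iff)
  have "finite (A.ev G ` T)" "A.ev G ` T \<subseteq> carrier A" using T(1) T1 A.ev_in[OF GP] by auto
  from sur.compress_finite[OF this e] obtain u where u: "u \<in> a_kernel A B f"
    "\<And>z. z \<in> carrier A \<Longrightarrow> nrm A (z \<ominus>\<^bsub>A\<^esub> z \<otimes>\<^bsub>A\<^esub> u) \<le> nrm A z"
    "\<And>t. t \<in> T \<Longrightarrow> nrm A (A.ev G t \<ominus>\<^bsub>A\<^esub> A.ev G t \<otimes>\<^bsub>A\<^esub> u) < nrm B (f (A.ev G t)) + e"
    by blast
  have uA: "u \<in> carrier A" and fu: "f u = \<zero>\<^bsub>B\<^esub>" using u(1) by (simp_all add: sur.kernel_iff)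
  define H where "H = (\<lambda>n. G n \<ominus>\<^bsub>A\<^esub> G n \<otimes>\<^bsub>A\<^esub> u)"
  have HA: "H n \<in> carrier A" for n by (simp add: H_def G(1) uA)
  have "summable (\<lambda>n. nrm A (H n))"
    by (rule summable_comparison_test'[of "\<lambda>n. nrm A (G n)" 0])
      (use GP u(2)[OF G(1)] G(1) uA in \<open>simp_all add: A.P_carrier H_def\<close>)
  then have HP: "H \<in> carrier A.P" using HA by (simp add: A.P_carrier)
  have H1: "H \<in> A.P1" using HP by (simp add: A.P1_iff H_def G0 uA)
  have tH: "tilde H = F" using G(1,2) uA F_in by (simp add: H_def fu)
  have evH: "A.ev H t = A.ev G t \<ominus>\<^bsub>A\<^esub> A.ev G t \<otimes>\<^bsub>A\<^esub> u" if t: "\<bar>t\<bar> \<le> 1" for t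
  proof (rule A.ev_eqI[OF HP t])
    have "A.trm t H = (\<lambda>k. A.trm t G k \<ominus>\<^bsub>A\<^esub> A.trm t G k \<otimes>\<^bsub>A\<^esub> u)"
      by (simp add: H_def A.smult_minus A.smult_mult_left G(1) uA)
    then have "A.psum (A.trm t H) n = A.psum (A.trm t G) n \<ominus>\<^bsub>A\<^esub> A.psum (A.trm t G) n \<otimes>\<^bsub>A\<^esub> u" for n
      using G(1) uA by (simp add: A.psum_minus A.psum_mult_right)
    then show "conv A (A.psum (A.trm t H)) (A.ev G t \<ominus>\<^bsub>A\<^esub> A.ev G t \<otimes>\<^bsub>A\<^esub> u)"
      using A.conv_minus[OF A.ev_conv[OF GP t] A.conv_mult[OF A.ev_conv[OF GP t] A.conv_const[OF uA]]]
      by simp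
  qed
  have "nrm A.P H \<le> 2 * nrm B.P F"
  proof (rule A.nrm_P_le)
    fix t assume tK: "t \<in> K"
    have t: "\<bar>t\<bar> \<le> 1" using tK by (rule A.K_abs)
    then have "t \<in> (\<Union>x\<in>T. ball x d)" by (intro subsetD[OF T(3)]) (simp add: abs_le_iff)
    then obtain s where s: "s \<in> T" "\<bar>s - t\<bar> < d" by (auto simp: dist_real_def)
    note s1 = T1[OF s(1)]
    have cl: "A.ev G t \<in> carrier A" "A.ev G s \<in> carrier A" using A.ev_in[OF GP] t s1 by auto
    define D where "D = A.ev G t \<ominus>\<^bsub>A\<^esub> A.ev G s"
    have D: "D \<in> carrier A" "nrm A D < e"
      using cl d(2)[OF t s1] s(2) by (simp_all add: D_def abs_minus_commute)
    \<comment> \<open>The difference is that of \<open>G\<close> multiplied by the contraction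
      \<open>1 - u\<close>. So \<open>H\<close> has the modulus of continuity of \<open>G\<close>
      whatever \<open>u\<close> is, and \<open>d\<close> and the net could be fixed before
      \<open>u\<close>.\<close>
    have "A.ev H t \<ominus>\<^bsub>A\<^esub> A.ev H s = D \<ominus>\<^bsub>A\<^esub> D \<otimes>\<^bsub>A\<^esub> u"
    proof -
      have cl': "A.ev G t \<otimes>\<^bsub>A\<^esub> u \<in> carrier A" "A.ev G s \<otimes>\<^bsub>A\<^esub> u \<in> carrier A" using cl uA by auto
      obtain L where L: "A.coords L (A.ev G t) (A.ev G s) (A.ev G t \<otimes>\<^bsub>A\<^esub> u) (A.ev G s \<otimes>\<^bsub>A\<^esub> u)"
        by (rule A.linear4[OF cl cl'])
      note L = A.coordsD[OF L]
      show ?thesis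
        unfolding evH[OF t] evH[OF s1] D_def A.mult_minus_left[OF cl uA]
        by (simp only: L(3,4)) (simp add: L(1,2) L(6-9))
    qed
    then have "nrm A (A.ev H t \<ominus>\<^bsub>A\<^esub> A.ev H s) < e" using u(2)[OF D(1)] D(2) by simp
    moreover have "nrm A (A.ev H s) < nrm B (f (A.ev G s)) + e" using u(3)[OF s(1)] by (simp add: evH s1)
    \<comment> \<open>The net point \<open>s\<close> may lie outside \<open>K\<close>, where
      \<open>nrm B.P F\<close> gives no control; the estimate is therefore moved back to
      \<open>t\<close>.\<close>
    moreover have "nrm B (f (A.ev G s)) \<le> nrm B (f (A.ev G t)) + e"
    proof -
      have "nrm B (f (A.ev G s)) \<le> nrm B (f (A.ev G s \<ominus>\<^bsub>A\<^esub> A.ev G t)) + nrm B (f (A.ev G t))"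
        using B.nrm_diff_le[of "f (A.ev G s)" "f (A.ev G t)"] cl by simp
      moreover have "nrm B (f (A.ev G s \<ominus>\<^bsub>A\<^esub> A.ev G t)) \<le> nrm A (A.ev G s \<ominus>\<^bsub>A\<^esub> A.ev G t)"
        using cl by (intro f_contractive) simp
      ultimately show ?thesis using d(2)[OF s1 t s(2)] by linarith
    qed
    moreover have "nrm B (f (A.ev G t)) \<le> nrm B.P F"
      using B.ev_le_nrm[OF FP(1) tK] ev_tilde[OF GP t] tG by simp
    moreover have "nrm A (A.ev H t) \<le> nrm A (A.ev H t \<ominus>\<^bsub>A\<^esub> A.ev H s) + nrm A (A.ev H s)"
      by (rule A.nrm_diff_le[OF A.ev_in[OF HP t] A.ev_in[OF HP s1]])
    ultimately show "nrm A (A.ev H t) \<le> 2 * nrm B.P F" by (simp add: e_def)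
  qed
  with H1 tH show ?thesis by blast
qed

text \<open>The lifted sequence maps onto a subsequence of a given representative, and a subsequence
  of a Cauchy sequence represents the same class.\<close>

lemma hat1_map_surj: "hat1_map K A B f ` carrier A.H1 = carrier B.H1"
proof (intro equalityI subsetI)
  fix X assume "X \<in> hat1_map K A B f ` carrier A.H1"
  then show "X \<in> carrier B.H1" using hat1_map_in by blast
next
  fix X assume "X \<in> carrier B.H1"
  then obtain s where s: "cauchy B.P s" "\<forall>n. s n \<in> B.P1" "X = B.P.cls s" by (rule B.hat1E)
  \<comment> \<open>Lifting within the subalgebras \<open>P1\<close> keeps every increment, and
    hence the whole lift, at zero constant term.\<close>
  let ?M = "A.P\<lparr>carrier := A.P1\<rparr>" and ?N = "B.P\<lparr>carrier := B.P1\<rparr>"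
  have M: "pre_cstar ?M" and N: "pre_cstar ?N"
    using A.P.pre_cstar_restrict[OF A.P1_subalgebra] B.P.pre_cstar_restrict[OF B.P1_subalgebra] .
  have P1P: "F \<in> carrier A.P" if "F \<in> A.P1" for F using that by (simp add: A.P1_iff)
  have hom: "tilde \<in> star_hom ?M ?N"
    using P1P by (intro star_hom_restrict[OF tilde_hom _ tilde_P1]) blast
  have sN: "cauchy ?N s" using s(1,2) by (simp add: B.P.cauchy_restrict[OF B.P1_subalgebra])
  have lift: "\<exists>H\<in>carrier ?M. tilde H = F \<and> nrm ?M H \<le> 2 * nrm ?N F" if "F \<in> carrier ?N" for F
    using lift_series that by simp
  from cauchy_lift[OF M N hom lift sN] obtain r t where r: "strict_mono r"
    and t: "cauchy ?M t" and rt: "\<forall>k. tilde (t k) = s (r k)" by blast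
  have t': "cauchy A.P t" "\<forall>n. t n \<in> A.P1"
    using t by (simp_all add: A.P.cauchy_restrict[OF A.P1_subalgebra])
  have rt': "(\<lambda>k. tilde (t k)) = (\<lambda>k. s (r k))" using rt by (intro ext) metis
  have sr: "cauchy B.P (\<lambda>k. s (r k))" using ext.cauchy_map[OF t'(1)] unfolding rt' .
  have "B.P.null_diff (\<lambda>k. s (r k)) s"
    unfolding B.P.null_diff_def
  proof (rule LIMSEQ_I)
    fix e :: real assume "e > 0"
    then obtain N where N: "\<forall>m\<ge>N. \<forall>n\<ge>N. nrm B.P (s m \<ominus>\<^bsub>B.P\<^esub> s n) < e"
      using B.P.cauchyD[OF s(1)] by blast
    have "norm (nrm B.P (s (r n) \<ominus>\<^bsub>B.P\<^esub> s n) - 0) < e" if "n \<ge> N" for n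
      using N that seq_suble[OF r, of n] B.P.cauchy_in[OF s(1)] by simp
    then show "\<exists>N. \<forall>n\<ge>N. norm (nrm B.P (s (r n) \<ominus>\<^bsub>B.P\<^esub> s n) - 0) < e" by blast
  qed
  then have "B.P.cls (\<lambda>k. s (r k)) = B.P.cls s" using B.P.cls_eq_iff[OF sr s(1)] by simp
  then have "hat1_map K A B f (A.P.cls t) = X" by (simp only: hat1_map_cls[OF t'] rt' s(3))
  then show "X \<in> hat1_map K A B f ` carrier A.H1" using A.hat1I[OF t'] by blast
qed

end

section \<open>Exactness\<close>

text \<open>The image of \<open>f\<close> is the kernel of \<open>g\<close>, a closed ideal and
  hence itself a C*-algebra, so \<open>f\<close> is a bijective homomorphism between
  C*-algebras.\<close>

lemma short_exact_isometric:
  assumes ex: "short_exact A f B g C" and x: "x \<in> carrier A"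
  shows "nrm B (f x) = nrm A x"
proof -
  have A: "cstar A" and B: "cstar B" and C: "cstar C" and f: "f \<in> star_hom A B" and g: "g \<in> star_hom B C"
    and inj: "inj_on f (carrier A)" and im: "f ` carrier A = a_kernel B C g"
    using ex by (simp_all add: short_exact_def cstar_iff)
  interpret B: cstar B by (rule B)
  interpret C: cstar C by (rule C)
  have "closed_ideal (a_kernel B C g) B"
    by (rule closed_ideal_a_kernel[OF B.pre_cstar_axioms C.pre_cstar_axioms g
          star_hom_contractive[OF B C.pre_cstar_axioms g]])
  then have J: "cstar (B\<lparr>carrier := a_kernel B C g\<rparr>)" by (rule B.cstar_restrict_closed_ideal)
  have "f \<in> star_hom A (B\<lparr>carrier := a_kernel B C g\<rparr>)"
    by (rule star_homI) (simp_all add: star_homD[OF f] flip: im)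
  moreover have "bij_betw f (carrier A) (carrier (B\<lparr>carrier := a_kernel B C g\<rparr>))"
    using inj im by (simp add: bij_betw_def)
  ultimately show ?thesis using star_hom_bij_isometric[OF A J _ _ x] by simp
qed

lemma hat1_short_exact:
  assumes ex: "short_exact A f B g C" and K: "K \<subseteq> {-1..1}" "0 islimpt K"
  shows "short_exact (hat1 K A) (hat1_map K A B f) (hat1 K B) (hat1_map K B C g) (hat1 K C)"
proof -
  have cs: "cstar A" "cstar B" "cstar C" and f: "f \<in> star_hom A B" and g: "g \<in> star_hom B C"
    and im: "f ` carrier A = a_kernel B C g" and surj: "g ` carrier B = carrier C"
    using ex by (simp_all add: short_exact_def cstar_iff)
  have ser: "series_algebra A K" "series_algebra B K" "series_algebra C K"
    using cs K by (simp_all add: series_algebra_def series_algebra_axioms_def)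
  interpret f: series_embedding A B K f
    by (rule series_embedding.intro[OF series_hom.intro[OF ser(1,2) series_hom_axioms.intro[OF f]]
        series_embedding_axioms.intro[OF short_exact_isometric[OF ex]]])
  interpret g: series_surjection B C K g
    by (rule series_surjection.intro[OF series_hom.intro[OF ser(2,3) series_hom_axioms.intro[OF g]]
        series_surjection_axioms.intro[OF surj]])
  have zero_C: "\<zero>\<^bsub>hat1 K C\<^esub> = g.B.P.cls (\<lambda>n. \<zero>\<^bsub>g.B.P\<^esub>)"
    by (simp add: g.B.hat1_ops g.B.P.cls_zero)
  have zc: "cauchy g.B.P (\<lambda>n. \<zero>\<^bsub>g.B.P\<^esub>)"
    by (rule g.B.P.conv_imp_cauchy[OF g.B.P.conv_const[OF g.B.P_zero_in]])
  have gf: "g (f x) = \<zero>\<^bsub>C\<^esub>" if "x \<in> carrier A" for x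
    using that im by (auto simp: a_kernel_def')
  have "hat1_map K A B f ` carrier (hat1 K A) = a_kernel (hat1 K B) (hat1 K C) (hat1_map K B C g)"
  proof (intro equalityI subsetI)
    fix X assume "X \<in> hat1_map K A B f ` carrier (hat1 K A)"
    then obtain Y where Y: "Y \<in> carrier (hat1 K A)" "X = hat1_map K A B f Y" by blast
    from Y(1) obtain s where s: "cauchy f.A.P s" "\<forall>n. s n \<in> f.A.P1" "Y = f.A.P.cls s" by (rule f.A.hat1E)
    have fs: "cauchy f.B.P (\<lambda>n. f.tilde (s n))" "\<forall>n. f.tilde (s n) \<in> f.B.P1"
      using f.ext.cauchy_map[OF s(1)] s(2) f.tilde_P1 by auto
    have X: "X = f.B.P.cls (\<lambda>n. f.tilde (s n))" using Y(2) s f.hat1_map_cls[OF s(1,2)] by simp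
    have "g.tilde (f.tilde (s n)) = \<zero>\<^bsub>g.B.P\<^esub>" for n
      using gf f.A.P_in[OF f.A.P.cauchy_in[OF s(1)]] by (simp add: g.B.P_simps)
    then have "hat1_map K B C g X = \<zero>\<^bsub>hat1 K C\<^esub>"
      unfolding X g.hat1_map_cls[OF fs] zero_C by simp
    then show "X \<in> a_kernel (hat1 K B) (hat1 K C) (hat1_map K B C g)"
      using f.B.hat1I[OF fs] by (simp add: a_kernel_def' X)
  next
    fix X assume "X \<in> a_kernel (hat1 K B) (hat1 K C) (hat1_map K B C g)"
    then have X: "X \<in> carrier (hat1 K B)" "hat1_map K B C g X = \<zero>\<^bsub>hat1 K C\<^esub>"
      by (simp_all add: a_kernel_def')
    from X(1) obtain s where s: "cauchy f.B.P s" "\<forall>n. s n \<in> f.B.P1" "X = f.B.P.cls s" by (rule f.B.hat1E)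
    have gs: "cauchy g.B.P (\<lambda>n. g.tilde (s n))" by (rule g.ext.cauchy_map[OF s(1)])
    have gs1: "g.tilde (s n) \<in> g.B.P1" for n using s(2) g.tilde_P1 by blast
    have "g.B.P.cls (\<lambda>n. g.tilde (s n)) = g.B.P.cls (\<lambda>n. \<zero>\<^bsub>g.B.P\<^esub>)"
      using X(2) by (simp only: s(3) g.hat1_map_cls[OF s(1,2)] zero_C)
    then have "g.B.P.null_diff (\<lambda>n. g.tilde (s n)) (\<lambda>n. \<zero>\<^bsub>g.B.P\<^esub>)"
      using g.B.P.cls_eq_iff[OF gs zc] by simp
    then have gs0: "(\<lambda>n. nrm g.B.P (g.tilde (s n))) \<longlonglongrightarrow> 0"
      using g.B.P.cauchy_in[OF gs] by (simp add: g.B.P.null_diff_def)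
    \<comment> \<open>The images of the \<open>s n\<close> are only a null sequence. Subtracting
      lifts \<open>h n\<close> of them whose norms tend to zero gives an equivalent representative
      \<open>u\<close> of \<open>X\<close> whose images are exactly zero, so that all its
      coefficients lie in the image of \<open>f\<close>.\<close>
    have "\<forall>n. \<exists>h. h \<in> f.B.P1 \<and> g.tilde h = g.tilde (s n) \<and> nrm f.B.P h \<le> 2 * nrm g.B.P (g.tilde (s n))"
      using g.lift_series[OF gs1] by blast
    then obtain h where h: "\<And>n. h n \<in> f.B.P1" "\<And>n. g.tilde (h n) = g.tilde (s n)"
      "\<And>n. nrm f.B.P (h n) \<le> 2 * nrm g.B.P (g.tilde (s n))" by metis
    have hP: "h n \<in> carrier f.B.P" and sP: "s n \<in> carrier f.B.P" for n
      using h(1)[of n] f.B.P.cauchy_in[OF s(1), of n] by (simp_all add: f.B.P1_iff)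
    have h0: "conv f.B.P h \<zero>\<^bsub>f.B.P\<^esub>"
    proof (rule f.B.P.convI)
      show "nrm f.B.P (h n \<ominus>\<^bsub>f.B.P\<^esub> \<zero>\<^bsub>f.B.P\<^esub>) \<le> 2 * nrm g.B.P (g.tilde (s n))" for n
        using h(3)[of n] hP[of n] by simp
      show "(\<lambda>n. 2 * nrm g.B.P (g.tilde (s n))) \<longlonglongrightarrow> 0"
        using tendsto_mult_right_zero[OF gs0, of 2] .
    qed (simp_all add: hP f.B.P_zero_in)
    define u where "u n = s n \<ominus>\<^bsub>f.B.P\<^esub> h n" for n
    have uP: "u n \<in> carrier f.B.P" for n by (simp add: u_def hP sP)
    have u_coeff: "u n k = s n k \<ominus>\<^bsub>B\<^esub> h n k" for n k
      using f.B.P_in[OF hP] f.B.P_in[OF sP]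
      by (simp add: u_def f.B.P.minus_smult[OF sP hP] f.B.P_simps f.B.minus_smult)
    have u: "cauchy f.B.P u"
      unfolding u_def by (rule f.B.P.cauchy_minus[OF s(1) f.B.P.conv_imp_cauchy[OF h0]])
    have "u n k \<in> f ` carrier A" for n k
    proof -
      have "g (u n k) = \<zero>\<^bsub>C\<^esub>"
        using fun_cong[OF h(2)[of n], of k] f.B.P_in[OF hP] f.B.P_in[OF sP]
        by (simp add: u_coeff g.B.minus_eq g.B.r_neg)
      then show ?thesis using f.B.P_in[OF uP] by (simp add: im a_kernel_def')
    qed
    then have "\<forall>n k. \<exists>x. x \<in> carrier A \<and> f x = u n k" by (metis imageE)
    then obtain a where a: "\<And>n k. a n k \<in> carrier A" "\<And>n k. f (a n k) = u n k" by metis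
    have au: "f.tilde (a n) = u n" for n using a(2) by (rule ext)
    \<comment> \<open>Isometry of \<open>f\<close> carries summability and the vanishing of the
      constant term back from \<open>u n\<close> to its coefficientwise preimage.\<close>
    have aP1: "a n \<in> f.A.P1" for n
    proof -
      have "summable (\<lambda>k. nrm A (a n k))"
        using uP[of n] f.isometric[OF a(1)] by (simp add: f.B.P_carrier a(2))
      moreover have "nrm A (a n 0) = 0"
        using f.isometric[OF a(1), of n 0] h(1)[of n] s(2)
        by (simp add: a(2) u_coeff f.B.P1_iff)
      ultimately show ?thesis using a(1) by (simp add: f.A.P1_iff f.A.P_carrier)
    qed
    have "cauchy f.A.P a"
      by (rule f.cauchy_reflect) (use aP1 u in \<open>simp_all add: f.A.P1_iff au\<close>)
    then have aH: "f.A.P.cls a \<in> carrier (hat1 K A)"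
      and "hat1_map K A B f (f.A.P.cls a) = f.B.P.cls (\<lambda>n. f.tilde (a n))"
      using aP1 f.A.hat1I f.hat1_map_cls by blast+
    then have fa: "hat1_map K A B f (f.A.P.cls a) = f.B.P.cls u" by (simp only: au)
    have "f.B.P.null_diff u s"
    proof (rule f.B.P.null_diffI)
      show "nrm f.B.P (u n \<ominus>\<^bsub>f.B.P\<^esub> s n) \<le> 2 * nrm g.B.P (g.tilde (s n))" for n
        using h(3)[of n] hP[of n] sP[of n] by (simp add: u_def f.B.P.add_minus_cancel)
      show "(\<lambda>n. 2 * nrm g.B.P (g.tilde (s n))) \<longlonglongrightarrow> 0"
        using tendsto_mult_right_zero[OF gs0, of 2] .
    qed (simp_all add: uP sP)
    then have "f.B.P.cls u = X" using f.B.P.cls_eq_iff[OF u s(1)] by (simp add: s(3))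
    with fa aH show "X \<in> hat1_map K A B f ` carrier (hat1 K A)" by (metis image_eqI)
  qed
  then show ?thesis
    unfolding short_exact_def cstar_iff[symmetric]
    using f.A.hat1_cstar f.B.hat1_cstar g.B.hat1_cstar f.hat1_map_hom g.hat1_map_hom
      f.hat1_map_inj g.hat1_map_surj by blast
qed

text \<open>The statement about quotients results from applying the functor to this sequence and
  then the first isomorphism theorem to its image.\<close>

lemma short_exact_quotient:
  assumes A: "cstar A" and I: "closed_ideal I A"
  shows "short_exact (A\<lparr>carrier := I\<rparr>) (\<lambda>x. x) A (\<lambda>x. I +>\<^bsub>A\<^esub> x) (quotient_algebra A I)"
proof -
  interpret cstar_with_ideal A I
    by (rule cstar_with_ideal.intro[OF A cstar_with_ideal_axioms.intro[OF I]])
  have "(\<lambda>x. x) \<in> star_hom (A\<lparr>carrier := I\<rparr>) A"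
    by (rule star_homI) simp_all
  moreover have "I = a_kernel A Q (\<lambda>x. I +>\<^bsub>A\<^esub> x)"
  proof (rule Set.set_eqI)
    fix x
    show "x \<in> I \<longleftrightarrow> x \<in> a_kernel A Q (\<lambda>x. I +>\<^bsub>A\<^esub> x)"
    proof (cases "x \<in> carrier A")
      case True
      then show ?thesis by (simp add: a_kernel_def' Q_simps(2) coset_eq_iff)
    next
      case False
      then show ?thesis using ideal_in[of x] unfolding a_kernel_def' by blast
    qed
  qed
  ultimately show ?thesis
    using cstar_restrict_closed_ideal[OF I] A Q_cstar coset_hom
    by (simp add: short_exact_def Q_simps flip: cstar_iff)
qed

lemma short_exact_star_isomorphic:
  assumes "short_exact A f B g C"
  shows "star_isomorphic C (quotient_algebra B (f ` carrier A))"
proof -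
  have B: "cstar B" and C: "cstar C" and g: "g \<in> star_hom B C"
    and im: "f ` carrier A = a_kernel B C g" and surj: "g ` carrier B = carrier C"
    using assms by (simp_all add: short_exact_def cstar_iff)
  interpret g: cstar_surjection B C g
    by (rule cstar_surjection.intro[OF B C cstar_surjection_axioms.intro[OF g surj]])
  show ?thesis
    unfolding star_isomorphic_def im
    using star_hom_inv_into[OF g.quot.Q_laws g.B.star_algebra_laws_axioms g.first_isomorphism]
      bij_betw_inv_into[OF g.first_isomorphism(2)] by blast
qed

lemma series_algebraI:
  "cstar_algebra A \<Longrightarrow> K \<subseteq> {-1..1} \<Longrightarrow> 0 islimpt K \<Longrightarrow> series_algebra A K"
  by (simp add: series_algebra_def series_algebra_axioms_def cstar_iff)

lemma series_homI:
  "K \<subseteq> {-1..1} \<Longrightarrow> 0 islimpt K \<Longrightarrow> cstar_algebra A \<Longrightarrow> cstar_algebra B \<Longrightarrow> f \<in> star_hom A B \<Longrightarrow>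
    series_hom A B K f"
  by (intro series_hom.intro series_hom_axioms.intro series_algebraI)

text \<open>Besides exactness, functoriality is spelled out: values on objects and morphisms,
  identities and composition. As \<open>hat1_map\<close> is restricted to the carrier, these laws
  are equations between extensional functions, stated with a restricted identity and
  \<open>compose\<close>.\<close>

theorem corollary2:
  fixes K :: "real set"
    and A :: "'a star_algebra" and B :: "'b star_algebra" and C :: "'c star_algebra"
  assumes "K \<subseteq> {-1..1}" and "0 islimpt K"
  shows
    "(\<forall>f g. short_exact A f B g C \<longrightarrow>
        short_exact (hat1 K A) (hat1_map K A B f) (hat1 K B) (hat1_map K B C g) (hat1 K C)) \<and>
     (cstar_algebra A \<longrightarrow>
        cstar_algebra (hat1 K A) \<and>
        hat1_map K A A (\<lambda>x. x) = (\<lambda>x \<in> carrier (hat1 K A). x)) \<and>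
     (\<forall>f g. cstar_algebra A \<and> cstar_algebra B \<and> cstar_algebra C \<and>
        f \<in> star_hom A B \<and> g \<in> star_hom B C \<longrightarrow>
        hat1_map K A B f \<in> star_hom (hat1 K A) (hat1 K B) \<and>
        hat1_map K A C (g \<circ> f) =
          compose (carrier (hat1 K A)) (hat1_map K B C g) (hat1_map K A B f)) \<and>
     (\<forall>I. cstar_algebra A \<and> closed_ideal I A \<longrightarrow>
        star_isomorphic (hat1 K (quotient_algebra A I))
          (quotient_algebra (hat1 K A) (hat1_ideal K A I)))"
proof (intro conjI allI impI)
  fix f g assume "short_exact A f B g C"
  then show "short_exact (hat1 K A) (hat1_map K A B f) (hat1 K B) (hat1_map K B C g) (hat1 K C)"
    using assms by (rule hat1_short_exact)
  next
  assume A: "cstar_algebra A"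
  interpret A: series_algebra A K by (rule series_algebraI[OF A assms])
  show "cstar_algebra (hat1 K A)" using A.hat1_cstar by (simp add: cstar_iff)
  have id: "(\<lambda>x. x) \<in> star_hom A A" by (rule star_homI) (assumption | rule refl)+
  show "hat1_map K A A (\<lambda>x. x) = (\<lambda>x\<in>carrier (hat1 K A). x)"
  proof (rule extensionalityI)
    show "hat1_map K A A (\<lambda>x. x) \<in> extensional (carrier (hat1 K A))" by (simp add: hat1_map_def)
    fix X assume X: "X \<in> carrier (hat1 K A)"
    then obtain s where s: "cauchy A.P s" "\<forall>n. s n \<in> A.P1" "X = A.P.cls s" by (rule A.hat1E)
    show "hat1_map K A A (\<lambda>x. x) X = (\<lambda>x\<in>carrier (hat1 K A). x) X"
      using X series_hom.hat1_map_cls[OF series_homI[OF assms A A id] s(1,2)] by (simp add: s(3))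
  qed simp
  next
  fix f g
  assume "cstar_algebra A \<and> cstar_algebra B \<and> cstar_algebra C \<and> f \<in> star_hom A B \<and> g \<in> star_hom B C"
  then have cs: "cstar_algebra A" "cstar_algebra B" "cstar_algebra C"
    and fg: "f \<in> star_hom A B" "g \<in> star_hom B C" by blast+
  interpret f: series_hom A B K f by (rule series_homI[OF assms cs(1,2) fg(1)])
  interpret g: series_hom B C K g by (rule series_homI[OF assms cs(2,3) fg(2)])
  show "hat1_map K A B f \<in> star_hom (hat1 K A) (hat1 K B)" by (rule f.hat1_map_hom)
  interpret gf: series_hom A C K "g \<circ> f"
    by (rule series_homI[OF assms cs(1,3)]) (simp add: star_homI star_homD[OF fg(1)] star_homD[OF fg(2)])
  show "hat1_map K A C (g \<circ> f)
      = compose (carrier (hat1 K A)) (hat1_map K B C g) (hat1_map K A B f)"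
  proof (rule extensionalityI)
    show "hat1_map K A C (g \<circ> f) \<in> extensional (carrier (hat1 K A))" by (simp add: hat1_map_def)
    fix X assume X: "X \<in> carrier (hat1 K A)"
    then obtain s where s: "cauchy f.A.P s" "\<forall>n. s n \<in> f.A.P1" "X = f.A.P.cls s" by (rule f.A.hat1E)
    have fs: "cauchy f.B.P (\<lambda>n. f.tilde (s n))" "\<forall>n. f.tilde (s n) \<in> f.B.P1"
      using f.ext.cauchy_map[OF s(1)] s(2) f.tilde_P1 by auto
    have "hat1_map K A C (g \<circ> f) X = hat1_map K B C g (hat1_map K A B f X)"
      unfolding s(3) f.hat1_map_cls[OF s(1,2)] g.hat1_map_cls[OF fs] gf.hat1_map_cls[OF s(1,2)]
      by simp
    then show "hat1_map K A C (g \<circ> f) X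
        = compose (carrier (hat1 K A)) (hat1_map K B C g) (hat1_map K A B f) X"
      using X by (simp add: compose_eq)
  qed (rule compose_extensional)
  next
  fix I assume "cstar_algebra A \<and> closed_ideal I A"
  then have "short_exact (A\<lparr>carrier := I\<rparr>) (\<lambda>x. x) A (\<lambda>x. I +>\<^bsub>A\<^esub> x) (quotient_algebra A I)"
    by (simp add: short_exact_quotient cstar_iff)
  \<comment> \<open>\<open>hat1_ideal\<close> is by definition the image of the first map of the
    resulting sequence, so the isomorphism already has the required form.\<close>
  from short_exact_star_isomorphic[OF hat1_short_exact[OF this assms]]
  show "star_isomorphic (hat1 K (quotient_algebra A I)) (quotient_algebra (hat1 K A) (hat1_ideal K A I))"
    by (simp only: hat1_ideal_def)
qed

end
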